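(* Let $\mathcal{K}$ be a tame knot class in $\mathbb{R}^3$. For $n\ge 3$ define $\mathcal{F}_n:\mathcal{C}(\mathcal{K})\to[0,\infty]$ by $\mathcal{F}_n(\gamma)=\Delta_n[\gamma]^{-1}$ if $\gamma\in\mathcal{P}_n(\mathcal{K})$ and $\mathcal{F}_n(\gamma)=+\infty$ otherwise, and define $\mathcal{F}:\mathcal{C}(\mathcal{K})\to[0,\infty]$ by $\mathcal{F}(\gamma)=\Delta[\gamma]^{-1}$. Then $\mathcal{F}_n$ $\Gamma$-converges to $\mathcal{F}$ on the space $\mathcal{C}(\mathcal{K})$ equipped with the topology induced by the norm $\|\cdot\|_{W^{1,\infty}(\mathbb{S}_1,\mathbb{R}^3)}$. That is: (i) for every sequence $\gamma_n\to\gamma$ in $\mathcal{C}(\mathcal{K})$ (w.r.t. $\|\cdot\|_{W^{1,\infty}}$) one has $\mathcal{F}(\gamma)\le\liminf_{n\to\infty}\mathcal{F}_n(\gamma_n)$; (ii) for every $\gamma\in\mathcal{C}(\mathcal{K})$ there exist $\gamma_n\in\mathcal{C}(\mathcal{K})$ with $\gamma_n\to\gamma$ in $W^{1,\infty}$ and $\limsup_{n\to\infty}\mathcal{F}_n(\gamma_n)\le\mathcal{F}(\gamma)$.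
   Context: $\mathbb{S}_1=\mathbb{R}/\mathbb{Z}$ is the circle of length $1$. $\mathcal{C}$ denotes the set of curves $\gamma\in W^{1,\infty}(\mathbb{S}_1,\mathbb{R}^d)$ with $|\gamma'|=1$ a.e. (arc length parametrised, length $1$); here $d=3$. For pairwise distinct $x,y,z\in\mathbb{R}^d$, $r(x,y,z)$ is the radius of the unique circle through $x,y,z$ ($=\infty$ if collinear). The thickness is $\Delta[\gamma]=\inf\{r(x,y,z): x,y,z\in\gamma(\mathbb{S}_1)\text{ pairwise distinct}\}$, and $\Delta[\gamma]^{-1}=1/\Delta[\gamma]\in[0,\infty]$ (with $1/0=\infty$). $\mathcal{P}_n\subset\mathcal{C}$ is the set of arc length parametrisations of closed equilateral polygons with $n$ edges (each of length $1/n$); if $x_1,\dots,x_n$ are the consecutive vertices, set $x_0=x_n$, $x_{n+1}=x_1$. For consecutive vertices $x,y,z$ let $\phi=\measuredangle(y-x,z-y)\in[0,\pi]$ be the exterior angle at $y$ and $\kappa_d(x,y,z)=\frac{2\tan(\phi/2)}{(|x-y|+|z-y|)/2}$. Set $\mathrm{maxCurv}(p)=\max_{i}\kappa_d(x_{i-1},x_i,x_{i+1})$ and $\mathrm{minRad}(p)=1/\mathrm{maxCurv}(p)$. The set $\mathrm{dcrit}(p)$ of doubly critical pairs consists of pairs $(x,y)$ of distinct points $x=p(t)$, $y=p(s)$ such that $s$ is a local extremum of $u\mapsto|p(t)-p(u)|^2$ and $t$ is a local extremum of $v\mapsto|p(v)-p(s)|^2$; $\mathrm{dcsd}(p)=\min_{(x,y)\in\mathrm{dcrit}(p)}|x-y|$.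 The discrete thickness is $\Delta_n[p]=\min\{\mathrm{minRad}(p),\tfrac12\mathrm{dcsd}(p)\}$ if all vertices of $p$ are pairwise distinct, and $\Delta_n[p]=0$ otherwise; $\Delta_n[p]^{-1}=1/\Delta_n[p]$. A tame knot class $\mathcal{K}$ is an ambient isotopy class of tame knots in $\mathbb{R}^3$ (knots ambient isotopic to polygonal knots). $\mathcal{C}(\mathcal{K})$ (resp. $\mathcal{P}_n(\mathcal{K})$) is the set of injective $\gamma\in\mathcal{C}$ (resp. $\mathcal{P}_n$) whose image is a knot in $\mathcal{K}$. *)

theory Defs
  imports "HOL-Analysis.Analysis"
begin

type_synonym R3 = "real ^ 3"
type_synonym curve = "real \<Rightarrow> R3"

section \<open>Curves on S_1 = R/Z (represented as 1-periodic maps R -> R^3)\<close>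

definition periodic1 :: "curve \<Rightarrow> bool" where
  "periodic1 \<gamma> \<longleftrightarrow> (\<forall>t. \<gamma> (t + 1) = \<gamma> t)"

text \<open>The class C: arc length parametrised closed curves of length 1 in W^{1,infty}
  (W^{1,infty} maps of the circle are the Lipschitz ones), with |gamma'| = 1 a.e.\<close>
definition arclength_curves :: "curve set" where
  "arclength_curves = {\<gamma>. periodic1 \<gamma> \<and> (\<exists>L. lipschitz_on L UNIV \<gamma>) \<and>
      (AE t in lebesgue. \<gamma> differentiable (at t) \<and> norm (vector_derivative \<gamma> (at t)) = 1)}"

definition w1inf_norm :: "curve \<Rightarrow> real" where
  "w1inf_norm f = (SUP t\<in>{0..1}. norm (f t)) +
     Inf {C. 0 \<le> C \<and> (AE t in lebesgue_on {0..1}. norm (vector_derivative f (at t)) \<le> C)}"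

definition w1inf_dist :: "curve \<Rightarrow> curve \<Rightarrow> real" where
  "w1inf_dist \<gamma> \<eta> = w1inf_norm (\<lambda>t. \<gamma> t - \<eta> t)"

definition circumradius :: "R3 \<Rightarrow> R3 \<Rightarrow> R3 \<Rightarrow> ereal" where
  "circumradius x y z = (if collinear {x, y, z} then \<infinity> else
     ereal (THE R. \<exists>c\<in>affine hull {x, y, z}. dist c x = R \<and> dist c y = R \<and> dist c z = R))"

definition thickness :: "curve \<Rightarrow> ereal" where
  "thickness \<gamma> = Inf {circumradius x y z | x y z.
      x \<in> \<gamma> ` {0..1} \<and> y \<in> \<gamma> ` {0..1} \<and> z \<in> \<gamma> ` {0..1} \<and> x \<noteq> y \<and> y \<noteq> z \<and> x \<noteq> z}"

definition polygon_data :: "nat \<Rightarrow> curve \<Rightarrow> (nat \<Rightarrow> R3) \<Rightarrow> real \<Rightarrow> bool" where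
  "polygon_data n p v s0 \<longleftrightarrow> 0 < n \<and> (\<forall>k. v k = v (k mod n)) \<and>
     (\<forall>k. norm (v (Suc k) - v k) = 1 / real n) \<and>
     (\<forall>k (a::real). 0 \<le> a \<and> a \<le> 1 \<longrightarrow>
         p (s0 + (real k + a) / real n) = (1 - a) *\<^sub>R v k + a *\<^sub>R v (Suc k))"

definition polygons :: "nat \<Rightarrow> curve set" where
  "polygons n = {p. p \<in> arclength_curves \<and> (\<exists>v s0. polygon_data n p v s0)}"

definition ext_angle :: "R3 \<Rightarrow> R3 \<Rightarrow> R3 \<Rightarrow> real" where
  "ext_angle x y z = arccos (((y - x) \<bullet> (z - y)) / (norm (y - x) * norm (z - y)))"

definition disc_curv :: "R3 \<Rightarrow> R3 \<Rightarrow> R3 \<Rightarrow> ereal" where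
  "disc_curv x y z = (if ext_angle x y z = pi then \<infinity> else
     ereal (2 * tan (ext_angle x y z / 2) / ((dist x y + dist z y) / 2)))"

definition maxCurv :: "nat \<Rightarrow> (nat \<Rightarrow> R3) \<Rightarrow> ereal" where
  "maxCurv n v = Max {disc_curv (v (i - 1)) (v i) (v (Suc i)) | i. i \<in> {1..n}}"

definition minRad :: "nat \<Rightarrow> (nat \<Rightarrow> R3) \<Rightarrow> ereal" where
  "minRad n v = inverse (maxCurv n v)"

definition local_extremum :: "(real \<Rightarrow> real) \<Rightarrow> real \<Rightarrow> bool" where
  "local_extremum f s \<longleftrightarrow> (\<exists>e>0. (\<forall>u. \<bar>u - s\<bar> < e \<longrightarrow> f u \<le> f s)
                                 \<or> (\<forall>u. \<bar>u - s\<bar> < e \<longrightarrow> f s \<le> f u))"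

definition dcrit :: "curve \<Rightarrow> (R3 \<times> R3) set" where
  "dcrit p = {(p t, p s) | t s. p t \<noteq> p s \<and>
      local_extremum (\<lambda>u. (norm (p t - p u))\<^sup>2) s \<and>
      local_extremum (\<lambda>w. (norm (p w - p s))\<^sup>2) t}"

definition dcsd :: "curve \<Rightarrow> ereal" where
  "dcsd p = Inf {ereal (dist x y) | x y. (x, y) \<in> dcrit p}"

text \<open>Discrete thickness (independent of the choice of vertex labelling / start parameter).\<close>
definition disc_thickness :: "nat \<Rightarrow> curve \<Rightarrow> ereal" where
  "disc_thickness n p = (let v = (SOME v. \<exists>s0. polygon_data n p v s0) in
     if inj_on v {1..n} then min (minRad n v) (dcsd p / 2) else 0)"

definition is_knot :: "R3 set \<Rightarrow> bool" where
  "is_knot K \<longleftrightarrow> K homeomorphic (sphere (0::real^2) 1)"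

definition ambient_isotopic :: "R3 set \<Rightarrow> R3 set \<Rightarrow> bool" where
  "ambient_isotopic K1 K2 \<longleftrightarrow> (\<exists>H :: real \<times> R3 \<Rightarrow> R3.
      continuous_on ({0..1} \<times> UNIV) H \<and>
      (\<forall>t\<in>{0..1}. \<exists>g. homeomorphism UNIV UNIV (\<lambda>x. H (t, x)) g) \<and>
      (\<forall>x. H (0, x) = x) \<and> (\<lambda>x. H (1, x)) ` K1 = K2)"

definition polygonal_knot :: "R3 set \<Rightarrow> bool" where
  "polygonal_knot K \<longleftrightarrow> is_knot K \<and>
     (\<exists>S. finite S \<and> K = (\<Union>(a, b)\<in>S. closed_segment a b))"

definition tame_knot :: "R3 set \<Rightarrow> bool" where
  "tame_knot K \<longleftrightarrow> is_knot K \<and> (\<exists>P. polygonal_knot P \<and> ambient_isotopic K P)"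

definition tame_knot_class :: "R3 set set \<Rightarrow> bool" where
  "tame_knot_class \<K> \<longleftrightarrow> (\<exists>K0. tame_knot K0 \<and> \<K> = {K. is_knot K \<and> ambient_isotopic K0 K})"

definition curves_in :: "R3 set set \<Rightarrow> curve set" where
  "curves_in \<K> = {\<gamma>. \<gamma> \<in> arclength_curves \<and> inj_on \<gamma> {0..<1} \<and> \<gamma> ` {0..1} \<in> \<K>}"

definition polygons_in :: "nat \<Rightarrow> R3 set set \<Rightarrow> curve set" where
  "polygons_in n \<K> = polygons n \<inter> curves_in \<K>"

definition F_n :: "R3 set set \<Rightarrow> nat \<Rightarrow> curve \<Rightarrow> ereal" where
  "F_n \<K> n \<gamma> = (if \<gamma> \<in> polygons_in n \<K> then inverse (disc_thickness n \<gamma>) else \<infinity>)"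

definition F_lim :: "curve \<Rightarrow> ereal" where
  "F_lim \<gamma> = inverse (thickness \<gamma>)"

end

(* Both inequalities rest on the polynomial form of "the circumradius is at least rho",
   4 rho^2 gram(y-x, z-x) <= |y-x|^2 |z-x|^2 |z-y|^2, which is closed under limits.

   Liminf: a curvature bound 1/rho on the polygons bounds the angle between any two edges, so the
   limit curve is C^1 with T(u).T(v) >= cos(|u-v|/rho).  Hence short arcs have chords at least as long
   as on a circle of radius rho, and the chord makes an angle at most (arc length)/(2 rho) with the end
   tangents, so triples on arcs of length at most pi rho are fine.  If two points at arc
   distance at least pi rho were closer than 2 rho, the distance function of a nearby polygon would have
   an interior minimum, a doubly critical pair shorter than 2 rho.  The remaining triples go around
   the curve with all gaps below pi rho; they are compared with an acute triangle in a circle of radius rho.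

   Limsup: positive thickness forces the curve to be C^1.  Inscribed equilateral polygons, rescaled to
   length 1, converge in W^{1,infinity}; their vertices inherit the circumradius bound, which
   controls the discrete curvature, and at a doubly critical pair the chord is almost orthogonal to the
   tangent of the curve, whence it has length almost 2 rho.  A perturbation with small
   Lipschitz constant relative to a bilipschitz curve extends to a map G of space with Lipschitz
   constant below 1, and x + t G(x) is an ambient isotopy. *)
theory Submission
  imports Defs
begin

section \<open>Lipschitz functions with almost everywhere bounded derivative\<close>

text \<open>All curves are merely Lipschitz, so derivatives exist only almost everywhere, and no
  curvature of the polygons converges. What survives a limit are bounds on angles between tangents
  at finite distance. Hence the mean value inequality with an exceptional null set, and the
  extension of a uniformly continuous tangent from a set of full measure to a true derivative. The
  threshold pi rho is half of the comparison circle: there the chord bound already equals 2 rho,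
  which keeps the minimum of the distance away from the boundary of the parameter range. A closed
  curve with this bound has length at least 2 pi rho, so the half arcs of a remaining triple,
  measured in units of rho, add up to at least pi, as the acute comparison requires. In the limsup
  half one number measures all errors, the Lipschitz constant e of p - gamma: it bounds the distance
  in the norm, the tilt of critical chords and, divided by the bilipschitz constant c, the
  perturbation as a function on the image. The gaps in sigma < rho < thickness absorb what is lost;
  the 3 in 3 (e / c) < 1 is the dimension, paid for extending coordinate by coordinate.\<close>

lemma closure_conegligible:
  fixes D :: "'a::euclidean_space set"
  assumes "negligible (- D)"
  shows "closure D = UNIV"
proof -
  have "negligible (- closure D)"
    by (rule negligible_subset[OF assms]) (use closure_subset in auto)
  then have "- closure D = {}" using open_not_negligible[of "- closure D"] by auto
  then show ?thesis by auto
qed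

lemma countable_imp_negligible:
  fixes S :: "'a::euclidean_space set"
  assumes "countable S"
  shows "negligible S"
proof -
  have "negligible (\<Union>x\<in>S. {x})" using assms by (intro negligible_countable_Union) auto
  then show ?thesis by simp
qed

text \<open>The set of points with value at least \<open>f a\<close> is closed, and its largest
  element cannot lie below b because f does not drop immediately to the right of it. Asking for
  growth on one side only lets each point be treated by its own argument later.\<close>

lemma right_increasing_imp_le:
  fixes f :: "real \<Rightarrow> real"
  assumes "a \<le> b" and cont: "continuous_on {a..b} f"
    and right: "\<And>x. a \<le> x \<Longrightarrow> x < b \<Longrightarrow> \<exists>d>0. \<forall>y. x < y \<and> y < x + d \<longrightarrow> f x \<le> f y"
  shows "f a \<le> f b"
proof -
  define S where "S = {x \<in> {a..b}. f a \<le> f x}"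
  have "closed S"
    unfolding S_def by (rule continuous_on_closed_Collect_le[OF continuous_on_const cont]) auto
  then have "compact S"
    unfolding compact_eq_bounded_closed
    by (auto simp: S_def intro: bounded_subset[OF bounded_closed_interval[of a b]])
  moreover have "S \<noteq> {}" using \<open>a \<le> b\<close> by (auto simp: S_def)
  ultimately obtain c where c: "c \<in> S" "\<And>y. y \<in> S \<Longrightarrow> y \<le> c"
    using compact_attains_sup[of S] by auto
  show ?thesis
  proof (cases "c = b")
    case True
    then show ?thesis using c(1) by (auto simp: S_def)
  next
    case False
    with c(1) have "a \<le> c" "c < b" "f a \<le> f c" by (auto simp: S_def)
    with right obtain d where d: "d > 0" "\<And>y. c < y \<Longrightarrow> y < c + d \<Longrightarrow> f c \<le> f y" by blast
    define y where "y = min b (c + d / 2)"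
    have "c < y" "y < c + d" "y \<le> b" using \<open>c < b\<close> \<open>d > 0\<close> by (auto simp: y_def)
    with d \<open>f a \<le> f c\<close> \<open>a \<le> c\<close> have "y \<in> S" by (force simp: S_def)
    with c(2) \<open>c < y\<close> show ?thesis by force
  qed
qed

text \<open>Takes the place of integrating the derivative of an absolutely continuous function. The
  null set is covered by an open U of small measure, and \<open>L * \<phi>\<close> is added to g,
  which pays for the steepest descent a Lipschitz function can make on U. Continuity alone would not
  do: the Cantor function has derivative 0 almost everywhere.\<close>

lemma lipschitz_AE_deriv_nonneg_imp_le:
  fixes g :: "real \<Rightarrow> real"
  assumes "a \<le> b" and lip: "L-lipschitz_on {a..b} g" and N: "negligible N"
    and der: "\<And>x. a < x \<Longrightarrow> x < b \<Longrightarrow> x \<notin> N \<Longrightarrow> \<exists>D\<ge>0. (g has_real_derivative D) (at x)"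
  shows "g a \<le> g b"
proof (rule field_le_epsilon)
  fix e :: real assume "e > 0"
  \<comment> \<open>The total error at the end is L * r + r * (b - a); the summand 1 keeps the
    denominator positive.\<close>
  define r where "r = e / (L + 1 + (b - a))"
  have "L \<ge> 0" using lip lipschitz_on_nonneg by blast
  have "r > 0" using \<open>e > 0\<close> \<open>L \<ge> 0\<close> \<open>a \<le> b\<close> by (simp add: r_def add_nonneg_pos)
  \<comment> \<open>The derivative is only known inside the interval, so the left end point has to
    be covered by U as well.\<close>
  have "negligible (insert a N)" using N by simp
  then have N': "insert a N \<in> null_sets lebesgue" using negligible_iff_null_sets by blast
  then obtain U where U: "open U" "insert a N \<subseteq> U" "U - insert a N \<in> lmeasurable"
      "emeasure lebesgue (U - insert a N) < ennreal r"
    using sets_lebesgue_outer_open[of "insert a N" r] \<open>r > 0\<close> by (metis null_setsD2)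
  have Umeas: "U \<in> sets lebesgue" using U(1) by auto
  have "emeasure lebesgue U = emeasure lebesgue (U - insert a N)"
    using emeasure_Diff_null_set[OF N' Umeas] by simp
  with U(4) have eU: "emeasure lebesgue U < ennreal r" by simp
  have Ul: "U \<in> lmeasurable" using eU Umeas by (auto simp: fmeasurable_def intro: less_trans)
  have mU: "measure lebesgue U \<le> r"
    using eU \<open>r > 0\<close> by (simp add: measure_def enn2real_leI less_imp_le)
  \<comment> \<open>Slope 1 on U, nondecreasing everywhere, and total increase at most r.\<close>
  define \<phi> where "\<phi> x = measure lebesgue (U \<inter> {a..x})" for x
  have meas: "U \<inter> {a..x} \<in> lmeasurable" for x
    by (rule fmeasurable_Int_fmeasurable[OF Ul]) auto
  have step: "\<phi> y = \<phi> x + measure lebesgue (U \<inter> {x<..y})" if "a \<le> x" "x \<le> y" for x y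
  proof -
    have "U \<inter> {a..y} = (U \<inter> {a..x}) \<union> (U \<inter> {x<..y})" using that by auto
    moreover have "U \<inter> {x<..y} \<in> lmeasurable" by (rule fmeasurable_Int_fmeasurable[OF Ul]) auto
    ultimately show ?thesis unfolding \<phi>_def
      by (subst \<open>U \<inter> {a..y} = _\<close>, subst measure_Un_AE) (auto simp: meas)
  qed
  have mono: "\<phi> x \<le> \<phi> y" if "a \<le> x" "x \<le> y" for x y using step[OF that] by simp
  have lip1: "\<phi> y \<le> \<phi> x + (y - x)" if "a \<le> x" "x \<le> y" for x y
  proof -
    have "measure lebesgue (U \<inter> {x<..y}) \<le> measure lebesgue {x<..y}"
      by (rule measure_mono_fmeasurable) (use Umeas in \<open>auto intro: bounded_set_imp_lmeasurable\<close>)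
    then show ?thesis using step[OF that] that by simp
  qed
  have "1-lipschitz_on {a..b} \<phi>"
    by (rule lipschitz_on_leI) (use mono lip1 in \<open>force simp: dist_real_def\<close>)+
  then have c\<phi>: "continuous_on {a..b} \<phi>" by (rule lipschitz_on_continuous_on)
  define G where "G x = g x + L * \<phi> x + r * (x - a)" for x
  have "G a \<le> G b"
  proof (rule right_increasing_imp_le[OF \<open>a \<le> b\<close>])
    show "continuous_on {a..b} G" unfolding G_def
      by (intro continuous_intros c\<phi> lipschitz_on_continuous_on[OF lip])
    fix x assume x: "a \<le> x" "x < b"
    show "\<exists>d>0. \<forall>y. x < y \<and> y < x + d \<longrightarrow> G x \<le> G y"
    proof (cases "x \<in> U")
      case True
      then obtain d where d: "d > 0" "ball x d \<subseteq> U" using U(1) open_contains_ball by blast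
      have "G x \<le> G y" if y: "x < y" "y < x + min d (b - x)" for y
      proof -
        have "{x<..y} \<subseteq> U" using d y by (force simp: dist_real_def subset_eq)
        then have "U \<inter> {x<..y} = {x<..y}" by auto
        then have "L * \<phi> y = L * \<phi> x + L * (y - x)" using step[of x y] x y
          by (simp flip: distrib_left)
        moreover have "\<bar>g y - g x\<bar> \<le> L * \<bar>y - x\<bar>"
          using lipschitz_onD[OF lip, of y x] x y by (simp add: dist_real_def)
        moreover have "r * (x - a) \<le> r * (y - a)" using y \<open>r > 0\<close> by simp
        ultimately show ?thesis using y by (simp add: G_def algebra_simps)
      qed
      then show ?thesis using \<open>d > 0\<close> \<open>x < b\<close> by (intro exI[of _ "min d (b - x)"]) auto
    next
      case False
      with U(2) have xN: "x \<notin> N" "x \<noteq> a" by auto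
      with x der obtain D where D: "D \<ge> 0" "(g has_real_derivative D) (at x)" by force
      have "((\<lambda>y. g y + r * (y - a)) has_real_derivative (D + r)) (at x)"
        by (auto intro!: derivative_eq_intros D(2))
      moreover have "D + r > 0" using D \<open>r > 0\<close> by simp
      ultimately obtain d where d: "d > 0" "\<And>h. h > 0 \<Longrightarrow> h < d \<Longrightarrow> g x + r * (x - a) < g (x + h) + r * (x + h - a)"
        using DERIV_pos_inc_right by (metis (no_types, lifting))
      have "G x \<le> G y" if y: "x < y" "y < x + d" for y
        using d(2)[of "y - x"] y mono[of x y] x \<open>L \<ge> 0\<close> 
        by (simp add: G_def) (smt (verit) mult_left_mono)
      then show ?thesis using \<open>d > 0\<close> by blast
    qed
  qed
  moreover have "\<phi> a \<ge> 0" "\<phi> b \<le> r"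
  proof -
    show "\<phi> a \<ge> 0" by (simp add: \<phi>_def)
    have "\<phi> b \<le> measure lebesgue U" unfolding \<phi>_def
      by (rule measure_mono_fmeasurable) (use Ul Umeas in auto)
    with mU show "\<phi> b \<le> r" by simp
  qed
  moreover have "L * \<phi> a \<ge> 0" "L * \<phi> b \<le> L * r"
    using calculation \<open>L \<ge> 0\<close> by (auto intro: mult_left_mono)
  ultimately have "g a \<le> g b + L * r + r * (b - a)"
    unfolding G_def by simp
  also have "\<dots> \<le> g b + r * (L + 1 + (b - a))" using \<open>r > 0\<close> by (simp add: algebra_simps)
  also have "\<dots> = g b + e" using \<open>L \<ge> 0\<close> \<open>a \<le> b\<close> by (simp add: r_def)
  finally show "g a \<le> g b + e" .
qed

text \<open>Reduction to the scalar case by testing with the increment w itself: the derivative of g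
  is C |w| minus the inner product of D and w, which Cauchy-Schwarz makes nonnegative.\<close>

lemma lipschitz_AE_deriv_bound:
  fixes f :: "real \<Rightarrow> 'a::real_inner"
  assumes "a \<le> b" and lip: "L-lipschitz_on {a..b} f" and N: "negligible N"
    and der: "\<And>x. a < x \<Longrightarrow> x < b \<Longrightarrow> x \<notin> N \<Longrightarrow> \<exists>D. norm D \<le> C \<and> (f has_vector_derivative D) (at x)"
  shows "norm (f b - f a) \<le> C * (b - a)"
proof -
  define w where "w = f b - f a"
  define g where "g x = C * norm w * x - f x \<bullet> w" for x
  have "(norm w * L)-lipschitz_on {a..b} (\<lambda>x. f x \<bullet> w)"
  proof (rule lipschitz_onI)
    fix x y assume "x \<in> {a..b}" "y \<in> {a..b}"
    have "dist (f x \<bullet> w) (f y \<bullet> w) = \<bar>(f x - f y) \<bullet> w\<bar>" by (simp add: dist_real_def inner_diff_left)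
    also have "\<dots> \<le> norm (f x - f y) * norm w" by (rule Cauchy_Schwarz_ineq2)
    also have "\<dots> \<le> (L * dist x y) * norm w"
      using lipschitz_onD[OF lip \<open>x \<in> _\<close> \<open>y \<in> _\<close>] by (intro mult_right_mono) (auto simp: dist_norm)
    finally show "dist (f x \<bullet> w) (f y \<bullet> w) \<le> norm w * L * dist x y" by (simp add: algebra_simps)
  qed (use lipschitz_on_nonneg[OF lip] in auto)
  moreover have "(\<bar>C * norm w\<bar>)-lipschitz_on {a..b} (\<lambda>x. C * norm w * x)"
    by (rule lipschitz_onI) (auto simp: dist_real_def abs_mult simp flip: right_diff_distrib)
  ultimately have "(\<bar>C * norm w\<bar> + norm w * L)-lipschitz_on {a..b} g"
    unfolding g_def by (intro lipschitz_on_diff)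
  then have "g a \<le> g b"
  proof (rule lipschitz_AE_deriv_nonneg_imp_le[OF \<open>a \<le> b\<close> _ N])
    fix x assume "a < x" "x < b" "x \<notin> N"
    with der obtain D where D: "norm D \<le> C" "(f has_vector_derivative D) (at x)" by blast
    have "((\<lambda>x. f x \<bullet> w) has_vector_derivative D \<bullet> w) (at x)"
      by (rule bounded_linear.has_vector_derivative[OF bounded_linear_inner_left D(2)])
    then have "((\<lambda>x. f x \<bullet> w) has_real_derivative D \<bullet> w) (at x)"
      by (simp add: has_real_derivative_iff_has_vector_derivative)
    then have "(g has_real_derivative (C * norm w - D \<bullet> w)) (at x)"
      unfolding g_def by (auto intro!: derivative_eq_intros)
    moreover have "D \<bullet> w \<le> C * norm w"
      by (meson D(1) mult_right_mono norm_cauchy_schwarz norm_ge_zero order_trans)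
    ultimately show "\<exists>D\<ge>0. (g has_real_derivative D) (at x)"
      by (intro exI[of _ "C * norm w - D \<bullet> w"]) auto
  qed
  then have "w \<bullet> w \<le> C * norm w * (b - a)"
    by (simp add: g_def w_def algebra_simps inner_diff_left)
  then have "norm w * norm w \<le> norm w * (C * (b - a))"
    by (simp add: power2_norm_eq_inner[symmetric] power2_eq_square algebra_simps)
  then show ?thesis
  \<comment> \<open>For w = 0 the claim says that C is nonnegative when a < b; any point outside the
    null set shows this.\<close>
  proof (cases "w = 0")
    case True
    then show ?thesis
    proof (cases "a < b")
      case True
      then have "\<not> negligible {a<..<b}"
        using open_not_negligible[of "{a<..<b}"] by auto
      then obtain x where "a < x" "x < b" "x \<notin> N"
        using negligible_subset[OF N, of "{a<..<b}"] by force
      with der[of x] obtain D :: 'a where "norm D \<le> C" by auto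
      then have "0 \<le> C" by (meson norm_ge_zero order_trans)
      then show ?thesis using \<open>w = 0\<close> \<open>a \<le> b\<close> by (simp add: w_def)
    qed (use \<open>a \<le> b\<close> in auto)
  qed (simp add: w_def)
qed

text \<open>After subtracting the linear map with slope \<open>T s\<close>, the almost everywhere
  derivative is small near s, so the mean value bound gives differentiability at s itself, also when
  s is outside D.\<close>

lemma lipschitz_uniformly_continuous_AE_deriv:
  fixes f :: "real \<Rightarrow> 'a::euclidean_space"
  assumes lip: "L-lipschitz_on UNIV f" and D: "negligible (- D)"
    and der: "\<And>x. x \<in> D \<Longrightarrow> (f has_vector_derivative f' x) (at x)"
    and uc: "uniformly_continuous_on D f'"
  obtains T where "uniformly_continuous_on UNIV T" "\<And>x. (f has_vector_derivative T x) (at x)"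
    "\<And>x. x \<in> D \<Longrightarrow> T x = f' x"
proof -
  note closure_conegligible[OF D]
  with uniformly_continuous_on_extension_on_closure[OF uc]
  obtain T where T: "uniformly_continuous_on UNIV T" "\<And>x. x \<in> D \<Longrightarrow> f' x = T x" by metis
  have "(f has_vector_derivative T s) (at s)" for s
    unfolding has_vector_derivative_def has_derivative_at_alt
  proof (intro conjI allI impI)
    show "bounded_linear (\<lambda>h. h *\<^sub>R T s)" by (rule bounded_linear_scaleR_left)
    fix e :: real assume "e > 0"
    with T(1) obtain d where d: "d > 0" "\<And>u. dist u s < d \<Longrightarrow> dist (T u) (T s) < e"
      unfolding uniformly_continuous_on_def by (metis UNIV_I)
    define k where "k u = f u - u *\<^sub>R T s" for u
    have lipk: "(L + norm (T s))-lipschitz_on UNIV k"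
      unfolding k_def
      by (rule lipschitz_on_diff[OF lip])
        (auto intro!: lipschitz_onI simp: dist_norm simp flip: scaleR_diff_left)
    have *: "norm (k v - k u) \<le> e * (v - u)" if "u \<le> v" "s - d < u" "v < s + d" for u v
    proof (rule lipschitz_AE_deriv_bound[OF that(1) lipschitz_on_subset[OF lipk subset_UNIV] D])
      fix x assume x: "u < x" "x < v" "x \<notin> - D"
      then have "(k has_vector_derivative (T x - T s)) (at x)"
        unfolding k_def using der[of x] T(2)[of x] by (auto intro!: derivative_eq_intros)
      moreover have "norm (T x - T s) \<le> e"
        using d(2)[of x] x that by (simp add: dist_norm less_imp_le)
      ultimately show "\<exists>D. norm D \<le> e \<and> (k has_vector_derivative D) (at x)" by blast
    qed
    show "\<exists>d>0. \<forall>y. norm (y - s) < d \<longrightarrow> norm (f y - f s - (y - s) *\<^sub>R T s) \<le> e * norm (y - s)"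
    proof (intro exI[of _ d] conjI allI impI)
      fix y assume y: "norm (y - s) < d"
      have eq: "f y - f s - (y - s) *\<^sub>R T s = k y - k s" by (simp add: k_def algebra_simps)
      show "norm (f y - f s - (y - s) *\<^sub>R T s) \<le> e * norm (y - s)"
        using *[of s y] *[of y s] y \<open>d > 0\<close> unfolding eq
        by (cases "s \<le> y") (auto simp: norm_minus_commute)
    qed fact
  qed
  with T show ?thesis using that by metis
qed

text \<open>Carries almost everywhere statements from one period, the only one that
  \<open>w1inf_norm\<close> sees, to the whole line.\<close>

lemma AE_periodic:
  fixes P :: "real \<Rightarrow> bool"
  assumes per: "\<And>t. P (t + 1) \<longleftrightarrow> P t" and N: "negligible {t \<in> {0..1}. \<not> P t}"
  shows "negligible {t. \<not> P t}"
proof -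
  have P: "P (t + of_int m) \<longleftrightarrow> P t" for t and m :: int
  proof (induction m rule: int_induct[where k=0])
    case (step1 i) then show ?case using per[of "t + of_int i"] by (simp add: algebra_simps)
  next
    case (step2 i) then show ?case using per[of "t + of_int i - 1"] by (simp add: algebra_simps)
  qed auto
  have "negligible (\<Union>m::int. (+) (of_int m) ` {t \<in> {0..1}. \<not> P t})"
    by (rule negligible_countable_Union) (auto intro!: negligible_translation N[simplified])
  moreover have "{t. \<not> P t} \<subseteq> (\<Union>m::int. (+) (of_int m) ` {t \<in> {0..1}. \<not> P t})"
  proof
    fix t assume "t \<in> {t. \<not> P t}"
    then have "frac t \<in> {t \<in> {0..1}. \<not> P t}"
      using P[of "frac t" "\<lfloor>t\<rfloor>"] frac_ge_0[of t] frac_lt_1[of t] by (auto simp: frac_def)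
    moreover have "t = of_int \<lfloor>t\<rfloor> + frac t" by (simp add: frac_def)
    ultimately show "t \<in> (\<Union>m::int. (+) (of_int m) ` {t \<in> {0..1}. \<not> P t})" by blast
  qed
  ultimately show ?thesis by (rule negligible_subset)
qed

lemma local_lipschitz_imp_uniformly_continuous_on:
  fixes f :: "real \<Rightarrow> 'a::real_normed_vector"
  assumes "h > 0" "K > 0"
    and lip: "\<And>s t. s \<in> D \<Longrightarrow> t \<in> D \<Longrightarrow> \<bar>s - t\<bar> < h \<Longrightarrow> norm (f s - f t) \<le> \<bar>s - t\<bar> / K"
  shows "uniformly_continuous_on D f"
  unfolding uniformly_continuous_on_def
proof (intro allI impI)
  fix e :: real assume "e > 0"
  define d where "d = min h (e * K)"
  have "d > 0" using assms \<open>e > 0\<close> by (simp add: d_def)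
  moreover have "dist (f t) (f s) < e" if "s \<in> D" "t \<in> D" "dist t s < d" for s t
  proof -
    have "dist (f t) (f s) \<le> \<bar>t - s\<bar> / K"
      using lip[of t s] that by (simp add: dist_norm dist_real_def d_def)
    also have "\<dots> < e" using that \<open>K > 0\<close> by (simp add: d_def dist_real_def field_simps)
    finally show ?thesis .
  qed
  ultimately show "\<exists>d>0. \<forall>x\<in>D. \<forall>x'\<in>D. dist x' x < d \<longrightarrow> dist (f x') (f x) < e" by blast
qed

lemma has_vector_derivative_quotient:
  assumes der: "(f has_vector_derivative T) (at s)"
  shows "((\<lambda>t. (1 / (t - s)) *\<^sub>R (f t - f s)) \<longlongrightarrow> T) (at s)"
proof -
  define Q where "Q t = (1 / (t - s)) *\<^sub>R (f t - f s)" for t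
  have "((\<lambda>t. norm (f t - f s - (t - s) *\<^sub>R T) / norm (t - s)) \<longlongrightarrow> 0) (at s)"
    using der unfolding has_vector_derivative_def has_derivative_iff_norm by simp
  moreover have "\<forall>\<^sub>F t in at s. norm (f t - f s - (t - s) *\<^sub>R T) / norm (t - s) = norm (Q t - T)"
    unfolding eventually_at_filter
  proof (intro always_eventually allI impI)
    fix t assume "t \<noteq> s"
    then have "Q t - T = (1 / (t - s)) *\<^sub>R (f t - f s - (t - s) *\<^sub>R T)"
      by (simp add: Q_def scaleR_diff_right)
    then show "norm (f t - f s - (t - s) *\<^sub>R T) / norm (t - s) = norm (Q t - T)" by simp
  qed
  ultimately have "((\<lambda>t. norm (Q t - T)) \<longlongrightarrow> 0) (at s)" by (rule Lim_transform_eventually)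
  then have "(Q \<longlongrightarrow> T) (at s)" using Lim_null tendsto_norm_zero_iff by blast
  then show ?thesis by (simp add: Q_def[abs_def])
qed

lemma lipschitz_deriv_bound:
  assumes lip: "\<And>x y. norm (f x - f y) \<le> e * \<bar>x - y\<bar>" and der: "(f has_vector_derivative D) (at t)"
  shows "norm D \<le> e"
proof (rule tendsto_upperbound)
  show "((\<lambda>x. norm ((1 / (x - t)) *\<^sub>R (f x - f t))) \<longlongrightarrow> norm D) (at t)"
    by (intro tendsto_norm has_vector_derivative_quotient der)
  show "\<forall>\<^sub>F x in at t. norm ((1 / (x - t)) *\<^sub>R (f x - f t)) \<le> e"
    unfolding eventually_at_filter
  proof (intro always_eventually allI impI)
    fix x assume "x \<noteq> t"
    then show "norm ((1 / (x - t)) *\<^sub>R (f x - f t)) \<le> e" 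
      unfolding norm_scaleR using lip[of x t] by (simp add: field_simps)
  qed
qed simp

section \<open>Circumradius and angles\<close>

definition gram :: "'a::real_inner \<Rightarrow> 'a \<Rightarrow> real" where
  "gram a b = (a \<bullet> a) * (b \<bullet> b) - (a \<bullet> b)\<^sup>2"

text \<open>The square of R = abc / (4 area), with area^2 = gram / 4. Degenerate and collinear
  triples satisfy it automatically because \<open>gram\<close> vanishes.\<close>

definition circumradius_ge :: "real \<Rightarrow> 'a::real_inner \<Rightarrow> 'a \<Rightarrow> 'a \<Rightarrow> bool" where
  "circumradius_ge \<rho> x y z \<longleftrightarrow> 4 * \<rho>\<^sup>2 * gram (y - x) (z - x)
     \<le> (norm (y - x))\<^sup>2 * (norm (z - x))\<^sup>2 * (norm (z - y))\<^sup>2"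

lemma gram_nonneg: "gram a b \<ge> 0"
  using Cauchy_Schwarz_ineq[of a b] by (simp add: gram_def)

lemma gram_le: "gram a b \<le> (norm a)\<^sup>2 * (norm b)\<^sup>2"
  by (simp add: gram_def power2_norm_eq_inner)

lemma gram_rotate: "gram (z - y) (x - y) = gram (y - x) (z - x)"
  by (simp add: gram_def inner_diff_left inner_diff_right inner_commute power2_eq_square algebra_simps)

lemma gram_middle: "gram (y - x) (z - y) = gram (y - x) (z - x)"
  by (simp add: gram_def inner_diff_left inner_diff_right inner_commute power2_eq_square algebra_simps)

lemma circumradius_ge_rotate: "circumradius_ge \<rho> y z x \<longleftrightarrow> circumradius_ge \<rho> x y z"
  by (simp add: circumradius_ge_def gram_rotate norm_minus_commute mult_ac)

lemma gram_commute: "gram a b = gram b a"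
  by (simp add: gram_def inner_commute mult.commute)

lemma circumradius_ge_swap: "circumradius_ge \<rho> x z y \<longleftrightarrow> circumradius_ge \<rho> x y z"
  by (simp add: circumradius_ge_def gram_commute[of "z - x"] norm_minus_commute mult_ac)

lemma circumradius_ge_trivial: "x = y \<or> y = z \<or> x = z \<Longrightarrow> circumradius_ge \<rho> x y z"
  by (auto simp: circumradius_ge_def gram_def power2_eq_square)

text \<open>A side is a chord of the circumcircle and hence no longer than its diameter; in
  polynomial form this is \<open>gram_le\<close> for the other two sides.\<close>

lemma circumradius_ge_side:
  assumes "norm (z - y) \<ge> 2 * \<rho>" "\<rho> > 0"
  shows "circumradius_ge \<rho> x y z"
proof -
  have "4 * \<rho>\<^sup>2 \<le> (norm (z - y))\<^sup>2"
    using power_mono[OF assms(1), of 2] assms(2) by (simp add: power_mult_distrib)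
  then have "4 * \<rho>\<^sup>2 * gram (y - x) (z - x) \<le> (norm (z - y))\<^sup>2 * ((norm (y - x))\<^sup>2 * (norm (z - x))\<^sup>2)"
    by (intro mult_mono gram_le gram_nonneg) auto
  then show ?thesis by (simp add: circumradius_ge_def mult_ac)
qed

lemma collinear_iff_gram:
  fixes x y z :: "'a::euclidean_space"
  shows "collinear {x, y, z} \<longleftrightarrow> gram (y - x) (z - x) = 0"
proof -
  have "{x, y, z} = {y, x, z}" by auto
  also have "collinear {y, x, z} = collinear {0, y - x, z - x}" by (rule collinear_3) simp
  also have "\<dots> \<longleftrightarrow> \<bar>(y - x) \<bullet> (z - x)\<bar> = norm (y - x) * norm (z - x)"
    by (simp add: norm_cauchy_schwarz_equal)
  also have "\<dots> \<longleftrightarrow> \<bar>(y - x) \<bullet> (z - x)\<bar>\<^sup>2 = (norm (y - x) * norm (z - x))\<^sup>2"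
    by (rule power2_eq_iff_nonneg[symmetric]) auto
  also have "\<dots> \<longleftrightarrow> gram (y - x) (z - x) = 0"
    by (auto simp: gram_def power_mult_distrib power2_norm_eq_inner)
  finally show ?thesis .
qed

text \<open>Seen from x, the centre w is equidistant from the three points exactly if its inner
  products with a and b are half of their squared lengths. This linear system has determinant
  \<open>gram a b\<close>, so there is one solution in the plane of the triangle.\<close>

lemma circumcentre_exists:
  fixes x y z :: "'a::real_inner"
  assumes g: "gram (y - x) (z - x) > 0"
  defines "R \<equiv> sqrt ((norm (y - x))\<^sup>2 * (norm (z - x))\<^sup>2 * (norm (z - y))\<^sup>2 / (4 * gram (y - x) (z - x)))"
  shows "\<exists>\<alpha> \<beta>. let c = x + \<alpha> *\<^sub>R (y - x) + \<beta> *\<^sub>R (z - x) in dist c x = R \<and> dist c y = R \<and> dist c z = R"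
    and "\<And>\<alpha> \<beta> r. let c = x + \<alpha> *\<^sub>R (y - x) + \<beta> *\<^sub>R (z - x) in 
        dist c x = r \<and> dist c y = r \<and> dist c z = r \<Longrightarrow> r = R"
proof -
  define a where "a = y - x"
  define b where "b = z - x"
  define A where "A = a \<bullet> a"
  define B where "B = b \<bullet> b"
  define C where "C = a \<bullet> b"
  define G where "G = gram a b"
  have G: "G = A * B - C\<^sup>2" "G > 0" using g by (auto simp: G_def gram_def A_def B_def C_def a_def b_def)
  have zy: "(norm (z - y))\<^sup>2 = A + B - 2 * C"
    unfolding power2_norm_eq_inner A_def B_def C_def a_def b_def
    by (simp add: inner_diff_left inner_diff_right inner_commute)
  have R: "R = sqrt (A * B * (A + B - 2 * C) / (4 * G))"
    unfolding R_def zy G_def A_def B_def by (simp add: power2_norm_eq_inner a_def b_def)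
  \<comment> \<open>Cramer's rule for the system \<open>wa\<close>, \<open>wb\<close>.\<close>
  define \<alpha> where "\<alpha> = B * (A - C) / (2 * G)"
  define \<beta> where "\<beta> = A * (B - C) / (2 * G)"
  define w where "w = \<alpha> *\<^sub>R a + \<beta> *\<^sub>R b"
  have wa: "w \<bullet> a = A / 2"
  proof -
    have "w \<bullet> a = \<alpha> * A + \<beta> * C" by (simp add: w_def inner_add_left A_def C_def inner_commute[of b a])
    also have "\<dots> = A * G / (2 * G)" unfolding \<alpha>_def \<beta>_def G(1)
      by (simp add: add_divide_distrib[symmetric] power2_eq_square algebra_simps)
    finally show ?thesis using G(2) by simp
  qed
  have wb: "w \<bullet> b = B / 2"
  proof -
    have "w \<bullet> b = \<alpha> * C + \<beta> * B" by (simp add: w_def inner_add_left B_def C_def)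
    also have "\<dots> = B * G / (2 * G)" unfolding \<alpha>_def \<beta>_def G(1)
      by (simp add: add_divide_distrib[symmetric] power2_eq_square algebra_simps)
    finally show ?thesis using G(2) by simp
  qed
  have ww: "w \<bullet> w = A * B * (A + B - 2 * C) / (4 * G)"
  proof -
    have "w \<bullet> w = \<alpha> * (w \<bullet> a) + \<beta> * (w \<bullet> b)" by (subst (2) w_def) (simp add: inner_add_right)
    also have "\<dots> = (A * B * (A + B - 2 * C)) / (4 * G)"
      unfolding wa wb \<alpha>_def \<beta>_def using G(2) by (simp add: field_simps)
    finally show ?thesis .
  qed
  have Rw: "R = norm w" by (simp add: R ww[symmetric] norm_eq_sqrt_inner)
  have eqd: "norm (v - d) = norm v" if "v \<bullet> d = (d \<bullet> d) / 2" for v d :: 'a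
    using that by (simp add: norm_eq_sqrt_inner inner_diff_left inner_diff_right inner_commute)
  show "\<exists>\<alpha> \<beta>. let c = x + \<alpha> *\<^sub>R (y - x) + \<beta> *\<^sub>R (z - x) in dist c x = R \<and> dist c y = R \<and> dist c z = R"
    using eqd[OF wa[unfolded A_def]] eqd[OF wb[unfolded B_def]]
    by (intro exI[of _ \<alpha>] exI[of _ \<beta>])
      (simp add: Rw Let_def dist_norm w_def a_def b_def algebra_simps)
  fix \<alpha>' \<beta>' r
  assume "let c = x + \<alpha>' *\<^sub>R (y - x) + \<beta>' *\<^sub>R (z - x) in dist c x = r \<and> dist c y = r \<and> dist c z = r"
  moreover define v where "v = \<alpha>' *\<^sub>R a + \<beta>' *\<^sub>R b"
  ultimately have "dist (x + v) x = r" "dist (x + v) y = r" "dist (x + v) z = r"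
    by (simp_all add: Let_def a_def b_def add.assoc)
  then have v: "norm v = r" "norm (v - a) = r" "norm (v - b) = r"
    by (simp_all add: dist_norm a_def b_def algebra_simps)
  have eqd': "v \<bullet> d = (d \<bullet> d) / 2" if "norm (v - d) = norm v" for d
  proof -
    have "(norm (v - d))\<^sup>2 = (norm v)\<^sup>2" using that by simp
    then show ?thesis
      by (simp add: power2_norm_eq_inner inner_diff_left inner_diff_right inner_commute)
  qed
  have "(v - w) \<bullet> a = 0" "(v - w) \<bullet> b = 0"
    using eqd'[of a] eqd'[of b] v wa wb by (simp_all add: inner_diff_left A_def B_def)
  moreover have "v - w = (\<alpha>' - \<alpha>) *\<^sub>R a + (\<beta>' - \<beta>) *\<^sub>R b" by (simp add: v_def w_def algebra_simps)
  ultimately have "(v - w) \<bullet> (v - w) = 0" by (metis add.right_neutral inner_add_right inner_scaleR_right mult_zero_right)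
  then show "r = R" using v(1) Rw by simp
qed

lemma circumradius_eq:
  assumes "\<not> collinear {x, y, z}"
  shows "circumradius x y z = ereal (sqrt ((norm (y - x))\<^sup>2 * (norm (z - x))\<^sup>2 * (norm (z - y))\<^sup>2
           / (4 * gram (y - x) (z - x))))" (is "_ = ereal ?R")
proof -
  have g: "gram (y - x) (z - x) > 0"
    using assms gram_nonneg[of "y - x" "z - x"] by (simp add: collinear_iff_gram)
  have hull: "c \<in> affine hull {x, y, z} \<longleftrightarrow> (\<exists>\<alpha> \<beta>. c = x + \<alpha> *\<^sub>R (y - x) + \<beta> *\<^sub>R (z - x))" for c
  proof
    assume "c \<in> affine hull {x, y, z}"
    then obtain u v w where "u + v + w = 1" "c = u *\<^sub>R x + v *\<^sub>R y + w *\<^sub>R z"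
      by (auto simp: affine_hull_3)
    then have u: "u = 1 - v - w" and c: "c = u *\<^sub>R x + v *\<^sub>R y + w *\<^sub>R z" by auto
    have "c = x + v *\<^sub>R (y - x) + w *\<^sub>R (z - x)"
      unfolding c u by (simp add: algebra_simps)
    then show "\<exists>\<alpha> \<beta>. c = x + \<alpha> *\<^sub>R (y - x) + \<beta> *\<^sub>R (z - x)" by blast
  next
    assume "\<exists>\<alpha> \<beta>. c = x + \<alpha> *\<^sub>R (y - x) + \<beta> *\<^sub>R (z - x)"
    then obtain v w where c: "c = x + v *\<^sub>R (y - x) + w *\<^sub>R (z - x)" by blast
    show "c \<in> affine hull {x, y, z}" unfolding affine_hull_3
      by (rule CollectI, rule exI[of _ "1 - v - w"], rule exI[of _ v], rule exI[of _ w])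
        (simp add: c algebra_simps)
  qed
  have "(THE R. \<exists>c\<in>affine hull {x, y, z}. dist c x = R \<and> dist c y = R \<and> dist c z = R) = ?R"
  proof (rule the_equality)
    show "\<exists>c\<in>affine hull {x, y, z}. dist c x = ?R \<and> dist c y = ?R \<and> dist c z = ?R"
      using circumcentre_exists(1)[OF g] unfolding Let_def hull Bex_def by metis
  next
    fix R assume "\<exists>c\<in>affine hull {x, y, z}. dist c x = R \<and> dist c y = R \<and> dist c z = R"
    then obtain \<alpha> \<beta> c where "c = x + \<alpha> *\<^sub>R (y - x) + \<beta> *\<^sub>R (z - x)"
        and c: "dist c x = R \<and> dist c y = R \<and> dist c z = R"
      using hull by metis
    with circumcentre_exists(2)[OF g, of \<alpha> \<beta> R] show "R = ?R" unfolding Let_def by blast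
  qed
  then show ?thesis using assms by (simp add: circumradius_def)
qed

lemma circumradius_ge_iff:
  assumes "\<rho> > 0"
  shows "ereal \<rho> \<le> circumradius x y z \<longleftrightarrow> circumradius_ge \<rho> x y z"
proof (cases "collinear {x, y, z}")
  case True
  then show ?thesis
    by (auto simp: circumradius_def circumradius_ge_def collinear_iff_gram)
next
  case False
  then have g: "gram (y - x) (z - x) > 0"
    using gram_nonneg[of "y - x" "z - x"] by (simp add: collinear_iff_gram)
  have "ereal \<rho> \<le> circumradius x y z \<longleftrightarrow>
     \<rho>\<^sup>2 \<le> (norm (y - x))\<^sup>2 * (norm (z - x))\<^sup>2 * (norm (z - y))\<^sup>2 / (4 * gram (y - x) (z - x))"
    using assms real_le_rsqrt real_sqrt_le_iff[of "\<rho>\<^sup>2"] by (simp only: circumradius_eq[OF False] ereal_less_eq real_sqrt_abs abs_of_pos)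
  also have "\<dots> \<longleftrightarrow> circumradius_ge \<rho> x y z"
    using g by (simp add: circumradius_ge_def field_simps)
  finally show ?thesis .
qed

text \<open>The triangle inequality for angles between unit vectors. Splitting off the components
  along v leaves vectors of lengths sin(arccos p) and sin(arccos q), so Cauchy-Schwarz yields the
  addition formula as a lower bound.\<close>

lemma sphere_triangle:
  fixes u v w :: "'a::real_inner"
  assumes n: "norm u = 1" "norm v = 1" "norm w = 1"
    and "cos x \<le> u \<bullet> v" "cos y \<le> v \<bullet> w" "0 \<le> x" "0 \<le> y" "x + y \<le> pi"
  shows "cos (x + y) \<le> u \<bullet> w"
proof -
  define p where "p = u \<bullet> v"
  define q where "q = v \<bullet> w"
  have p: "-1 \<le> p" "p \<le> 1" and q: "-1 \<le> q" "q \<le> 1"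
    using Cauchy_Schwarz_ineq2[of u v] Cauchy_Schwarz_ineq2[of v w] n by (auto simp: p_def q_def)
  have x: "arccos p \<le> x" using arccos_le_mono[of p "cos x"] assms p by (simp add: p_def arccos_cos)
  have y: "arccos q \<le> y" using arccos_le_mono[of q "cos y"] assms q by (simp add: q_def arccos_cos)
  have uv: "u \<bullet> u = 1" "v \<bullet> v = 1" "w \<bullet> w = 1" using n by (simp_all add: norm_eq_1)
  have nu: "norm (u - p *\<^sub>R v) = sqrt (1 - p\<^sup>2)"
    by (simp add: norm_eq_sqrt_inner inner_diff_left inner_diff_right uv p_def inner_commute power2_eq_square)
  have nw: "norm (w - q *\<^sub>R v) = sqrt (1 - q\<^sup>2)"
    by (simp add: norm_eq_sqrt_inner inner_diff_left inner_diff_right uv q_def inner_commute power2_eq_square)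
  have "(u - p *\<^sub>R v) \<bullet> (w - q *\<^sub>R v) = u \<bullet> w - p * q"
    by (simp add: inner_diff_left inner_diff_right uv p_def q_def inner_commute)
  then have "u \<bullet> w - p * q \<ge> - (sqrt (1 - p\<^sup>2) * sqrt (1 - q\<^sup>2))"
    using Cauchy_Schwarz_ineq2[of "u - p *\<^sub>R v" "w - q *\<^sub>R v"] nu nw by simp
  moreover have "cos (arccos p + arccos q) = p * q - sqrt (1 - p\<^sup>2) * sqrt (1 - q\<^sup>2)"
    using p q by (simp add: cos_add sin_arccos)
  moreover have "cos (x + y) \<le> cos (arccos p + arccos q)"
    using x y p q assms(6-8) arccos_lbound by (intro cos_monotone_0_pi_le) auto
  ultimately show ?thesis by simp
qed

text \<open>After shrinking C to C' with A + B + C' = pi, the weights sin 2A, sin 2B, sin 2C' are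
  barycentric coordinates of the circumcentre of the comparison triangle with angles A, B, C';
  in the given triangle the weighted sum of the radius vectors would have negative square.\<close>
lemma acute_circumradius_mono:
  fixes x y z c :: "'a::real_inner"
  assumes c: "dist c x = R" "dist c y = R" "dist c z = R" and R: "0 < R"
    and A: "0 < A" "A < pi/2" and B: "0 < B" "B < pi/2" and C: "0 < C" "C < pi/2"
    and sum: "A + B + C \<ge> pi"
    and sides: "norm (z - y) \<ge> 2 * \<rho> * sin A" "norm (z - x) \<ge> 2 * \<rho> * sin B" "norm (y - x) \<ge> 2 * \<rho> * sin C"
  shows "\<rho> \<le> R"
proof (rule ccontr)
  assume "\<not> \<rho> \<le> R" then have \<rho>: "R < \<rho>" by simp
  define C' where "C' = pi - A - B"
  have C': "0 < C'" "C' \<le> C" "C' < pi/2" using A B C sum by (auto simp: C'_def)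
  have sC: "sin C' \<le> sin C" using C' C by (intro sin_monotone_2pi_le) auto
  have pos: "sin A > 0" "sin B > 0" "sin C' > 0" using A B C' by (auto intro!: sin_gt_zero)
  define a b d where "a = x - c" and "b = y - c" and "d = z - c"
  have nn: "a \<bullet> a = R\<^sup>2" "b \<bullet> b = R\<^sup>2" "d \<bullet> d = R\<^sup>2"
    using c by (simp_all add: a_def b_def d_def dist_norm norm_minus_commute power2_norm_eq_inner[symmetric])
  \<comment> \<open>On a circle of radius R a chord longer than 2 R sin(theta) subtends a central
    angle above 2 theta. The inequality is strict because R < \<open>\<rho>\<close>.\<close>
  have *: "u \<bullet> v < R\<^sup>2 * cos (2 * \<theta>)"
    if "norm (v - u) \<ge> 2 * \<rho> * sin \<theta>'" "sin \<theta> \<le> sin \<theta>'" "sin \<theta> > 0" "u \<bullet> u = R\<^sup>2" "v \<bullet> v = R\<^sup>2"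
    for u v :: 'a and \<theta> \<theta>' 
  proof -
    have "2 * R * sin \<theta> < 2 * \<rho> * sin \<theta>" using \<rho> that by simp
    also have "\<dots> \<le> 2 * \<rho> * sin \<theta>'" using \<rho> R that by simp
    also note that(1)
    finally have "(2 * R * sin \<theta>)\<^sup>2 < (norm (v - u))\<^sup>2"
      using R that by (intro power_strict_mono) auto
    also have "(norm (v - u))\<^sup>2 = 2 * R\<^sup>2 - 2 * (u \<bullet> v)"
      using that by (simp add: power2_norm_eq_inner inner_diff_left inner_diff_right inner_commute)
    finally have "4 * (R\<^sup>2 * (sin \<theta>)\<^sup>2) < 2 * R\<^sup>2 - 2 * (u \<bullet> v)" by (simp add: power_mult_distrib)
    moreover have "R\<^sup>2 * cos (2 * \<theta>) = R\<^sup>2 - 2 * (R\<^sup>2 * (sin \<theta>)\<^sup>2)"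
      unfolding cos_double_sin by (simp add: algebra_simps)
    ultimately show ?thesis by linarith
  qed
  have ab: "a \<bullet> b < R\<^sup>2 * cos (2 * C')" 
    using *[of C b a C'] sides(3) sC pos(3) nn by (simp add: a_def b_def norm_minus_commute inner_commute)
  have ad: "a \<bullet> d < R\<^sup>2 * cos (2 * B)" 
    using *[of B d a B] sides(2) pos(2) nn by (simp add: a_def d_def norm_minus_commute inner_commute)
  have bd: "b \<bullet> d < R\<^sup>2 * cos (2 * A)" 
    using *[of A d b A] sides(1) pos(1) nn by (simp add: b_def d_def norm_minus_commute inner_commute)
  define s t r where "s = sin (2 * A)" and "t = sin (2 * B)" and "r = sin (2 * C')"
  have str: "s > 0" "t > 0" "r > 0"
    unfolding s_def t_def r_def using A B C' by (auto intro!: sin_gt_zero)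
  have "2 * C' = 2 * pi - (2 * A + 2 * B)" by (simp add: C'_def)
  then have r': "r = - sin (2 * A + 2 * B)" and c': "cos (2 * C') = cos (2 * A + 2 * B)"
    unfolding r_def by (simp_all add: sin_diff cos_diff)
  have sq: "(cos (2*A))\<^sup>2 = 1 - s\<^sup>2" "(cos (2*B))\<^sup>2 = 1 - t\<^sup>2" by (simp_all add: s_def t_def cos_squared_eq)
  \<comment> \<open>The squared length of the weighted sum of the radius vectors of the comparison
    triangle in a unit circle; that sum vanishes.\<close>
  have id: "s\<^sup>2 + t\<^sup>2 + r\<^sup>2 + 2 * s * t * cos (2 * C') + 2 * t * r * cos (2 * A) + 2 * s * r * cos (2 * B) = 0"
  proof -
    define p where "p = cos (2 * A)"
    define q where "q = cos (2 * B)"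
    have "r = - (s * q + p * t)" "cos (2 * C') = p * q - s * t"
      by (simp_all add: r' c' sin_add cos_add s_def t_def p_def q_def)
    moreover have "p\<^sup>2 = 1 - s\<^sup>2" "q\<^sup>2 = 1 - t\<^sup>2" using sq by (simp_all add: p_def q_def)
    ultimately have "s\<^sup>2 + t\<^sup>2 + r\<^sup>2 + 2 * s * t * cos (2 * C') + 2 * t * r * p + 2 * s * r * q = 0"
      by algebra
    then show ?thesis by (simp add: p_def q_def)
  qed
  have "0 \<le> (s *\<^sub>R a + t *\<^sub>R b + r *\<^sub>R d) \<bullet> (s *\<^sub>R a + t *\<^sub>R b + r *\<^sub>R d)" by simp
  also have "\<dots> = s\<^sup>2 * R\<^sup>2 + t\<^sup>2 * R\<^sup>2 + r\<^sup>2 * R\<^sup>2 + 2 * s * t * (a \<bullet> b) + 2 * t * r * (b \<bullet> d) + 2 * s * r * (a \<bullet> d)"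
    by (simp add: inner_add_left inner_add_right nn inner_commute power2_eq_square algebra_simps)
  also have "\<dots> < s\<^sup>2 * R\<^sup>2 + t\<^sup>2 * R\<^sup>2 + r\<^sup>2 * R\<^sup>2 + 2 * s * t * (R\<^sup>2 * cos (2 * C')) + 2 * t * r * (R\<^sup>2 * cos (2 * A)) + 2 * s * r * (R\<^sup>2 * cos (2 * B))"
    using str ab ad bd by (intro add_strict_mono add_le_less_mono mult_strict_left_mono) auto
  also have "\<dots> = R\<^sup>2 * (s\<^sup>2 + t\<^sup>2 + r\<^sup>2 + 2 * s * t * cos (2 * C') + 2 * t * r * cos (2 * A) + 2 * s * r * cos (2 * B))"
    by (simp add: algebra_simps)
  also have "\<dots> = 0" using id by simp
  finally show False by simp
qed

lemma one_minus_cos_le: "1 - cos x \<le> x\<^sup>2 / 2" for x :: real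
proof -
  have "cos x = 1 - 2 * (sin (x / 2))\<^sup>2" using cos_double_sin[of "x / 2"] by simp
  moreover have "(sin (x / 2))\<^sup>2 \<le> (x / 2)\<^sup>2"
    using abs_sin_x_le_abs_x[of "x / 2"] by (rule abs_le_square_iff[THEN iffD1])
  ultimately show ?thesis by (simp add: power2_eq_square)
qed

section \<open>Curves of bounded curvature\<close>

text \<open>Integration of the bound on T without integrals: \<open>\<Phi>\<close> is an explicit
  antiderivative of the lower bound, and the difference is monotone.\<close>

lemma inner_increment_ge:
  fixes \<gamma> :: "real \<Rightarrow> 'a::real_inner"
  assumes "a \<le> b" and der: "\<And>t. (\<gamma> has_vector_derivative T t) (at t)"
    and \<Phi>: "\<And>u. (\<Phi> has_real_derivative \<phi> u) (at u)"
    and le: "\<And>u. a \<le> u \<Longrightarrow> u \<le> b \<Longrightarrow> \<phi> u \<le> T u \<bullet> w"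
  shows "\<Phi> b - \<Phi> a \<le> (\<gamma> b - \<gamma> a) \<bullet> w"
proof -
  have d: "((\<lambda>u. \<gamma> u \<bullet> w - \<Phi> u) has_real_derivative (T u \<bullet> w - \<phi> u)) (at u)" for u
    using bounded_linear.has_vector_derivative[OF bounded_linear_inner_left der, of w u]
    by (auto intro!: derivative_eq_intros \<Phi> simp: has_real_derivative_iff_has_vector_derivative[symmetric])
  have "\<gamma> a \<bullet> w - \<Phi> a \<le> \<gamma> b \<bullet> w - \<Phi> b"
    by (rule DERIV_nonneg_imp_nondecreasing[OF \<open>a \<le> b\<close>]) (use d le in force)
  then show ?thesis by (simp add: inner_diff_left)
qed

text \<open>Curvature at most 1 / \<open>\<rho>\<close> without a second derivative: tangents at arc
  distance s form an angle of at most s / \<open>\<rho>\<close>. The restriction to angles up to pi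
  is where a lower bound on the cosine is an upper bound on the angle.\<close>

locale bounded_curvature =
  fixes \<gamma> T :: "real \<Rightarrow> 'a::real_inner" and \<rho> :: real
  assumes der: "\<And>t. (\<gamma> has_vector_derivative T t) (at t)"
    and unit: "\<And>t. norm (T t) = 1"
    and \<rho>_pos: "\<rho> > 0"
    and turning: "\<And>u v. \<bar>u - v\<bar> \<le> pi * \<rho> \<Longrightarrow> cos (\<bar>u - v\<bar> / \<rho>) \<le> T u \<bullet> T v"
begin

lemma unit_inner: "T t \<bullet> T t = 1" using unit[of t] by (simp add: norm_eq_1)

lemma angle_le_pi: "x / \<rho> \<le> pi \<longleftrightarrow> x \<le> pi * \<rho>"
  using \<rho>_pos by (simp add: field_simps)

lemma chord_inner_tangent:
  assumes "a \<le> m" "m \<le> b" "m - a \<le> pi * \<rho>" "b - m \<le> pi * \<rho>"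
  shows "\<rho> * sin ((b - m) / \<rho>) + \<rho> * sin ((m - a) / \<rho>) \<le> (\<gamma> b - \<gamma> a) \<bullet> T m"
proof -
  have "\<rho> * sin ((b - m) / \<rho>) - \<rho> * sin ((a - m) / \<rho>) \<le> (\<gamma> b - \<gamma> a) \<bullet> T m"
  proof (rule inner_increment_ge[OF _ der])
    show "((\<lambda>u. \<rho> * sin ((u - m) / \<rho>)) has_real_derivative cos ((u - m) / \<rho>)) (at u)" for u
      using \<rho>_pos by (auto intro!: derivative_eq_intros)
    show "cos ((u - m) / \<rho>) \<le> T u \<bullet> T m" if "a \<le> u" "u \<le> b" for u
    proof -
      have "cos (\<bar>u - m\<bar> / \<rho>) \<le> T u \<bullet> T m" using turning[of u m] that assms by auto
      moreover have "\<bar>u - m\<bar> / \<rho> = \<bar>(u - m) / \<rho>\<bar>" using \<rho>_pos by simp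
      ultimately show ?thesis by (metis cos_abs_real)
    qed
  qed (use assms in auto)
  moreover have "sin ((a - m) / \<rho>) = - sin ((m - a) / \<rho>)"
    by (metis minus_diff_eq minus_divide_left sin_minus)
  ultimately show ?thesis by simp
qed

text \<open>A comparison of Schur type with the circle of radius \<open>\<rho>\<close>: the chord is
  projected onto the tangent at the midpoint, and each half of the arc may turn by up to pi.\<close>

lemma chord_lower_bound:
  assumes "a \<le> b" "b - a \<le> 2 * pi * \<rho>"
  shows "2 * \<rho> * sin ((b - a) / (2 * \<rho>)) \<le> norm (\<gamma> b - \<gamma> a)"
proof -
  define m where "m = (a + b) / 2"
  have m: "b - m = (b - a) / 2" "m - a = (b - a) / 2" by (simp_all add: m_def field_simps)
  have "\<rho> * sin ((b - m) / \<rho>) + \<rho> * sin ((m - a) / \<rho>) \<le> (\<gamma> b - \<gamma> a) \<bullet> T m"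
    by (rule chord_inner_tangent) (use assms in \<open>auto simp: m\<close>, auto simp: m_def)
  also have "\<dots> \<le> norm (\<gamma> b - \<gamma> a) * norm (T m)" by (rule norm_cauchy_schwarz)
  finally show ?thesis by (simp add: m unit)
qed

text \<open>Test the chord against the unit vector w orthogonal to it in the plane of the chord and the
  initial tangent: if the angle were too large, the integral of the inner product of T and w would be positive.\<close>
lemma chord_tangent_angle:
  assumes "a < b" "b - a \<le> pi * \<rho>"
  shows "norm (\<gamma> b - \<gamma> a) * cos ((b - a) / (2 * \<rho>)) \<le> (\<gamma> b - \<gamma> a) \<bullet> T a"
proof -
  define L where "L = (b - a) / \<rho>"
  define d where "d = \<gamma> b - \<gamma> a"
  have L: "0 < L" "L \<le> pi" using assms \<rho>_pos by (auto simp: L_def angle_le_pi)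
  have L2: "(b - a) / (2 * \<rho>) = L / 2" by (simp add: L_def)
  have pp: "pi * \<rho> > 0" using \<rho>_pos by simp
  have "2 * \<rho> * sin (L / 2) \<le> norm d"
    using chord_lower_bound[of a b] assms pp unfolding L2 d_def by linarith
  moreover have "sin (L / 2) > 0" using L by (intro sin_gt_zero) auto
  ultimately have d: "norm d > 0" using \<rho>_pos by (smt (verit) mult_pos_pos)
  define e where "e = d /\<^sub>R norm d"
  have e: "norm e = 1" "d = norm d *\<^sub>R e" using d by (auto simp: e_def)
  then have ee: "e \<bullet> e = 1" by (simp add: norm_eq_1)
  define p where "p = e \<bullet> T a"
  have "\<rho> * sin L \<le> d \<bullet> T a"
    using chord_inner_tangent[of a a b] assms pp by (simp add: d_def L_def)
  moreover have "sin L \<ge> 0" using L by (intro sin_ge_zero) auto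
  ultimately have "d \<bullet> T a \<ge> 0" using \<rho>_pos by (smt (verit) mult_nonneg_nonneg)
  \<comment> \<open>Puts \<open>\<alpha>\<close> into [0, pi/2], so that pi/2 -
    \<open>\<alpha>\<close>, the angle between \<open>T a\<close> and w below, is
    nonnegative.\<close>
  then have "p \<ge> 0" unfolding p_def e_def using d by simp
  have "p \<le> 1" using norm_cauchy_schwarz[of e "T a"] e unit by (simp add: p_def)
  have "cos (L / 2) \<le> p"
  proof (rule ccontr)
    assume neg: "\<not> cos (L / 2) \<le> p"
    define \<alpha> where "\<alpha> = arccos p"
    have cos\<alpha>: "cos \<alpha> = p" using \<open>0 \<le> p\<close> \<open>p \<le> 1\<close> by (simp add: \<alpha>_def)
    have \<alpha>: "0 \<le> \<alpha>" "\<alpha> \<le> pi / 2"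
      unfolding \<alpha>_def using \<open>0 \<le> p\<close> \<open>p \<le> 1\<close> by (intro arccos_lbound arccos_le_pi2; simp)+
    have "L / 2 < \<alpha>"
      using neg cos_monotone_0_pi_le[of \<alpha> "L / 2"] \<alpha> L cos\<alpha> by force
    then have "sin \<alpha> > 0" using \<alpha> L by (intro sin_gt_zero) auto
    define w where "w = (T a - p *\<^sub>R e) /\<^sub>R sin \<alpha>"
    have pw: "(T a - p *\<^sub>R e) \<bullet> (T a - p *\<^sub>R e) = (sin \<alpha>)\<^sup>2"
      using unit_inner[of a]
      by (simp add: inner_diff_left inner_diff_right ee p_def[symmetric] inner_commute[of "T a" e] sin_squared_eq cos\<alpha>)
        (simp add: power2_eq_square)
    have "norm (T a - p *\<^sub>R e) = sin \<alpha>"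
      using \<open>sin \<alpha> > 0\<close> unfolding norm_eq_sqrt_inner pw by simp
    then have w1: "norm w = 1" using \<open>sin \<alpha> > 0\<close> by (simp add: w_def)
    have we: "e \<bullet> w = 0"
      by (simp add: w_def inner_diff_right ee p_def)
    have Tw: "T a \<bullet> w = sin \<alpha>"
    proof -
      have "T a \<bullet> w = (1 - p\<^sup>2) / sin \<alpha>"
        using unit_inner[of a] by (simp add: w_def inner_diff_right p_def inner_commute power2_eq_square divide_inverse)
      also have "1 - p\<^sup>2 = (sin \<alpha>)\<^sup>2" by (simp add: sin_squared_eq cos\<alpha>)
      finally show ?thesis using \<open>sin \<alpha> > 0\<close> by (simp add: power2_eq_square)
    qed
    \<comment> \<open>\<open>T u\<close> is within (u - a) / \<open>\<rho>\<close> of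
      \<open>T a\<close>, hence within (u - a) / \<open>\<rho>\<close> + pi/2 -
      \<open>\<alpha>\<close> of w. The left side is the integral of the resulting lower bound
      sin(\<open>\<alpha>\<close> - (u - a) / \<open>\<rho>\<close>).\<close>
    have "\<rho> * cos (\<alpha> - (b - a) / \<rho>) - \<rho> * cos (\<alpha> - (a - a) / \<rho>) \<le> (\<gamma> b - \<gamma> a) \<bullet> w"
    proof (rule inner_increment_ge[OF _ der])
      show "((\<lambda>u. \<rho> * cos (\<alpha> - (u - a) / \<rho>)) has_real_derivative sin (\<alpha> - (u - a) / \<rho>)) (at u)" for u
        using \<rho>_pos by (auto intro!: derivative_eq_intros)
      show "sin (\<alpha> - (u - a) / \<rho>) \<le> T u \<bullet> w" if u: "a \<le> u" "u \<le> b" for u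
      proof -
        have uL: "(u - a) / \<rho> \<le> L" "0 \<le> (u - a) / \<rho>" using u \<rho>_pos by (auto simp: L_def divide_right_mono)
        have "cos ((u - a) / \<rho> + (pi / 2 - \<alpha>)) \<le> T u \<bullet> w"
        proof (rule sphere_triangle[OF unit unit w1])
          show "cos ((u - a) / \<rho>) \<le> T u \<bullet> T a" using turning[of u a] u assms by auto
          show "cos (pi / 2 - \<alpha>) \<le> T a \<bullet> w" by (simp add: Tw cos_diff)
        qed (use uL \<alpha> \<open>L / 2 < \<alpha>\<close> in auto)
        moreover have "cos ((u - a) / \<rho> + (pi / 2 - \<alpha>)) = sin (\<alpha> - (u - a) / \<rho>)"
          by (simp add: sin_cos_eq algebra_simps)
        ultimately show ?thesis by simp
      qed
    qed (use assms in auto)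
    moreover have "(\<gamma> b - \<gamma> a) \<bullet> w = 0" using we e(2) by (metis d_def inner_scaleR_left mult_zero_right)
    ultimately have "\<rho> * cos (\<alpha> - L) \<le> \<rho> * cos \<alpha>" by (simp add: L_def)
    \<comment> \<open>L may exceed \<open>\<alpha>\<close>; still the distance of L from
      \<open>\<alpha>\<close> is less than \<open>\<alpha>\<close>, because 0 < L < 2
      \<open>\<alpha>\<close>.\<close>
    then have "cos \<bar>\<alpha> - L\<bar> \<le> cos \<alpha>" using \<rho>_pos by simp
    moreover have "cos \<alpha> < cos \<bar>\<alpha> - L\<bar>"
      by (rule cos_monotone_0_pi) (use \<alpha> L \<open>L / 2 < \<alpha>\<close> in auto)
    ultimately show False by simp
  qed
  then have "norm d * cos (L / 2) \<le> norm d * p" by (intro mult_left_mono) auto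
  also have "\<dots> = d \<bullet> T a" using d by (simp add: p_def e_def)
  finally show ?thesis by (simp add: L2 d_def)
qed

text \<open>Reversing the parameter and reflecting space leave the tangent vectors unchanged up to
  relabelling, so that a statement about the initial tangent becomes one about the end
  tangent.\<close>

lemma reversed: "bounded_curvature (\<lambda>u. - \<gamma> (- u)) (\<lambda>u. T (- u)) \<rho>"
proof
  fix t
  show "((\<lambda>u. - \<gamma> (- u)) has_vector_derivative T (- t)) (at t)"
  proof -
    have "(uminus has_vector_derivative - 1) (at t)"
      by (auto intro!: derivative_eq_intros)
    then have "((\<lambda>u. \<gamma> (- u)) has_vector_derivative - T (- t)) (at t)"
      using vector_diff_chain_at[of uminus "-1" t \<gamma> "T (- t)"] der[of "- t"] by (simp add: o_def)
    from has_vector_derivative_minus[OF this] show ?thesis by simp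
  qed
  fix u v :: real assume "\<bar>u - v\<bar> \<le> pi * \<rho>"
  then show "cos (\<bar>u - v\<bar> / \<rho>) \<le> T (- u) \<bullet> T (- v)" using turning[of "- u" "- v"] by (simp add: abs_minus_commute)
qed (use unit \<rho>_pos in auto)

lemma chord_tangent_angle_end:
  assumes "a < b" "b - a \<le> pi * \<rho>"
  shows "norm (\<gamma> b - \<gamma> a) * cos ((b - a) / (2 * \<rho>)) \<le> (\<gamma> b - \<gamma> a) \<bullet> T b"
  using bounded_curvature.chord_tangent_angle[OF reversed, of "- b" "- a"] assms by simp

lemma chord_pos:
  assumes "a < b" "b - a \<le> pi * \<rho>"
  shows "norm (\<gamma> b - \<gamma> a) > 0"
proof -
  have "pi * \<rho> > 0" using \<rho>_pos by simp
  then have "2 * \<rho> * sin ((b - a) / (2 * \<rho>)) \<le> norm (\<gamma> b - \<gamma> a)"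
    using chord_lower_bound[of a b] assms by linarith
  moreover have "(b - a) / (2 * \<rho>) < pi" using assms \<rho>_pos \<open>pi * \<rho> > 0\<close> by (simp add: field_simps)
  then have "sin ((b - a) / (2 * \<rho>)) > 0" using assms \<rho>_pos by (intro sin_gt_zero) auto
  ultimately show ?thesis using \<rho>_pos by (smt (verit) mult_pos_pos)
qed

text \<open>Law of sines: the circumradius is |z - x| divided by twice the sine of the exterior
  angle at y. By the chord-tangent estimates at b that angle is at most \<open>\<theta>\<close>, and
  the chord is at least 2 \<open>\<rho>\<close> sin \<open>\<theta>\<close>.\<close>

lemma circumradius_ge_arc:
  assumes "a < b" "b < c" "c - a \<le> pi * \<rho>"
  shows "circumradius_ge \<rho> (\<gamma> a) (\<gamma> b) (\<gamma> c)"
proof -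
  define x y z where "x = \<gamma> a" and "y = \<gamma> b" and "z = \<gamma> c"
  define \<theta> where "\<theta> = (c - a) / (2 * \<rho>)"
  have pp: "pi * \<rho> > 0" using \<rho>_pos by simp
  have \<theta>: "0 < \<theta>" "\<theta> \<le> pi / 2" using assms \<rho>_pos by (auto simp: \<theta>_def field_simps)
  define l m where "l = norm (y - x)" and "m = norm (z - y)"
  have lm: "l > 0" "m > 0" using chord_pos[of a b] chord_pos[of b c] assms by (auto simp: l_def m_def x_def y_def z_def)
  define e f where "e = (y - x) /\<^sub>R l" and "f = (z - y) /\<^sub>R m"
  have ef: "norm e = 1" "norm f = 1" "y - x = l *\<^sub>R e" "z - y = m *\<^sub>R f"
    using lm by (auto simp: e_def f_def l_def m_def)
  have "cos ((b - a) / (2 * \<rho>)) \<le> e \<bullet> T b"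
    using chord_tangent_angle_end[of a b] assms lm(1) ef(1)
    by (simp add: ef(3) flip: x_def y_def)
  moreover have "cos ((c - b) / (2 * \<rho>)) \<le> T b \<bullet> f"
    using chord_tangent_angle[of b c] assms lm(2) ef(2)
    by (simp add: ef(4) inner_commute flip: z_def y_def)
  moreover have \<theta>_eq: "(b - a) / (2 * \<rho>) + (c - b) / (2 * \<rho>) = \<theta>"
    by (simp add: \<theta>_def diff_divide_distrib)
  moreover have "0 \<le> (b - a) / (2 * \<rho>)" "0 \<le> (c - b) / (2 * \<rho>)" using assms \<rho>_pos by auto
  ultimately have q: "cos \<theta> \<le> e \<bullet> f"
    using sphere_triangle[OF ef(1) unit ef(2), of "(b - a) / (2 * \<rho>)" b "(c - b) / (2 * \<rho>)"] \<theta> by simp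
  have "cos \<theta> \<ge> 0" using \<theta> by (intro cos_ge_zero) auto
  then have "(cos \<theta>)\<^sup>2 \<le> (e \<bullet> f)\<^sup>2" using q by (intro power_mono) auto
  then have q2: "1 - (e \<bullet> f)\<^sup>2 \<le> (sin \<theta>)\<^sup>2" by (simp add: sin_squared_eq)
  have g: "gram (y - x) (z - x) = l\<^sup>2 * m\<^sup>2 * (1 - (e \<bullet> f)\<^sup>2)"
  proof -
    have "gram (l *\<^sub>R e) (m *\<^sub>R f) = l\<^sup>2 * m\<^sup>2 * (1 - (e \<bullet> f)\<^sup>2)"
      unfolding gram_def using ef(1,2) by (simp add: norm_eq_1 power2_eq_square algebra_simps)
    then show ?thesis unfolding gram_middle[symmetric, of y x z] unfolding ef(3,4) .
  qed
  have "2 * \<rho> * sin \<theta> \<le> norm (z - x)"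
    using chord_lower_bound[of a c] assms pp by (simp add: x_def z_def \<theta>_def)
  moreover have "sin \<theta> > 0" using \<theta> by (intro sin_gt_zero) auto
  ultimately have "4 * \<rho>\<^sup>2 * (sin \<theta>)\<^sup>2 \<le> (norm (z - x))\<^sup>2"
    using power_mono[of "2 * \<rho> * sin \<theta>" "norm (z - x)" 2] \<rho>_pos by (simp add: power_mult_distrib)
  then have "l\<^sup>2 * m\<^sup>2 * (4 * \<rho>\<^sup>2 * (sin \<theta>)\<^sup>2) \<le> l\<^sup>2 * m\<^sup>2 * (norm (z - x))\<^sup>2"
    by (intro mult_left_mono) auto
  moreover have "4 * \<rho>\<^sup>2 * gram (y - x) (z - x) \<le> l\<^sup>2 * m\<^sup>2 * (4 * \<rho>\<^sup>2 * (sin \<theta>)\<^sup>2)"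
    using mult_left_mono[OF q2, of "4 * \<rho>\<^sup>2 * (l\<^sup>2 * m\<^sup>2)"] by (simp add: g mult_ac)
  ultimately show ?thesis
    unfolding circumradius_ge_def x_def[symmetric] y_def[symmetric] z_def[symmetric] l_def[symmetric] m_def[symmetric]
    by (simp add: mult_ac)
qed

text \<open>Otherwise \<open>chord_lower_bound\<close> over a full period would give positive length
  to a chord that vanishes.\<close>

lemma closed_length:
  assumes per: "\<And>t. \<gamma> (t + 1) = \<gamma> t"
  shows "2 * pi * \<rho> \<le> 1"
proof (rule ccontr)
  assume *: "\<not> 2 * pi * \<rho> \<le> 1"
  then have "2 * \<rho> * sin (1 / (2 * \<rho>)) \<le> 0" using chord_lower_bound[of 0 1] per[of 0] by simp
  moreover have "sin (1 / (2 * \<rho>)) > 0" using * \<rho>_pos by (intro sin_gt_zero) (auto simp: field_simps)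
  ultimately show False using \<rho>_pos by (smt (verit) mult_pos_pos)
qed

lemma circumradius_ge_closed:
  assumes per: "\<And>t. \<gamma> (t + 1) = \<gamma> t"
    and far: "\<And>s h. pi * \<rho> \<le> h \<Longrightarrow> h \<le> 1 - pi * \<rho> \<Longrightarrow> 2 * \<rho> \<le> norm (\<gamma> (s + h) - \<gamma> s)"
    and abc: "a < b" "b < c" "c < a + 1"
  shows "circumradius_ge \<rho> (\<gamma> a) (\<gamma> b) (\<gamma> c)"
proof -
  have rot: "circumradius_ge \<rho> (\<gamma> b) (\<gamma> c) (\<gamma> a) \<longleftrightarrow> circumradius_ge \<rho> (\<gamma> a) (\<gamma> b) (\<gamma> c)"
    "circumradius_ge \<rho> (\<gamma> c) (\<gamma> a) (\<gamma> b) \<longleftrightarrow> circumradius_ge \<rho> (\<gamma> a) (\<gamma> b) (\<gamma> c)"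
    by (simp_all add: circumradius_ge_rotate)
  \<comment> \<open>The three gaps add up to 1. If one exceeds 1 - pi rho, the triple lies on an arc
    of length below pi rho (first three cases); if one is between pi rho and 1 - pi rho, it yields a
    side of length 2 rho; otherwise all gaps are below pi rho.\<close>
  consider "c - a \<le> pi * \<rho>" | "a + 1 - b \<le> pi * \<rho>" | "b + 1 - c \<le> pi * \<rho>"
    | "pi * \<rho> \<le> b - a" "b - a \<le> 1 - pi * \<rho>" | "pi * \<rho> \<le> c - b" "c - b \<le> 1 - pi * \<rho>"
    | "pi * \<rho> \<le> a + 1 - c" "a + 1 - c \<le> 1 - pi * \<rho>"
    | "b - a < pi * \<rho>" "c - b < pi * \<rho>" "a + 1 - c < pi * \<rho>" by argo
  then show ?thesis
  proof cases
    case 1 then show ?thesis using circumradius_ge_arc abc by blast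
  next
    case 2 then have "circumradius_ge \<rho> (\<gamma> b) (\<gamma> c) (\<gamma> (a + 1))" using circumradius_ge_arc abc by auto
    then show ?thesis by (simp add: per rot)
  next
    case 3 then have "circumradius_ge \<rho> (\<gamma> c) (\<gamma> (a + 1)) (\<gamma> (b + 1))" using circumradius_ge_arc abc by auto
    then show ?thesis by (simp add: per rot)
  next
    case 4 then have "circumradius_ge \<rho> (\<gamma> c) (\<gamma> a) (\<gamma> b)"
      using far[of "b - a" a] \<rho>_pos by (intro circumradius_ge_side) auto
    then show ?thesis by (simp add: rot)
  next
    case 5 then show ?thesis
      using far[of "c - b" b] \<rho>_pos by (intro circumradius_ge_side) auto
  next
    case 6 then have "circumradius_ge \<rho> (\<gamma> b) (\<gamma> c) (\<gamma> a)"
      using far[of "a + 1 - c" c] \<rho>_pos by (intro circumradius_ge_side) (auto simp: per)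
    then show ?thesis by (simp add: rot)
  next
    case 7
    show ?thesis
    proof (rule ccontr)
      assume neg: "\<not> ?thesis"
      define x y z where "x = \<gamma> a" and "y = \<gamma> b" and "z = \<gamma> c"
      define N where "N = (norm (y - x))\<^sup>2 * (norm (z - x))\<^sup>2 * (norm (z - y))\<^sup>2"
      have g: "4 * \<rho>\<^sup>2 * gram (y - x) (z - x) > N" "N \<ge> 0"
        using neg by (simp_all add: circumradius_ge_def x_def y_def z_def N_def)
      then have "gram (y - x) (z - x) > 0"
        using gram_nonneg[of "y - x" "z - x"] by (cases "gram (y - x) (z - x) = 0") auto
      note c = circumcentre_exists(1)[OF this, folded N_def]
      define R where "R = sqrt (N / (4 * gram (y - x) (z - x)))"
      from c obtain c' where c': "dist c' x = R" "dist c' y = R" "dist c' z = R"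
        unfolding R_def Let_def by blast
      have len: "norm (\<gamma> v - \<gamma> u) \<ge> 2 * \<rho> * sin ((v - u) / (2 * \<rho>))" if "u < v" "v - u < pi * \<rho>" for u v
        using chord_lower_bound[of u v] that \<rho>_pos by auto
      have "norm (y - x) > 0" using chord_pos[of a b] 7 abc by (simp add: x_def y_def)
      then have "R \<noteq> 0" using c' by auto
      moreover have "R \<ge> 0" using c'(1) by auto
      ultimately have "R > 0" by simp
      have "\<rho> \<le> R"
      proof (rule acute_circumradius_mono[OF c' \<open>R > 0\<close>])
        show "2 * \<rho> * sin ((c - b) / (2 * \<rho>)) \<le> norm (z - y)" using len[of b c] 7 abc by (simp add: y_def z_def)
        show "2 * \<rho> * sin ((a + 1 - c) / (2 * \<rho>)) \<le> norm (z - x)" using len[of c "a + 1"] 7 abc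
          by (simp add: x_def z_def per norm_minus_commute)
        show "2 * \<rho> * sin ((b - a) / (2 * \<rho>)) \<le> norm (y - x)" using len[of a b] 7 abc by (simp add: x_def y_def)
        \<comment> \<open>The comparison angles are the inscribed angles over the three arcs: each
          is below pi/2, and their sum 1 / (2 rho) is at least pi by
          \<open>closed_length\<close>.\<close>
        have "(c - b) / (2 * \<rho>) + (a + 1 - c) / (2 * \<rho>) + (b - a) / (2 * \<rho>) = 1 / (2 * \<rho>)"
          by (simp flip: add_divide_distrib)
        then show "pi \<le> (c - b) / (2 * \<rho>) + (a + 1 - c) / (2 * \<rho>) + (b - a) / (2 * \<rho>)"
          using closed_length[OF per] \<rho>_pos by (simp add: field_simps)
      qed (use 7 abc \<rho>_pos in \<open>auto simp: field_simps\<close>)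
      then have "\<rho>\<^sup>2 \<le> R\<^sup>2" using \<rho>_pos by (intro power_mono) auto
      also have "R\<^sup>2 = N / (4 * gram (y - x) (z - x))"
        unfolding R_def using g(2) gram_nonneg[of "y - x" "z - x"] by simp
      finally show False using g \<open>gram (y - x) (z - x) > 0\<close> by (simp add: field_simps)
    qed
  qed
qed

end

section \<open>Polygons and the W(1,infinity) distance\<close>

lemma periodic1_add_int:
  assumes "periodic1 f"
  shows "f (t + of_int m) = f t"
proof (induction m rule: int_induct[where k=0])
  case (step1 i) then show ?case
    using assms unfolding periodic1_def by (metis add.assoc of_int_1 of_int_add)
next
  case (step2 i) then show ?case
    using assms unfolding periodic1_def by (metis add.assoc diff_add_cancel of_int_1 of_int_diff of_int_add)
qed auto

lemma periodic1_frac: "periodic1 f \<Longrightarrow> f (frac t) = f t"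
  using periodic1_add_int[of f "frac t" "\<lfloor>t\<rfloor>"] by (simp add: frac_def)

lemma periodic1_inj_iff:
  assumes "periodic1 f" "inj_on f {0..<1}"
  shows "f s = f t \<longleftrightarrow> s - t \<in> \<int>"
proof
  assume "f s = f t"
  then have "f (frac s) = f (frac t)" by (simp add: assms(1) periodic1_frac)
  then have "frac s = frac t"
    using inj_onD[OF assms(2)] frac_ge_0 frac_lt_1 by (metis atLeastLessThan_iff)
  then have "s - t = of_int (\<lfloor>s\<rfloor> - \<lfloor>t\<rfloor>)" by (simp add: frac_def)
  then show "s - t \<in> \<int>" by simp
next
  assume "s - t \<in> \<int>"
  then obtain m where "s = t + of_int m" by (metis Ints_cases add.commute diff_add_cancel)
  then show "f s = f t" using periodic1_add_int[OF assms(1)] by simp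
qed

lemma polygon_data_shift:
  assumes "periodic1 p" "polygon_data n p v s0"
  shows "polygon_data n p v (s0 + of_int m)"
proof -
  have "p (s0 + of_int m + x) = p (s0 + x)" for x
    using periodic1_add_int[OF assms(1), of "s0 + x" m] by (simp add: algebra_simps)
  then show ?thesis using assms(2) unfolding polygon_data_def by simp
qed

text \<open>\<open>polygon_data\<close> describes p only to the right of its start parameter, since
  k is a natural number; an integer shift brings any given parameter into reach.\<close>

lemma polygon_data_start_le:
  assumes "periodic1 p" "polygon_data n p v s0"
  obtains s1 where "s1 \<le> t" "polygon_data n p v s1"
proof
  show "s0 + of_int (- \<lceil>s0 - t\<rceil>) \<le> t" by linarith
qed (rule polygon_data_shift[OF assms])

lemma polygon_on_edge:
  assumes pd: "polygon_data n p v s0" and u: "s0 + real k / real n \<le> u" "u \<le> s0 + real (Suc k) / real n"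
  shows "p u = v k + (real n * (u - s0) - real k) *\<^sub>R (v (Suc k) - v k)"
proof -
  have n: "n > 0" using pd by (simp add: polygon_data_def)
  define a where "a = real n * (u - s0) - real k"
  have "real k \<le> real n * (u - s0)" "real n * (u - s0) \<le> real (Suc k)"
    using u n by (simp_all add: field_simps)
  then have a: "0 \<le> a" "a \<le> 1" by (simp_all add: a_def)
  have "u = s0 + (real k + a) / real n" using n by (simp add: a_def)
  then have "p u = (1 - a) *\<^sub>R v k + a *\<^sub>R v (Suc k)"
    using pd a unfolding polygon_data_def by blast
  then show ?thesis by (simp add: a_def algebra_simps)
qed

text \<open>At a vertex (a = 0) only the outgoing edge is known to be linear. Since p is
  differentiable there by assumption, its derivative is the one-sided derivative along that
  edge.\<close>

lemma polygon_vector_derivative: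
  assumes pd: "polygon_data n p v s0" and diff: "p differentiable (at t)"
    and t: "t = s0 + (real k + a) / real n" "0 \<le> a" "a < 1"
  shows "vector_derivative p (at t) = real n *\<^sub>R (v (Suc k) - v k)"
proof -
  have n: "n > 0" using pd by (simp add: polygon_data_def)
  define e where "e = (1 - a) / real n"
  have "e > 0" using n t by (simp add: e_def)
  have lin: "p u = v k + (real n * (u - s0) - real k) *\<^sub>R (v (Suc k) - v k)" if "u \<in> {t..t + e}" for u
  proof (rule polygon_on_edge[OF pd])
    have "s0 + real k / real n \<le> t" "t + e = s0 + real (Suc k) / real n"
      using n t by (simp_all add: e_def add_divide_distrib[symmetric] field_simps)
    then show "s0 + real k / real n \<le> u" "u \<le> s0 + real (Suc k) / real n" using that by auto
  qed
  have "(p has_vector_derivative vector_derivative p (at t)) (at t within {t..t+e})"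
    using diff by (metis has_vector_derivative_at_within vector_derivative_works)
  moreover have "((\<lambda>u. v k + (real n * (u - s0) - real k) *\<^sub>R (v (Suc k) - v k))
      has_vector_derivative real n *\<^sub>R (v (Suc k) - v k)) (at t within {t..t+e})"
    by (auto intro!: derivative_eq_intros)
  then have "(p has_vector_derivative real n *\<^sub>R (v (Suc k) - v k)) (at t within {t..t+e})"
    by (rule has_vector_derivative_transform[rotated 2, OF _ _ lin]) (use \<open>e > 0\<close> in auto)
  ultimately show ?thesis
    using vector_derivative_unique_within_closed_interval[of t "t + e" t p] \<open>e > 0\<close> by simp
qed

lemma polygon_param:
  assumes "n > 0" "s0 \<le> t"
  defines "k \<equiv> nat \<lfloor>real n * (t - s0)\<rfloor>"
  obtains a where "t = s0 + (real k + a) / real n" "0 \<le> a" "a < 1"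
proof
  have "real n * (t - s0) \<ge> 0" using assms by simp
  then have "real k = of_int \<lfloor>real n * (t - s0)\<rfloor>" by (simp add: k_def)
  then have "real k + frac (real n * (t - s0)) = real n * (t - s0)" by (simp add: frac_def)
  then show "t = s0 + (real k + frac (real n * (t - s0))) / real n" using assms by simp
qed (auto simp: frac_lt_1)

text \<open>With exterior angle phi the hypothesis reads 2 tan(phi/2) / r \<le> 1 /
  \<open>\<rho>\<close>, and phi/2 \<le> tan(phi/2) turns it into phi \<le> r /
  \<open>\<rho>\<close>.\<close>

lemma disc_curv_le_imp_turn:
  assumes r: "norm (y - x) = r" "norm (z - y) = r" "r > 0" and "\<rho> > 0"
    and dc: "disc_curv x y z \<le> ereal (1 / \<rho>)" and "r / \<rho> \<le> pi"
  shows "cos (r / \<rho>) \<le> ((1/r) *\<^sub>R (y - x)) \<bullet> ((1/r) *\<^sub>R (z - y))"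
proof -
  define q where "q = ((1/r) *\<^sub>R (y - x)) \<bullet> ((1/r) *\<^sub>R (z - y))"
  have "q = ((y - x) \<bullet> (z - y)) / (norm (y - x) * norm (z - y))"
    by (simp add: q_def r)
  then have \<phi>: "ext_angle x y z = arccos q" by (simp add: ext_angle_def)
  have q: "-1 \<le> q" "q \<le> 1"
  proof -
    have "\<bar>q\<bar> \<le> norm ((1/r) *\<^sub>R (y - x)) * norm ((1/r) *\<^sub>R (z - y))"
      unfolding q_def by (rule Cauchy_Schwarz_ineq2)
    also have "\<dots> = 1" unfolding norm_scaleR r(1,2) using r(3) by simp
    finally show "-1 \<le> q" "q \<le> 1" by auto
  qed
  define \<psi> where "\<psi> = arccos q / 2"
  have ne: "arccos q \<noteq> pi" using dc by (auto simp: disc_curv_def \<phi>)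
  then have \<psi>: "0 \<le> \<psi>" "\<psi> < pi / 2"
    using arccos_lbound[of q] arccos_ubound[of q] q by (auto simp: \<psi>_def)
  have "2 * tan \<psi> / r \<le> 1 / \<rho>"
    using dc ne r by (simp add: disc_curv_def \<phi> \<psi>_def dist_norm norm_minus_commute)
  moreover have "\<psi> \<le> tan \<psi>"
    using arctan_le_self[of "tan \<psi>"] \<psi> by (simp add: arctan_tan tan_pos_pi2_le)
  ultimately have "arccos q \<le> r / \<rho>"
    using r \<open>\<rho> > 0\<close> by (simp add: \<psi>_def field_simps) (smt (verit) mult_left_mono)
  then have "cos (r / \<rho>) \<le> cos (arccos q)"
    using arccos_lbound[of q] q assms by (intro cos_monotone_0_pi_le) auto
  then show ?thesis using q by (simp add: q_def)
qed

lemma polygon_turn: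
  assumes pd: "polygon_data n p v s0" and "\<rho> > 0"
    and dc: "\<And>i. i \<in> {1..n} \<Longrightarrow> disc_curv (v (i - 1)) (v i) (v (Suc i)) \<le> ereal (1 / \<rho>)"
    and "real k / (real n * \<rho>) \<le> pi"
  shows "cos (real k / (real n * \<rho>)) \<le>
     (real n *\<^sub>R (v (Suc j) - v j)) \<bullet> (real n *\<^sub>R (v (Suc (j + k)) - v (j + k)))"
  using assms(4)
proof (induction k)
  case 0
  have "norm (real n *\<^sub>R (v (Suc j) - v j)) = 1" using pd by (simp add: polygon_data_def)
  then show ?case by (metis add_0_right cos_zero div_0 norm_eq_1 of_nat_0 order_refl)
next
  case (Suc k)
  have n: "n > 0" and per: "v i = v (i mod n)" and len: "norm (v (Suc i) - v i) = 1 / real n" for i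
    using pd by (auto simp: polygon_data_def)
  have unit: "norm (real n *\<^sub>R (v (Suc i) - v i)) = 1" for i using n len by simp
  define i where "i = j + k"
  have turn: "cos (1 / (real n * \<rho>)) \<le> (real n *\<^sub>R (v (Suc i) - v i)) \<bullet> (real n *\<^sub>R (v (Suc (Suc i)) - v (Suc i)))"
  proof -
    \<comment> \<open>Curvature is bounded only at the indices 1, ..., n. The predecessor is
      therefore reduced modulo n, so that the middle vertex gets an index in that range.\<close>
    define m where "m = Suc (i mod n)"
    have "m \<in> {1..n}" using n by (auto simp: m_def Suc_le_eq)
    from dc[OF this] have "disc_curv (v (i mod n)) (v (Suc (i mod n))) (v (Suc (Suc (i mod n)))) \<le> ereal (1 / \<rho>)"
      by (simp add: m_def)
    moreover have "v (Suc (i mod n)) = v (Suc i)" "v (Suc (Suc (i mod n))) = v (Suc (Suc i))"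
      using per[of "Suc (i mod n)"] per[of "Suc i"] per[of "Suc (Suc (i mod n))"] per[of "Suc (Suc i)"]
      by (simp_all add: mod_Suc_eq mod_Suc_Suc_eq)
    ultimately have "disc_curv (v i) (v (Suc i)) (v (Suc (Suc i))) \<le> ereal (1 / \<rho>)"
      using per[of i] by simp
    moreover have "1 / real n / \<rho> \<le> pi"
    proof -
      have "1 / (real n * \<rho>) \<le> real (Suc k) / (real n * \<rho>)" using \<open>\<rho> > 0\<close> by (intro divide_right_mono) auto
      then show ?thesis using Suc.prems by simp
    qed
    ultimately show ?thesis
      using disc_curv_le_imp_turn[OF len len, of \<rho> i] n \<open>\<rho> > 0\<close> by simp
  qed
  have le: "real k / (real n * \<rho>) \<le> real (Suc k) / (real n * \<rho>)"
    using \<open>\<rho> > 0\<close> by (intro divide_right_mono) auto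
  have sum: "real k / (real n * \<rho>) + 1 / (real n * \<rho>) = real (Suc k) / (real n * \<rho>)"
    by (simp add: add_divide_distrib[symmetric] add.commute)
  have "cos (real k / (real n * \<rho>) + 1 / (real n * \<rho>)) \<le>
     (real n *\<^sub>R (v (Suc j) - v j)) \<bullet> (real n *\<^sub>R (v (Suc (Suc i)) - v (Suc i)))"
    by (rule sphere_triangle[OF unit unit unit _ turn])
      (use Suc le sum \<open>\<rho> > 0\<close> in \<open>auto simp: i_def\<close>)
  then show ?case unfolding sum by (simp add: i_def)
qed

text \<open>Points at distance t - s lie on edges whose indices differ by at most n (t - s) + 1; the
  surplus 1 costs one turn by 1 / (n rho), which vanishes as n grows.\<close>

lemma polygon_tangent_angle:
  assumes per: "periodic1 p" and pd: "polygon_data n p v s0" and "\<rho> > 0"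
    and dc: "\<And>i. i \<in> {1..n} \<Longrightarrow> disc_curv (v (i - 1)) (v i) (v (Suc i)) \<le> ereal (1 / \<rho>)"
    and st: "s \<le> t" "(t - s) / \<rho> + 1 / (real n * \<rho>) \<le> pi"
    and diff: "p differentiable (at s)" "p differentiable (at t)"
  shows "cos ((t - s) / \<rho> + 1 / (real n * \<rho>)) \<le> vector_derivative p (at s) \<bullet> vector_derivative p (at t)"
proof -
  obtain s1 where s1: "s1 \<le> s" "polygon_data n p v s1" using polygon_data_start_le[OF per pd] .
  have n: "n > 0" using pd by (simp add: polygon_data_def)
  define i j where "i = nat \<lfloor>real n * (s - s1)\<rfloor>" and "j = nat \<lfloor>real n * (t - s1)\<rfloor>"
  obtain a where a: "s = s1 + (real i + a) / real n" "0 \<le> a" "a < 1"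
    using polygon_param[OF n s1(1)] unfolding i_def by metis
  obtain b where b: "t = s1 + (real j + b) / real n" "0 \<le> b" "b < 1"
    using polygon_param[OF n, of s1 t] s1(1) st(1) unfolding j_def by (metis order_trans)
  have "i \<le> j" unfolding i_def j_def using st(1) n by (intro nat_mono floor_mono) simp
  then obtain k where k: "j = i + k" using le_Suc_ex by blast
  have "real k \<le> real n * (t - s) + 1"
    using a b n by (simp add: k field_simps)
  then have "real k / (real n * \<rho>) \<le> (real n * (t - s) + 1) / (real n * \<rho>)"
    using \<open>\<rho> > 0\<close> by (intro divide_right_mono) auto
  also have "\<dots> = (t - s) / \<rho> + 1 / (real n * \<rho>)" using n by (simp add: add_divide_distrib)
  finally have kle: "real k / (real n * \<rho>) \<le> (t - s) / \<rho> + 1 / (real n * \<rho>)" .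
  then have "cos ((t - s) / \<rho> + 1 / (real n * \<rho>)) \<le> cos (real k / (real n * \<rho>))"
    using st \<open>\<rho> > 0\<close> by (intro cos_monotone_0_pi_le) auto
  also have "\<dots> \<le> vector_derivative p (at s) \<bullet> vector_derivative p (at t)"
    using polygon_turn[OF s1(2) \<open>\<rho> > 0\<close> dc, of k i] kle st(2)
    by (simp add: polygon_vector_derivative[OF s1(2) diff(1) a] polygon_vector_derivative[OF s1(2) diff(2) b] k)
  finally show ?thesis .
qed

section \<open>Almost everywhere derivatives of arc length curves and the W(1,infinity)
  distance\<close>

lemma arclength_AE:
  assumes "\<gamma> \<in> arclength_curves"
  shows "negligible {t. \<not> (\<gamma> differentiable (at t) \<and> norm (vector_derivative \<gamma> (at t)) = 1)}"
proof -
  have "AE t in lebesgue. \<gamma> differentiable (at t) \<and> norm (vector_derivative \<gamma> (at t)) = 1"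
    using assms by (simp add: arclength_curves_def)
  then show ?thesis
    unfolding eventually_ae_filter_negligible using negligible_subset by auto
qed

lemma has_vector_derivative_periodic:
  assumes "periodic1 f"
  shows "(f has_vector_derivative D) (at (t + 1)) \<longleftrightarrow> (f has_vector_derivative D) (at t)"
proof
  assume *: "(f has_vector_derivative D) (at (t + 1))"
  have "((\<lambda>x. x + 1) has_vector_derivative 1) (at t)" by (auto intro!: derivative_eq_intros)
  from vector_diff_chain_at[OF this *] show "(f has_vector_derivative D) (at t)"
    using assms by (simp add: o_def periodic1_def)
next
  assume *: "(f has_vector_derivative D) (at t)"
  have "((\<lambda>x. x - 1) has_vector_derivative 1) (at (t + 1))" by (auto intro!: derivative_eq_intros)
  moreover have "f (x - 1) = f x" for x using assms unfolding periodic1_def by (metis diff_add_cancel)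
  ultimately show "(f has_vector_derivative D) (at (t + 1))"
    using vector_diff_chain_at[of "\<lambda>x. x - 1" 1 "t + 1" f D] * by (simp add: o_def)
qed

lemma vector_derivative_diff:
  assumes "f differentiable (at t)" "g differentiable (at t)"
  shows "vector_derivative (\<lambda>t. f t - g t) (at t) = vector_derivative f (at t) - vector_derivative g (at t)"
  using assms by (intro vector_derivative_at has_vector_derivative_diff) (simp_all flip: vector_derivative_works)

lemma arclength_lipschitz1:
  assumes "\<gamma> \<in> arclength_curves"
  shows "1-lipschitz_on UNIV \<gamma>"
proof (rule lipschitz_on_leI)
  obtain L where L: "L-lipschitz_on UNIV \<gamma>" using assms by (auto simp: arclength_curves_def)
  fix s t :: real assume "s \<le> t"
  have "norm (\<gamma> t - \<gamma> s) \<le> 1 * (t - s)"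
  proof (rule lipschitz_AE_deriv_bound[OF \<open>s \<le> t\<close> lipschitz_on_subset[OF L subset_UNIV] arclength_AE[OF assms]])
    fix x assume "x \<notin> {t. \<not> (\<gamma> differentiable (at t) \<and> norm (vector_derivative \<gamma> (at t)) = 1)}"
    then show "\<exists>D. norm D \<le> 1 \<and> (\<gamma> has_vector_derivative D) (at x)"
      by (intro exI[of _ "vector_derivative \<gamma> (at x)"]) (simp flip: vector_derivative_works)
  qed
  then show "dist (\<gamma> s) (\<gamma> t) \<le> 1 * dist s t"
    using \<open>s \<le> t\<close> by (simp add: dist_norm norm_minus_commute)
qed auto

text \<open>The distance controls both parts of the norm because each part is nonnegative. The slack
  e in the derivative bound avoids the question whether the infimum over essential bounds is
  attained.\<close>

lemma w1inf_dist_bounds: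
  assumes "\<gamma> \<in> arclength_curves" "\<eta> \<in> arclength_curves"
  shows norm_le_w1inf_dist: "norm (\<gamma> t - \<eta> t) \<le> w1inf_dist \<gamma> \<eta>"
    and deriv_le_w1inf_dist: "e > 0 \<Longrightarrow> negligible {t. \<not> (\<gamma> differentiable (at t) \<and> \<eta> differentiable (at t) \<and>
        norm (vector_derivative \<gamma> (at t) - vector_derivative \<eta> (at t)) \<le> w1inf_dist \<gamma> \<eta> + e)}"
proof -
  define f where "f t = \<gamma> t - \<eta> t" for t
  have per: "periodic1 \<gamma>" "periodic1 \<eta>" using assms by (auto simp: arclength_curves_def)
  have perf: "periodic1 f" using per by (simp add: periodic1_def f_def)
  define S where "S = {C. 0 \<le> C \<and> (AE t in lebesgue_on {0..1}. norm (vector_derivative f (at t)) \<le> C)}"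
  have w: "w1inf_dist \<gamma> \<eta> = (SUP t\<in>{0..1}. norm (f t)) + Inf S"
    by (simp add: w1inf_dist_def w1inf_norm_def S_def f_def[abs_def])
  have "continuous_on UNIV f"
    unfolding f_def using assms[THEN arclength_lipschitz1]
    by (intro continuous_intros lipschitz_on_continuous_on)
  then have "compact ((\<lambda>t. norm (f t)) ` {0..1})"
    using compact_continuous_image[OF continuous_on_norm[OF continuous_on_subset] compact_Icc] by blast
  then have bdd: "bdd_above ((\<lambda>t. norm (f t)) ` {0..1})"
    by (intro bounded_imp_bdd_above compact_imp_bounded)
  have sup: "norm (f t) \<le> (SUP t\<in>{0..1}. norm (f t))" for t
  proof -
    have "norm (f (frac t)) \<le> (SUP t\<in>{0..1}. norm (f t))"
      using frac_ge_0[of t] frac_lt_1[of t] by (intro cSUP_upper[OF _ bdd]) auto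
    then show ?thesis by (simp add: periodic1_frac[OF perf])
  qed
  define N where "N = {t. \<not> (\<gamma> differentiable (at t) \<and> norm (vector_derivative \<gamma> (at t)) = 1)} \<union>
     {t. \<not> (\<eta> differentiable (at t) \<and> norm (vector_derivative \<eta> (at t)) = 1)}"
  have N: "negligible N" unfolding N_def using assms by (intro negligible_Un arclength_AE)
  have AE_iff: "(AE t in lebesgue_on {0..1}. Q t) \<longleftrightarrow> (\<exists>N. negligible N \<and> {t\<in>{0..1}. \<not> Q t} \<subseteq> N)" for Q :: "real \<Rightarrow> bool"
    by (subst AE_restrict_space_iff) (auto simp: eventually_ae_filter_negligible)
  have "norm (vector_derivative f (at t)) \<le> 2" if "t \<notin> N" for t
    using that norm_triangle_ineq4[of "vector_derivative \<gamma> (at t)" "vector_derivative \<eta> (at t)"]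
    unfolding f_def by (subst vector_derivative_diff) (auto simp: N_def)
  then have "{t \<in> {0..1}. \<not> norm (vector_derivative f (at t)) \<le> 2} \<subseteq> N" by auto
  \<comment> \<open>Two unit vectors differ by at most 2. Nonemptiness matters, since the infimum of
    an empty set of reals carries no information.\<close>
  with N have "2 \<in> S" unfolding S_def AE_iff by auto
  then have ne: "S \<noteq> {}" by auto
  have "Inf S \<ge> 0" using ne by (intro cInf_greatest) (auto simp: S_def)
  then show "norm (\<gamma> t - \<eta> t) \<le> w1inf_dist \<gamma> \<eta>" using sup[of t] by (simp add: w f_def)
  assume "e > 0"
  then obtain C where C: "C \<in> S" "C < Inf S + e" using cInf_lessD[OF ne, of "Inf S + e"] by auto
  have "(SUP t\<in>{0..1}. norm (f t)) \<ge> 0" using sup[of 0] norm_ge_zero order_trans by blast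
  with C have Cle: "C \<le> w1inf_dist \<gamma> \<eta> + e" by (simp add: w)
  obtain N' where N': "negligible N'" "{t\<in>{0..1}. \<not> norm (vector_derivative f (at t)) \<le> C} \<subseteq> N'"
    using C(1) unfolding S_def AE_iff by blast
  define P where "P t \<longleftrightarrow> norm (vector_derivative f (at t)) \<le> C" for t
  have "negligible {t. \<not> P t}"
  proof (rule AE_periodic)
    show "P (t + 1) \<longleftrightarrow> P t" for t
      by (simp add: P_def vector_derivative_def has_vector_derivative_periodic[OF perf])
    show "negligible {t \<in> {0..1}. \<not> P t}" using N' unfolding P_def by (rule negligible_subset)
  qed
  with N have "negligible (N \<union> {t. \<not> P t})" by (rule negligible_Un)
  then show "negligible {t. \<not> (\<gamma> differentiable (at t) \<and> \<eta> differentiable (at t) \<and>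
        norm (vector_derivative \<gamma> (at t) - vector_derivative \<eta> (at t)) \<le> w1inf_dist \<gamma> \<eta> + e)}"
  proof (rule negligible_subset)
    show "{t. \<not> (\<gamma> differentiable (at t) \<and> \<eta> differentiable (at t) \<and>
        norm (vector_derivative \<gamma> (at t) - vector_derivative \<eta> (at t)) \<le> w1inf_dist \<gamma> \<eta> + e)}
        \<subseteq> N \<union> {t. \<not> P t}"
    proof (rule subsetI, rule ccontr)
      fix t assume t: "t \<in> {t. \<not> (\<gamma> differentiable (at t) \<and> \<eta> differentiable (at t) \<and>
          norm (vector_derivative \<gamma> (at t) - vector_derivative \<eta> (at t)) \<le> w1inf_dist \<gamma> \<eta> + e)}"
        "t \<notin> N \<union> {t. \<not> P t}"
      then have "\<gamma> differentiable (at t)" "\<eta> differentiable (at t)" "P t" by (auto simp: N_def)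
      then have "norm (vector_derivative \<gamma> (at t) - vector_derivative \<eta> (at t)) \<le> C"
        unfolding P_def f_def by (simp add: vector_derivative_diff)
      with t \<open>\<gamma> differentiable (at t)\<close> \<open>\<eta> differentiable (at t)\<close> Cle show False by auto
    qed
  qed
qed

section \<open>Limits of thick polygons\<close>

lemma local_minimum_imp_local_extremum:
  "e > 0 \<Longrightarrow> (\<And>u. \<bar>u - s\<bar> < e \<Longrightarrow> f s \<le> f u) \<Longrightarrow> local_extremum f s"
  unfolding local_extremum_def by blast

text \<open>A value below b is not taken on the boundary h = c or h = 1 - c, so the minimum of the
  distance over the strip is interior and varying either point alone shows a doubly critical pair.
  The level b is kept apart from d because a polygon near the limit curve satisfies the boundary
  estimates only up to a small error.\<close>

lemma dcsd_far:
  assumes per: "periodic1 p" and inj: "inj_on p {0..<1}" and cont: "continuous_on UNIV p"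
    and dcsd: "ereal d \<le> dcsd p" and c: "0 < c"
    and ends: "\<And>s. b \<le> norm (p (s + c) - p s)" "\<And>s. b \<le> norm (p (s + (1 - c)) - p s)" "b \<le> d"
    and h: "c \<le> h" "h \<le> 1 - c"
  shows "b \<le> norm (p (s + h) - p s)"
proof (rule ccontr)
  assume neg: "\<not> ?thesis"
  define f where "f x = norm (p (fst x + snd x) - p (fst x))" for x :: "real \<times> real"
  have contf: "continuous_on K f" for K
    unfolding f_def
    by (intro continuous_intros continuous_on_compose2[OF cont]) auto
  have "compact ({0..1::real} \<times> {c..1-c})" by (intro compact_Times compact_Icc)
  moreover have "{0..1::real} \<times> {c..1-c} \<noteq> {}" using h by auto
  ultimately obtain m where m: "m \<in> {0..1::real} \<times> {c..1-c}" "\<And>y. y \<in> {0..1::real} \<times> {c..1-c} \<Longrightarrow> f m \<le> f y"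
    using continuous_attains_inf[OF _ _ contf] by metis
  obtain s1 h1 where sh: "m = (s1, h1)" by fastforce
  \<comment> \<open>The minimum over base points in one period is a minimum over all base
    points.\<close>
  have min: "norm (p (s1 + h1) - p s1) \<le> norm (p (u + k) - p u)" if "c \<le> k" "k \<le> 1 - c" for u k
  proof -
    have "f m \<le> f (frac u, k)" using that frac_ge_0[of u] frac_lt_1[of u] by (intro m) auto
    moreover have "p (frac u + k) = p (u + k)"
      using periodic1_add_int[OF per, of "frac u + k" "\<lfloor>u\<rfloor>"] by (simp add: frac_def)
    ultimately show ?thesis by (simp add: f_def sh periodic1_frac[OF per])
  qed
  have less: "norm (p (s1 + h1) - p s1) < b" using min[OF h, of s] neg by linarith
  have "c \<le> h1" "h1 \<le> 1 - c" using m(1) sh by auto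
  moreover have "h1 \<noteq> c" "h1 \<noteq> 1 - c" using less ends(1)[of s1] ends(2)[of s1] by auto
  ultimately have h1: "c < h1" "h1 < 1 - c" by auto
  define t where "t = s1 + h1"
  define e where "e = min (h1 - c) (1 - c - h1)"
  have "e > 0" using h1 by (simp add: e_def)
  have "p t \<noteq> p s1"
  proof
    assume "p t = p s1"
    then have "h1 \<in> \<int>" using periodic1_inj_iff[OF per inj, of t s1] by (simp add: t_def)
    then obtain k where "h1 = of_int k" by (auto simp: Ints_def)
    with h1 c have "0 < real_of_int k" "real_of_int k < 1" by linarith+
    then show False by simp
  qed
  \<comment> \<open>With t fixed, moving u changes the base point and the arc length t - u together;
    \<open>e\<close> keeps that length between c and 1 - c.\<close>
  moreover have "local_extremum (\<lambda>u. (norm (p t - p u))\<^sup>2) s1"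
  proof (rule local_minimum_imp_local_extremum[OF \<open>e > 0\<close>])
    fix u assume "\<bar>u - s1\<bar> < e"
    then have "norm (p t - p s1) \<le> norm (p (u + (t - u)) - p u)"
      using min[of "t - u" u] by (auto simp: t_def e_def)
    then show "(norm (p t - p s1))\<^sup>2 \<le> (norm (p t - p u))\<^sup>2" by (intro power_mono) auto
  qed
  moreover have "local_extremum (\<lambda>w. (norm (p w - p s1))\<^sup>2) t"
  proof (rule local_minimum_imp_local_extremum[OF \<open>e > 0\<close>])
    fix w assume "\<bar>w - t\<bar> < e"
    then have "norm (p t - p s1) \<le> norm (p (s1 + (w - s1)) - p s1)"
      using min[of "w - s1" s1] by (auto simp: t_def e_def)
    then show "(norm (p t - p s1))\<^sup>2 \<le> (norm (p w - p s1))\<^sup>2" by (intro power_mono) auto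
  qed
  ultimately have "(p t, p s1) \<in> dcrit p" by (auto simp: dcrit_def)
  then have "dcsd p \<le> ereal (dist (p t) (p s1))" unfolding dcsd_def by (intro Inf_lower) blast
  with dcsd have "d \<le> dist (p t) (p s1)" using ereal_less_eq(3) order_trans by blast
  with less \<open>b \<le> d\<close> show False by (simp add: dist_norm t_def)
qed

text \<open>Derivatives of the polygons converge on the full set D, where countably many null sets
  have been removed. The turning bound passes to the limit there, makes the derivative Lipschitz at
  small distances on D, and returns to all parameters by continuity of the extension.\<close>

lemma limit_of_thick_polygons_bounded_curvature:
  fixes p :: "nat \<Rightarrow> curve" and r :: "nat \<Rightarrow> nat"
  assumes \<gamma>: "\<gamma> \<in> arclength_curves" and p: "\<And>k. p k \<in> arclength_curves"
    and "\<rho> > 0" and conv: "(\<lambda>k. w1inf_dist (p k) \<gamma>) \<longlonglongrightarrow> 0"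
    and r: "filterlim r at_top sequentially"
    and pd: "\<And>k. polygon_data (r k) (p k) (v k) (s0 k)"
    and dc: "\<And>k i. i \<in> {1..r k} \<Longrightarrow> disc_curv (v k (i - 1)) (v k i) (v k (Suc i)) \<le> ereal (1 / \<rho>)"
  obtains T where "bounded_curvature \<gamma> T \<rho>"
proof -
  define d where "d t = vector_derivative \<gamma> (at t)" for t
  define N where "N k = {t. \<not> (p k differentiable (at t) \<and> \<gamma> differentiable (at t) \<and>
        norm (vector_derivative (p k) (at t) - d t) \<le> w1inf_dist (p k) \<gamma> + 1 / real (Suc k))}" for k
  define D where "D = - ((\<Union>k. N k) \<union> {t. \<not> (\<gamma> differentiable (at t) \<and> norm (d t) = 1)})"
  have "negligible (N k)" for k
    using deriv_le_w1inf_dist[OF p \<gamma>, of "1 / real (Suc k)" k] by (simp add: N_def d_def)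
  then have "negligible (\<Union>k. N k)" by (intro negligible_countable_Union) auto
  then have D: "negligible (- D)"
    unfolding D_def d_def using arclength_AE[OF \<gamma>] by (simp add: negligible_Un)
  have der: "(\<gamma> has_vector_derivative d t) (at t)" "norm (d t) = 1" if "t \<in> D" for t
    using that unfolding D_def d_def by (auto simp flip: vector_derivative_works)
  have pD: "p k differentiable (at t)" 
    "norm (vector_derivative (p k) (at t) - d t) \<le> w1inf_dist (p k) \<gamma> + 1 / real (Suc k)" if "t \<in> D" for t k
    using that unfolding D_def N_def by blast+
  have lim: "(\<lambda>k. vector_derivative (p k) (at t)) \<longlonglongrightarrow> d t" if "t \<in> D" for t
  proof (rule Lim_null[THEN iffD2], rule Lim_null_comparison)
    show "\<forall>\<^sub>F k in sequentially. norm (vector_derivative (p k) (at t) - d t) \<le> w1inf_dist (p k) \<gamma> + 1 / real (Suc k)"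
      using pD that by simp
    show "(\<lambda>k. w1inf_dist (p k) \<gamma> + 1 / real (Suc k)) \<longlonglongrightarrow> 0"
      using tendsto_add[OF conv LIMSEQ_inverse_real_of_nat] by (simp add: inverse_eq_divide)
  qed
  have "filterlim (\<lambda>k. real (r k)) at_top sequentially"
    using filterlim_compose[OF filterlim_real_sequentially r] .
  then have "(\<lambda>k. inverse (real (r k))) \<longlonglongrightarrow> 0" by (rule tendsto_inverse_0_at_top)
  from tendsto_divide[OF this tendsto_const, of \<rho>] \<open>\<rho> > 0\<close>
  have rlim: "(\<lambda>k. 1 / (real (r k) * \<rho>)) \<longlonglongrightarrow> 0" by (simp add: field_simps inverse_eq_divide)
  \<comment> \<open>Strictly below pi rho, so that the surplus angle 1 / (r k rho) eventually still
    fits under pi.\<close>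
  have turn: "cos ((t - s) / \<rho>) \<le> d s \<bullet> d t" if st: "s \<in> D" "t \<in> D" "s \<le> t" "t - s < pi * \<rho>" for s t
  proof (rule tendsto_le[OF sequentially_bot])
    show "(\<lambda>k. vector_derivative (p k) (at s) \<bullet> vector_derivative (p k) (at t)) \<longlonglongrightarrow> d s \<bullet> d t"
      by (intro tendsto_inner lim st)
    have "(\<lambda>k. cos ((t - s) / \<rho> + 1 / (real (r k) * \<rho>))) \<longlonglongrightarrow> cos ((t - s) / \<rho> + 0)"
      by (intro tendsto_intros rlim)
    then show "(\<lambda>k. cos ((t - s) / \<rho> + 1 / (real (r k) * \<rho>))) \<longlonglongrightarrow> cos ((t - s) / \<rho>)" by simp
    have "pi - (t - s) / \<rho> > 0" using st \<open>\<rho> > 0\<close> by (simp add: field_simps)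
    then have "\<forall>\<^sub>F k in sequentially. 1 / (real (r k) * \<rho>) < pi - (t - s) / \<rho>"
      using order_tendstoD(2)[OF rlim] by blast
    then show "\<forall>\<^sub>F k in sequentially. cos ((t - s) / \<rho> + 1 / (real (r k) * \<rho>))
        \<le> vector_derivative (p k) (at s) \<bullet> vector_derivative (p k) (at t)"
    proof eventually_elim
      case (elim k)
      have "periodic1 (p k)" using p by (auto simp: arclength_curves_def)
      then show ?case
        using elim by (intro polygon_tangent_angle[OF _ pd \<open>\<rho> > 0\<close> dc] pD st) auto
    qed
  qed
  have lip: "norm (d s - d t) \<le> \<bar>s - t\<bar> / \<rho>" if st: "s \<in> D" "t \<in> D" "\<bar>s - t\<bar> < pi * \<rho>" for s t
  proof -
    have "cos (\<bar>s - t\<bar> / \<rho>) \<le> d s \<bullet> d t"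
      using turn[of s t] turn[of t s] st by (cases "s \<le> t") (auto simp: inner_commute abs_if)
    then have "1 - d s \<bullet> d t \<le> (\<bar>s - t\<bar> / \<rho>)\<^sup>2 / 2" using one_minus_cos_le[of "\<bar>s - t\<bar> / \<rho>"] by linarith
    moreover have "(norm (d s - d t))\<^sup>2 = 2 - 2 * (d s \<bullet> d t)"
      using der(2)[OF st(1)] der(2)[OF st(2)]
      by (simp add: power2_norm_eq_inner inner_diff_left inner_diff_right inner_commute norm_eq_1)
    ultimately have "(norm (d s - d t))\<^sup>2 \<le> (\<bar>s - t\<bar> / \<rho>)\<^sup>2" by linarith
    then show ?thesis using \<open>\<rho> > 0\<close> by (intro power2_le_imp_le[of "norm (d s - d t)"]) auto
  qed
  have "uniformly_continuous_on D d"
    using \<open>\<rho> > 0\<close> lip by (intro local_lipschitz_imp_uniformly_continuous_on[of "pi * \<rho>" \<rho>]) auto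
  from lipschitz_uniformly_continuous_AE_deriv[OF arclength_lipschitz1[OF \<gamma>] D der(1) this]
  obtain T where T: "uniformly_continuous_on UNIV T" "\<And>x. (\<gamma> has_vector_derivative T x) (at x)"
    "\<And>x. x \<in> D \<Longrightarrow> T x = d x" by metis
  have cT: "isCont T x" for x
    using uniformly_continuous_imp_continuous[OF T(1)] continuous_on_eq_continuous_at[OF open_UNIV] by blast
  have ap: "\<exists>s. (\<forall>k. s k \<in> D \<and> a < s k \<and> s k < b) \<and> s \<longlonglongrightarrow> x" if "a < b" "x \<in> {a..b}" for a b x
  proof -
    have "{a<..<b} \<subseteq> closure D" by (simp add: closure_conegligible[OF D])
    then have "closure ({a<..<b} \<inter> D) = {a..b}"
      using closure_open_Int_superset[of "{a<..<b}" D] that(1) by simp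
    with that(2) have "x \<in> closure ({a<..<b} \<inter> D)" by simp
    then obtain s where "\<And>k. s k \<in> {a<..<b} \<inter> D" "s \<longlonglongrightarrow> x" unfolding closure_sequential by blast
    then show ?thesis by (intro exI[of _ s]) auto
  qed
  have unit: "norm (T x) = 1" for x
  proof -
    obtain s where s: "\<And>k. s k \<in> D" "s \<longlonglongrightarrow> x" using ap[of x "x + 1" x] by auto
    have "(\<lambda>k. norm (T (s k))) \<longlonglongrightarrow> norm (T x)"
      by (intro tendsto_norm isCont_tendsto_compose[OF cT] s)
    moreover have "norm (T (s k)) = 1" for k using s(1) T(3) der(2) by simp
    ultimately show ?thesis by (simp add: LIMSEQ_const_iff)
  qed
  have turnT: "cos ((v - u) / \<rho>) \<le> T u \<bullet> T v" if uv: "u < v" "v - u \<le> pi * \<rho>" for u v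
  proof -
    \<comment> \<open>The midpoint separates the approximating parameters: those near u stay to the
      left of those near v, and all differences are strictly below v - u, as \<open>turn\<close>
      demands.\<close>
    define m where "m = (u + v) / 2"
    have m: "u < m" "m < v" using uv by (auto simp: m_def)
    obtain s where s: "\<And>k. s k \<in> D" "\<And>k. u < s k" "\<And>k. s k < m" "s \<longlonglongrightarrow> u" using ap[OF m(1), of u] m by auto
    obtain t where t: "\<And>k. t k \<in> D" "\<And>k. m < t k" "\<And>k. t k < v" "t \<longlonglongrightarrow> v" using ap[OF m(2), of v] m by auto
    show ?thesis
    proof (rule LIMSEQ_le)
      show "(\<lambda>k. cos ((t k - s k) / \<rho>)) \<longlonglongrightarrow> cos ((v - u) / \<rho>)"
        using \<open>\<rho> > 0\<close> by (intro tendsto_intros s t) auto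
      show "(\<lambda>k. T (s k) \<bullet> T (t k)) \<longlonglongrightarrow> T u \<bullet> T v"
        by (intro tendsto_inner isCont_tendsto_compose[OF cT] s t)
      have "cos ((t k - s k) / \<rho>) \<le> T (s k) \<bullet> T (t k)" for k
        using turn[OF s(1) t(1), of k k] s(2,3)[of k] t(2,3)[of k] uv by (simp add: T(3) s(1) t(1))
      then show "\<exists>N. \<forall>k\<ge>N. cos ((t k - s k) / \<rho>) \<le> T (s k) \<bullet> T (t k)" by blast
    qed
  qed
  have "bounded_curvature \<gamma> T \<rho>"
  proof
    fix u v :: real assume uv: "\<bar>u - v\<bar> \<le> pi * \<rho>"
    show "cos (\<bar>u - v\<bar> / \<rho>) \<le> T u \<bullet> T v"
    proof (cases u v rule: linorder_cases)
      case less then show ?thesis using turnT[of u v] uv by simp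
    next
      case equal then show ?thesis using unit[of v] by (simp add: norm_eq_1)
    next
      case greater then show ?thesis using turnT[of v u] uv by (simp add: inner_commute)
    qed
  qed (use T unit \<open>\<rho> > 0\<close> in auto)
  then show ?thesis using that by blast
qed

lemma limit_of_thick_polygons:
  fixes p :: "nat \<Rightarrow> curve" and r :: "nat \<Rightarrow> nat"
  assumes \<gamma>: "\<gamma> \<in> arclength_curves" and p: "\<And>k. p k \<in> arclength_curves" and inj: "\<And>k. inj_on (p k) {0..<1}"
    and "\<rho> > 0" and conv: "(\<lambda>k. w1inf_dist (p k) \<gamma>) \<longlonglongrightarrow> 0"
    and r: "filterlim r at_top sequentially"
    and pd: "\<And>k. polygon_data (r k) (p k) (v k) (s0 k)"
    and dc: "\<And>k i. i \<in> {1..r k} \<Longrightarrow> disc_curv (v k (i - 1)) (v k i) (v k (Suc i)) \<le> ereal (1 / \<rho>)"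
    and dcsd: "\<And>k. ereal (2 * \<rho>) \<le> dcsd (p k)"
    and abc: "a < b" "b < c" "c < a + 1"
  shows "circumradius_ge \<rho> (\<gamma> a) (\<gamma> b) (\<gamma> c)"
proof -
  obtain T where "bounded_curvature \<gamma> T \<rho>"
    using limit_of_thick_polygons_bounded_curvature[OF \<gamma> p \<open>\<rho> > 0\<close> conv r pd dc] by metis
  then interpret bounded_curvature \<gamma> T \<rho> .
  have per: "periodic1 \<gamma>" "\<And>k. periodic1 (p k)" using \<gamma> p by (auto simp: arclength_curves_def)
  then have per': "\<gamma> (t + 1) = \<gamma> t" for t by (simp add: periodic1_def)
  have pos: "pi * \<rho> > 0" using \<open>\<rho> > 0\<close> by simp
  have end1: "2 * \<rho> \<le> norm (\<gamma> (s + pi * \<rho>) - \<gamma> s)" for s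
    using chord_lower_bound[of s "s + pi * \<rho>"] pos \<open>\<rho> > 0\<close> by simp
  have end2: "2 * \<rho> \<le> norm (\<gamma> (s + (1 - pi * \<rho>)) - \<gamma> s)" for s
    using end1[of "s - pi * \<rho>"] per'[of "s - pi * \<rho>"] by (simp add: norm_minus_commute algebra_simps)
  \<comment> \<open>The boundary estimates hold for the limit curve and thus for a close polygon up
    to e / 2, so \<open>dcsd_far\<close> is used at the level 2 rho - e / 2; transfer back to the
    limit costs another e / 2.\<close>
  have far: "2 * \<rho> \<le> norm (\<gamma> (s + h) - \<gamma> s)" if h: "pi * \<rho> \<le> h" "h \<le> 1 - pi * \<rho>" for s h
  proof (rule field_le_epsilon)
    fix e :: real assume "e > 0"
    then have "\<forall>\<^sub>F k in sequentially. w1inf_dist (p k) \<gamma> < e / 4"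
      using order_tendstoD(2)[OF conv, of "e / 4"] by simp
    then obtain k where k: "w1inf_dist (p k) \<gamma> < e / 4"
      using eventually_happens sequentially_bot by blast
    have close: "\<bar>norm (p k t - p k s) - norm (\<gamma> t - \<gamma> s)\<bar> \<le> e / 2" for s t
    proof -
      have "norm (p k t - \<gamma> t) \<le> e / 4" "norm (p k s - \<gamma> s) \<le> e / 4"
        using norm_le_w1inf_dist[OF p \<gamma>] k by (meson less_imp_le order_trans)+
      moreover have "norm ((p k t - p k s) - (\<gamma> t - \<gamma> s)) = norm ((p k t - \<gamma> t) - (p k s - \<gamma> s))"
        by (rule arg_cong[where f=norm]) simp
      ultimately have "norm ((p k t - p k s) - (\<gamma> t - \<gamma> s)) \<le> e / 2"
        using norm_triangle_ineq4[of "p k t - \<gamma> t" "p k s - \<gamma> s"] by linarith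
      then show ?thesis using norm_triangle_ineq3[of "p k t - p k s" "\<gamma> t - \<gamma> s"] by linarith
    qed
    have "2 * \<rho> - e / 2 \<le> norm (p k (s + h) - p k s)"
    proof (rule dcsd_far[OF per(2) inj _ dcsd pos _ _ _ h])
      show "continuous_on UNIV (p k)" by (rule lipschitz_on_continuous_on[OF arclength_lipschitz1[OF p]])
      show "2 * \<rho> - e / 2 \<le> norm (p k (s + pi * \<rho>) - p k s)" for s
        using close[of "s + pi * \<rho>" s] end1[of s] by linarith
      show "2 * \<rho> - e / 2 \<le> norm (p k (s + (1 - pi * \<rho>)) - p k s)" for s
        using close[of "s + (1 - pi * \<rho>)" s] end2[of s] by linarith
    qed (use \<open>e > 0\<close> in simp)
    then show "2 * \<rho> \<le> norm (\<gamma> (s + h) - \<gamma> s) + e" using close[of "s + h" s] by linarith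
  qed
  show ?thesis by (rule circumradius_ge_closed[OF per' far abc])
qed

section \<open>Regularity of thick curves\<close>

text \<open>Divide the polynomial condition by (t - s)^2 and let t tend to s. The limit bounds from
  below the radius of the circle that touches the curve at \<open>\<gamma> s\<close> and passes
  through x.\<close>

lemma circumradius_ge_tangent:
  fixes \<gamma> :: "real \<Rightarrow> 'a::real_inner"
  assumes der: "(\<gamma> has_vector_derivative T) (at s)"
    and ge: "\<And>t. circumradius_ge \<rho> (\<gamma> s) (\<gamma> t) x"
  shows "4 * \<rho>\<^sup>2 * gram T (x - \<gamma> s) \<le> (norm T)\<^sup>2 * (norm (x - \<gamma> s))\<^sup>2 * (norm (x - \<gamma> s))\<^sup>2"
proof -
  define Q where "Q t = (1 / (t - s)) *\<^sub>R (\<gamma> t - \<gamma> s)" for t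
  have lim: "(Q \<longlongrightarrow> T) (at s)"
    using has_vector_derivative_quotient[OF der] by (simp add: Q_def[abs_def])
  have cont: "(\<gamma> \<longlongrightarrow> \<gamma> s) (at s)"
    using has_vector_derivative_continuous[OF der] by (simp add: continuous_within)
  show ?thesis
  proof (rule tendsto_le[OF trivial_limit_at])
    show "((\<lambda>t. (norm (Q t))\<^sup>2 * (norm (x - \<gamma> s))\<^sup>2 * (norm (x - \<gamma> t))\<^sup>2)
        \<longlongrightarrow> (norm T)\<^sup>2 * (norm (x - \<gamma> s))\<^sup>2 * (norm (x - \<gamma> s))\<^sup>2) (at s)"
      by (intro tendsto_intros lim cont)
    show "((\<lambda>t. 4 * \<rho>\<^sup>2 * gram (Q t) (x - \<gamma> s)) \<longlongrightarrow> 4 * \<rho>\<^sup>2 * gram T (x - \<gamma> s)) (at s)"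
      unfolding gram_def by (intro tendsto_intros lim)
    have "4 * \<rho>\<^sup>2 * gram (Q t) (x - \<gamma> s) \<le> (norm (Q t))\<^sup>2 * (norm (x - \<gamma> s))\<^sup>2 * (norm (x - \<gamma> t))\<^sup>2" for t
    proof -
      define c where "c = 1 / (t - s)"
      have "gram (Q t) (x - \<gamma> s) = c\<^sup>2 * gram (\<gamma> t - \<gamma> s) (x - \<gamma> s)"
        by (simp add: gram_def Q_def c_def[symmetric] power2_eq_square algebra_simps)
      moreover have "(norm (Q t))\<^sup>2 = c\<^sup>2 * (norm (\<gamma> t - \<gamma> s))\<^sup>2"
        by (simp add: Q_def c_def[symmetric] power_mult_distrib)
      moreover have "c\<^sup>2 * (4 * \<rho>\<^sup>2 * gram (\<gamma> t - \<gamma> s) (x - \<gamma> s)) \<le>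
          c\<^sup>2 * ((norm (\<gamma> t - \<gamma> s))\<^sup>2 * (norm (x - \<gamma> s))\<^sup>2 * (norm (x - \<gamma> t))\<^sup>2)"
        using ge[of t] unfolding circumradius_ge_def by (intro mult_left_mono) auto
      ultimately show ?thesis by (simp add: mult_ac)
    qed
    then show "\<forall>\<^sub>F t in at s. 4 * \<rho>\<^sup>2 * gram (Q t) (x - \<gamma> s)
        \<le> (norm (Q t))\<^sup>2 * (norm (x - \<gamma> s))\<^sup>2 * (norm (x - \<gamma> t))\<^sup>2" by simp
  qed
qed

text \<open>Near a point with tangent T, the height in direction T is injective on a thick curve. This excludes
  that the curve turns back, i.e. that a nearby tangent is close to -T.\<close>
lemma equal_height_imp_eq:
  fixes a b T :: "'a::real_inner"
  assumes T: "norm T = 1" and \<rho>: "\<rho> > 0"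
    and a: "4 * \<rho>\<^sup>2 * gram T a \<le> (norm a)\<^sup>2 * (norm a)\<^sup>2" and b: "4 * \<rho>\<^sup>2 * gram T b \<le> (norm b)\<^sup>2 * (norm b)\<^sup>2"
    and ab: "4 * \<rho>\<^sup>2 * gram a b \<le> (norm a)\<^sup>2 * (norm b)\<^sup>2 * (norm (b - a))\<^sup>2"
    and h: "a \<bullet> T = b \<bullet> T" and small: "norm a \<le> \<rho>" "norm b \<le> \<rho>"
  shows "a = b"
proof (rule ccontr)
  assume "a \<noteq> b"
  define c where "c = b - a"
  have TT: "T \<bullet> T = 1" using T by (simp add: norm_eq_1)
  have "c \<noteq> 0" using \<open>a \<noteq> b\<close> by (simp add: c_def)
  moreover have "c \<bullet> T = 0" using h by (simp add: c_def inner_diff_left)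
  ultimately have c: "c \<bullet> c > 0" "c \<bullet> T = 0" by simp_all
  have sm: "a \<bullet> a \<le> \<rho>\<^sup>2" "b \<bullet> b \<le> \<rho>\<^sup>2"
    using power_mono[OF small(1), of 2] power_mono[OF small(2), of 2] by (simp_all add: power2_norm_eq_inner)
  have a': "4 * \<rho>\<^sup>2 * (a \<bullet> a - (a \<bullet> T)\<^sup>2) \<le> (a \<bullet> a) * (a \<bullet> a)"
    using a by (simp add: gram_def TT power2_norm_eq_inner inner_commute)
  have b': "4 * \<rho>\<^sup>2 * (b \<bullet> b - (b \<bullet> T)\<^sup>2) \<le> (b \<bullet> b) * (b \<bullet> b)"
    using b by (simp add: gram_def TT power2_norm_eq_inner inner_commute)
  show False
  proof (cases "a = 0")
    case True
    then have "b \<noteq> 0" "b \<bullet> T = 0" using \<open>a \<noteq> b\<close> h by auto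
    then have "b \<bullet> b > 0" "(4 * \<rho>\<^sup>2) * (b \<bullet> b) \<le> (b \<bullet> b) * (b \<bullet> b)" using b' by auto
    then have "4 * \<rho>\<^sup>2 \<le> b \<bullet> b" by simp
    then show False using sm zero_less_power[OF \<rho>, of 2] by linarith
  next
    case False
    then have "a \<bullet> a > 0" by simp
    \<comment> \<open>Since c is orthogonal to T, only a - k T contributes to the inner product of a
      and c, and Cauchy-Schwarz for that part leaves \<open>gram a c\<close> at least k^2
      |c|^2.\<close>
    define k where "k = a \<bullet> T"
    have "(a - k *\<^sub>R T) \<bullet> c = a \<bullet> c" using c(2) by (simp add: inner_diff_left inner_commute[of T c])
    moreover have "(a - k *\<^sub>R T) \<bullet> (a - k *\<^sub>R T) = a \<bullet> a - k\<^sup>2"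
      by (simp add: inner_diff_left inner_diff_right TT k_def inner_commute power2_eq_square)
    ultimately have "(a \<bullet> c)\<^sup>2 \<le> (a \<bullet> a - k\<^sup>2) * (c \<bullet> c)"
      using Cauchy_Schwarz_ineq[of "a - k *\<^sub>R T" c] by simp
    then have "gram a c \<ge> k\<^sup>2 * (c \<bullet> c)" by (simp add: gram_def algebra_simps)
    moreover have "gram a c = gram a b"
      by (simp add: gram_def c_def inner_diff_left inner_diff_right inner_commute power2_eq_square algebra_simps)
    ultimately have "4 * \<rho>\<^sup>2 * (k\<^sup>2 * (c \<bullet> c)) \<le> 4 * \<rho>\<^sup>2 * gram a b" by (intro mult_left_mono) auto
    also have "\<dots> \<le> (a \<bullet> a) * (b \<bullet> b) * (c \<bullet> c)" using ab by (simp add: power2_norm_eq_inner c_def)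
    finally have "(4 * \<rho>\<^sup>2 * k\<^sup>2) * (c \<bullet> c) \<le> ((a \<bullet> a) * (b \<bullet> b)) * (c \<bullet> c)" by (simp add: mult_ac)
    then have "4 * \<rho>\<^sup>2 * k\<^sup>2 \<le> (a \<bullet> a) * (b \<bullet> b)" using c by simp
    \<comment> \<open>The tangent condition bounds the part of a across T, the previous line the
      part k along T. Together they force 4 rho^2 \<le> |a|^2 + |b|^2, which is at most 2
      rho^2.\<close>
    then have "(4 * \<rho>\<^sup>2) * (a \<bullet> a) \<le> (a \<bullet> a + b \<bullet> b) * (a \<bullet> a)"
      using a' unfolding k_def[symmetric] distrib_right right_diff_distrib by (simp add: mult.commute)
    then have "4 * \<rho>\<^sup>2 \<le> a \<bullet> a + b \<bullet> b" using \<open>a \<bullet> a > 0\<close> by simp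
    then show False using sm zero_less_power[OF \<rho>, of 2] by linarith
  qed
qed

text \<open>Both tangents form with the line of d an angle whose squared sine is at most
  \<open>\<eta>\<close> = |d|^2 / (4 rho^2). As \<open>\<eta>\<close> \<le> 1/4, opposite
  orientations along d would make the inner product of S and T negative; with equal ones it is at
  least 1 - 2 \<open>\<eta>\<close>.\<close>

lemma tangents_close:
  fixes S T d :: "'a::real_inner"
  assumes n: "norm S = 1" "norm T = 1" and \<rho>: "\<rho> > 0"
    and S: "4 * \<rho>\<^sup>2 * gram S d \<le> (norm d)\<^sup>2 * (norm d)\<^sup>2" and T: "4 * \<rho>\<^sup>2 * gram T d \<le> (norm d)\<^sup>2 * (norm d)\<^sup>2"
    and nonneg: "0 \<le> S \<bullet> T" and small: "0 < norm d" "norm d \<le> \<rho>"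
  shows "norm (S - T) \<le> norm d / \<rho>"
proof -
  define e where "e = d /\<^sub>R norm d"
  have e: "norm e = 1" "d = norm d *\<^sub>R e" using small by (auto simp: e_def)
  define \<eta> where "\<eta> = (norm d)\<^sup>2 / (4 * \<rho>\<^sup>2)"
  have "(norm d)\<^sup>2 \<le> \<rho>\<^sup>2" using small by (intro power_mono) auto
  then have \<eta>: "0 \<le> \<eta>" "\<eta> \<le> 1/4" using \<rho> by (auto simp: \<eta>_def field_simps)
  have inner1: "S \<bullet> S = 1" "T \<bullet> T = 1" "e \<bullet> e = 1" using n e by (simp_all add: norm_eq_1)
  have *: "1 - (U \<bullet> e)\<^sup>2 \<le> \<eta>" if "U \<bullet> U = 1" "4 * \<rho>\<^sup>2 * gram U d \<le> (norm d)\<^sup>2 * (norm d)\<^sup>2" for U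
  proof -
    have "gram U d = gram U (norm d *\<^sub>R e)" using e(2) by simp
    also have "\<dots> = (norm d)\<^sup>2 * (1 - (U \<bullet> e)\<^sup>2)"
      using that inner1 unfolding gram_def by (simp add: power2_eq_square algebra_simps)
    finally have "(norm d)\<^sup>2 * (4 * \<rho>\<^sup>2 * (1 - (U \<bullet> e)\<^sup>2)) \<le> (norm d)\<^sup>2 * (norm d)\<^sup>2"
      using that(2) by (simp add: mult_ac)
    moreover have "(norm d)\<^sup>2 > 0" using small by simp
    ultimately have "4 * \<rho>\<^sup>2 * (1 - (U \<bullet> e)\<^sup>2) \<le> (norm d)\<^sup>2" by (simp only: mult_le_cancel_left_pos)
    then show ?thesis using \<rho> by (simp add: \<eta>_def field_simps)
  qed
  define p q where "p = S \<bullet> e" and "q = T \<bullet> e"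
  have p: "1 - p\<^sup>2 \<le> \<eta>" and q: "1 - q\<^sup>2 \<le> \<eta>" using *[OF inner1(1) S] *[OF inner1(2) T] by (simp_all add: p_def q_def)
  have "(S - p *\<^sub>R e) \<bullet> (T - q *\<^sub>R e) = S \<bullet> T - p * q"
    by (simp add: inner_diff_left inner_diff_right inner1 p_def q_def inner_commute)
  moreover have "(S - p *\<^sub>R e) \<bullet> (S - p *\<^sub>R e) = 1 - p\<^sup>2" "(T - q *\<^sub>R e) \<bullet> (T - q *\<^sub>R e) = 1 - q\<^sup>2"
    by (simp_all add: inner_diff_left inner_diff_right inner1 p_def q_def inner_commute power2_eq_square)
  ultimately have "(S \<bullet> T - p * q)\<^sup>2 \<le> (1 - p\<^sup>2) * (1 - q\<^sup>2)" "0 \<le> 1 - p\<^sup>2" "0 \<le> 1 - q\<^sup>2"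
    using Cauchy_Schwarz_ineq[of "S - p *\<^sub>R e" "T - q *\<^sub>R e"]
      inner_ge_zero[of "S - p *\<^sub>R e"] inner_ge_zero[of "T - q *\<^sub>R e"] by simp_all
  then have "(S \<bullet> T - p * q)\<^sup>2 \<le> \<eta>\<^sup>2"
    using mult_mono[OF p q] \<eta>(1) unfolding power2_eq_square by linarith
  then have st: "\<bar>S \<bullet> T - p * q\<bar> \<le> \<eta>" using \<eta> abs_le_square_iff[of "S \<bullet> T - p * q" \<eta>] by simp
  have "(1 - \<eta>) * (1 - \<eta>) \<le> p\<^sup>2 * q\<^sup>2" using p q \<eta> by (intro mult_mono) auto
  then have "(1 - \<eta>)\<^sup>2 \<le> (p * q)\<^sup>2" by (simp add: power2_eq_square mult_ac)
  then have "\<bar>p * q\<bar> \<ge> 1 - \<eta>" using \<eta> abs_le_square_iff[of "1 - \<eta>" "p * q"] by simp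
  with st nonneg \<eta> have "S \<bullet> T \<ge> 1 - 2 * \<eta>" by linarith
  moreover have "(norm (S - T))\<^sup>2 = 2 - 2 * (S \<bullet> T)"
    by (simp add: power2_norm_eq_inner inner_diff_left inner_diff_right inner_commute inner1)
  ultimately have "(norm (S - T))\<^sup>2 \<le> 4 * \<eta>" by linarith
  also have "\<dots> = (norm d / \<rho>)\<^sup>2" by (simp add: \<eta>_def power_divide)
  finally show ?thesis using \<rho> by (intro power2_le_imp_le[of "norm (S - T)"]) auto
qed

text \<open>A continuous injection of an interval is strictly monotone, so a function that rises at
  the left end cannot fall at the right end.\<close>

lemma inj_deriv_same_sign:
  fixes f :: "real \<Rightarrow> real"
  assumes "a < b" and cont: "continuous_on {a..b} f" and inj: "inj_on f {a..b}"
    and da: "(f has_real_derivative A) (at a)" "A > 0" and db: "(f has_real_derivative B) (at b)"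
  shows "B \<ge> 0"
proof (rule ccontr)
  assume "\<not> B \<ge> 0" then have "B < 0" by simp
  obtain d where d: "d > 0" "\<And>h. 0 < h \<Longrightarrow> h < d \<Longrightarrow> f a < f (a + h)"
    using DERIV_pos_inc_right[OF da] by blast
  obtain d' where d': "d' > 0" "\<And>h. 0 < h \<Longrightarrow> h < d' \<Longrightarrow> f b < f (b - h)"
    using DERIV_neg_dec_left[OF db \<open>B < 0\<close>] by blast
  define h where "h = min (min d d') (b - a) / 2"
  have h: "0 < h" "h < d" "h < d'" "h < b - a" using d d' \<open>a < b\<close> by (auto simp: h_def)
  have "f a < f (a + h) \<and> f (a + h) < f b \<or> f b < f (a + h) \<and> f (a + h) < f a"
    by (rule continuous_inj_imp_mono[OF _ _ cont inj]) (use h in auto)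
  moreover have "f a < f (b - h) \<and> f (b - h) < f b \<or> f b < f (b - h) \<and> f (b - h) < f a"
    by (rule continuous_inj_imp_mono[OF _ _ cont inj]) (use h in auto)
  ultimately show False using d(2)[OF h(1,2)] d'(2)[OF h(1,3)] by auto
qed

lemma inj_deriv_same_sign':
  fixes f :: "real \<Rightarrow> real"
  assumes "a < b" and cont: "continuous_on {a..b} f" and inj: "inj_on f {a..b}"
    and db: "(f has_real_derivative B) (at b)" "B > 0" and da: "(f has_real_derivative A) (at a)"
  shows "A \<ge> 0"
proof -
  have d: "((\<lambda>x. - f (- x)) has_real_derivative D) (at (- x))" if "(f has_real_derivative D) (at x)" for D x
  proof -
    have "((\<lambda>x. f (- x)) has_real_derivative - D) (at (- x))" using that DERIV_mirror[of f "- x" D] by (metis add.inverse_inverse DERIV_mirror)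
    from DERIV_minus[OF this] show ?thesis by simp
  qed
  show ?thesis
  proof (rule inj_deriv_same_sign)
    show "((\<lambda>x. - f (- x)) has_real_derivative B) (at (- b))" "((\<lambda>x. - f (- x)) has_real_derivative A) (at (- a))"
      using d da db by auto
    show "continuous_on {- b..- a} (\<lambda>x. - f (- x))"
      by (intro continuous_intros continuous_on_compose2[OF cont]) auto
    show "inj_on (\<lambda>x. - f (- x)) {- b..- a}"
    proof (rule inj_onI)
      fix x y assume "x \<in> {- b..- a}" "y \<in> {- b..- a}" "- f (- x) = - f (- y)"
      then have "- x = - y" using inj_onD[OF inj, of "- x" "- y"] by auto
      then show "x = y" by simp
    qed
  qed (use assms in auto)
qed

text \<open>Thickness compares a tangent with a chord only as lines, because \<open>gram\<close> is
  blind to signs. Injectivity of the height over a tangent fixes the orientation of nearby tangents;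
  then \<open>tangents_close\<close> makes the derivative Lipschitz at small distances on a set of
  full measure.\<close>

lemma thick_curve_C1:
  assumes \<gamma>: "\<gamma> \<in> arclength_curves" and inj: "inj_on \<gamma> {0..<1}" and "\<rho> > 0"
    and ge: "\<And>a b c. circumradius_ge \<rho> (\<gamma> a) (\<gamma> b) (\<gamma> c)"
  obtains T where "uniformly_continuous_on UNIV T" "\<And>t. (\<gamma> has_vector_derivative T t) (at t)" "\<And>t. norm (T t) = 1"
proof -
  define D where "D = {t. \<gamma> differentiable (at t) \<and> norm (vector_derivative \<gamma> (at t)) = 1}"
  define T where "T t = vector_derivative \<gamma> (at t)" for t
  have D: "negligible (- D)" using arclength_AE[OF \<gamma>] by (simp add: D_def Compl_eq)
  have T: "(\<gamma> has_vector_derivative T t) (at t)" "norm (T t) = 1" if "t \<in> D" for t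
    using that by (auto simp: D_def T_def simp flip: vector_derivative_works)
  have per: "periodic1 \<gamma>" using \<gamma> by (simp add: arclength_curves_def)
  note lip = arclength_lipschitz1[OF \<gamma>]
  have lip': "norm (\<gamma> t - \<gamma> s) \<le> \<bar>t - s\<bar>" for s t
    using lipschitz_onD[OF lip, of t s] by (simp add: dist_norm)
  have tan: "4 * \<rho>\<^sup>2 * gram (T s) (\<gamma> t - \<gamma> s) \<le> (norm (\<gamma> t - \<gamma> s))\<^sup>2 * (norm (\<gamma> t - \<gamma> s))\<^sup>2" if "s \<in> D" for s t
    using circumradius_ge_tangent[OF T(1)[OF that] ge] T(2)[OF that] by simp
  \<comment> \<open>A window of radius \<open>\<delta>\<close> has length at most 2/3, so the curve
    is injective on it, and its points stay within distance rho of the middle one.\<close>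
  define \<delta> where "\<delta> = min \<rho> (1/3)"
  have \<delta>: "0 < \<delta>" "\<delta> \<le> \<rho>" "\<delta> \<le> 1/3" using \<open>\<rho> > 0\<close> by (auto simp: \<delta>_def)
  have eqI: "u = w" if "\<gamma> u = \<gamma> w" "\<bar>u - w\<bar> < 1" for u w
  proof -
    have "u - w \<in> \<int>" using periodic1_inj_iff[OF per inj] that by blast
    then obtain k where "u - w = of_int k" by (auto simp: Ints_def)
    moreover from this that(2) have "k = 0" by auto
    ultimately show ?thesis by simp
  qed
  have nonneg: "0 \<le> T s \<bullet> T u" if su: "s \<in> D" "u \<in> D" "\<bar>u - s\<bar> < \<delta>" for s u
  proof -
    define f where "f x = (\<gamma> x - \<gamma> s) \<bullet> T s" for x
    have inj_f: "inj_on f {s-\<delta>..s+\<delta>}"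
    proof (rule inj_onI)
      fix x y assume xy: "x \<in> {s-\<delta>..s+\<delta>}" "y \<in> {s-\<delta>..s+\<delta>}" "f x = f y"
      have "\<gamma> x - \<gamma> s = \<gamma> y - \<gamma> s"
      proof (rule equal_height_imp_eq[OF T(2)[OF su(1)] \<open>\<rho> > 0\<close> tan[OF su(1)] tan[OF su(1)]])
        show "4 * \<rho>\<^sup>2 * gram (\<gamma> x - \<gamma> s) (\<gamma> y - \<gamma> s)
           \<le> (norm (\<gamma> x - \<gamma> s))\<^sup>2 * (norm (\<gamma> y - \<gamma> s))\<^sup>2 * (norm (\<gamma> y - \<gamma> s - (\<gamma> x - \<gamma> s)))\<^sup>2"
          using ge[of s x y] by (simp add: circumradius_ge_def)
        show "norm (\<gamma> x - \<gamma> s) \<le> \<rho>" "norm (\<gamma> y - \<gamma> s) \<le> \<rho>"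
        proof -
          have "\<bar>x - s\<bar> \<le> \<rho>" "\<bar>y - s\<bar> \<le> \<rho>" using xy(1,2) \<delta> by auto
          then show "norm (\<gamma> x - \<gamma> s) \<le> \<rho>" "norm (\<gamma> y - \<gamma> s) \<le> \<rho>"
            using lip'[of x s] lip'[of y s] by linarith+
        qed
      qed (use xy in \<open>simp add: f_def\<close>)
      then show "x = y" using xy \<delta> by (intro eqI) auto
    qed
    have df: "(f has_real_derivative T x \<bullet> T s) (at x)" if "x \<in> D" for x
    proof -
      have "((\<lambda>x. \<gamma> x - \<gamma> s) has_vector_derivative T x) (at x)" using T(1)[OF that] by (auto intro!: derivative_eq_intros)
      from bounded_linear.has_vector_derivative[OF bounded_linear_inner_left this]
      show ?thesis unfolding f_def by (simp add: has_real_derivative_iff_has_vector_derivative)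
    qed
    have "continuous_on UNIV f"
      unfolding f_def by (intro continuous_intros lipschitz_on_continuous_on[OF lip])
    then have cf: "continuous_on K f" for K by (rule continuous_on_subset) simp
    have ss: "T s \<bullet> T s > 0" using T(2)[OF su(1)] by (simp add: norm_eq_1)
    show ?thesis
    proof (cases u s rule: linorder_cases)
      case less
      have "T u \<bullet> T s \<ge> 0"
        by (rule inj_deriv_same_sign'[OF less cf inj_on_subset[OF inj_f] df[OF su(1)] ss df[OF su(2)]])
          (use less su in auto)
      then show ?thesis by (simp add: inner_commute)
    next
      case equal then show ?thesis using ss by simp
    next
      case greater
      have "T u \<bullet> T s \<ge> 0"
        by (rule inj_deriv_same_sign[OF greater cf inj_on_subset[OF inj_f] df[OF su(1)] ss df[OF su(2)]])
          (use greater su in auto)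
      then show ?thesis by (simp add: inner_commute)
    qed
  qed
  have close: "norm (T s - T u) \<le> \<bar>s - u\<bar> / \<rho>" if su: "s \<in> D" "u \<in> D" "\<bar>u - s\<bar> < \<delta>" for s u
  proof (cases "u = s")
    case False
    define d where "d = \<gamma> u - \<gamma> s"
    have d: "norm d \<le> \<bar>u - s\<bar>" by (simp add: d_def lip')
    have "d \<noteq> 0" using eqI[of u s] False su \<delta> by (auto simp: d_def)
    have "norm (T s - T u) \<le> norm d / \<rho>"
    proof (rule tangents_close)
      show "4 * \<rho>\<^sup>2 * gram (T s) d \<le> (norm d)\<^sup>2 * (norm d)\<^sup>2" using tan[OF su(1)] by (simp add: d_def)
      have "\<gamma> s - \<gamma> u = - d" by (simp add: d_def)
      then show "4 * \<rho>\<^sup>2 * gram (T u) d \<le> (norm d)\<^sup>2 * (norm d)\<^sup>2" using tan[OF su(2), of s] by (simp add: gram_def)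
    qed (use su T \<open>\<rho> > 0\<close> nonneg \<open>d \<noteq> 0\<close> d \<delta> in auto)
    also have "\<dots> \<le> \<bar>s - u\<bar> / \<rho>" using d \<open>\<rho> > 0\<close> by (intro divide_right_mono) auto
    finally show ?thesis .
  qed simp
  have "uniformly_continuous_on D T"
    using \<open>\<rho> > 0\<close> \<delta> close
    by (intro local_lipschitz_imp_uniformly_continuous_on[of \<delta> \<rho>]) (auto simp: abs_minus_commute)
  from lipschitz_uniformly_continuous_AE_deriv[OF lip D T(1) this]
  obtain T' where T': "uniformly_continuous_on UNIV T'" "\<And>x. (\<gamma> has_vector_derivative T' x) (at x)"
    "\<And>x. x \<in> D \<Longrightarrow> T' x = T x" by metis
  have "closed {x. norm (T' x) = 1}"
    using uniformly_continuous_imp_continuous[OF T'(1)] by (intro closed_Collect_eq continuous_on_norm continuous_on_const)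
  moreover have "D \<subseteq> {x. norm (T' x) = 1}" using T' T by auto
  ultimately have "closure D \<subseteq> {x. norm (T' x) = 1}" by (rule closure_minimal[rotated])
  then have "norm (T' x) = 1" for x using closure_conegligible[OF D] by auto
  with T' show ?thesis using that by blast
qed

section \<open>Inscribed equilateral polygons\<close>

locale C1_closed_curve =
  fixes \<gamma> T :: curve
  assumes per: "\<gamma> (t + 1) = \<gamma> t"
    and der: "(\<gamma> has_vector_derivative T t) (at t)"
    and unit: "norm (T t) = 1"
    and uc: "uniformly_continuous_on UNIV T"
begin

lemma linear_approx:
  assumes "a \<le> b" and T: "\<And>u. a \<le> u \<Longrightarrow> u \<le> b \<Longrightarrow> norm (T u - w) \<le> e"
  shows "norm (\<gamma> b - \<gamma> a - (b - a) *\<^sub>R w) \<le> e * (b - a)"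
proof -
  define d where "d = \<gamma> b - \<gamma> a - (b - a) *\<^sub>R w"
  define k where "k u = \<gamma> u - u *\<^sub>R w" for u
  have kd: "k b - k a = d" by (simp add: k_def d_def algebra_simps)
  have "(k has_vector_derivative (T u - w)) (at u)" for u
    unfolding k_def by (auto intro!: derivative_eq_intros der)
  then have "(- e * norm d) * b - (- e * norm d) * a \<le> (k b - k a) \<bullet> (- d)"
  proof (rule inner_increment_ge[OF \<open>a \<le> b\<close>])
    show "((*) (- e * norm d) has_real_derivative - e * norm d) (at u)" for u
      by (auto intro!: derivative_eq_intros)
    fix u assume "a \<le> u" "u \<le> b"
    then have "(T u - w) \<bullet> d \<le> e * norm d"
      using T by (meson mult_right_mono norm_cauchy_schwarz norm_ge_zero order_trans)
    then show "- e * norm d \<le> (T u - w) \<bullet> - d" by simp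
  qed
  then have "norm d * norm d \<le> norm d * (e * (b - a))"
    by (simp add: kd power2_norm_eq_inner[symmetric] power2_eq_square algebra_simps)
  moreover have "0 \<le> e * (b - a)"
    using order_trans[OF norm_ge_zero T[of a]] \<open>a \<le> b\<close> by (intro mult_nonneg_nonneg) auto
  ultimately have "norm d \<le> e * (b - a)"
    by (cases "d = 0") auto
  then show ?thesis by (simp add: d_def)
qed

lemma lip1: "norm (\<gamma> t - \<gamma> s) \<le> \<bar>t - s\<bar>"
proof -
  have *: "norm (\<gamma> b - \<gamma> a) \<le> b - a" if "a \<le> b" for a b
    using linear_approx[OF that, of 0 1] unit by simp
  show ?thesis using *[of s t] *[of t s] by (cases "s \<le> t") (simp_all add: norm_minus_commute)
qed

lemma periodic: "periodic1 \<gamma>" by (simp add: periodic1_def per)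

lemma cont: "continuous_on S \<gamma>"
  by (intro continuous_at_imp_continuous_on ballI has_vector_derivative_continuous[OF der])

definition tangent_modulus :: "real \<Rightarrow> real \<Rightarrow> bool" where
  "tangent_modulus \<delta> e \<longleftrightarrow> (\<forall>u s. \<bar>u - s\<bar> \<le> \<delta> \<longrightarrow> norm (T u - T s) \<le> e)"

lemma tangent_modulusD: "tangent_modulus \<delta> e \<Longrightarrow> \<bar>u - s\<bar> \<le> \<delta> \<Longrightarrow> norm (T u - T s) \<le> e"
  by (simp add: tangent_modulus_def)

lemma tangent_modulus_exists:
  assumes "e > 0"
  obtains \<delta> where "\<delta> > 0" "tangent_modulus \<delta> e"
proof -
  obtain d where d: "d > 0" "\<And>u s. dist u s < d \<Longrightarrow> dist (T u) (T s) < e"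
    using uc assms unfolding uniformly_continuous_on_def by (metis UNIV_I)
  show ?thesis
    by (rule that[of "d / 2"]) (use d in \<open>auto simp: tangent_modulus_def dist_real_def dist_norm intro!: less_imp_le\<close>)
qed

text \<open>Close parameters are handled by linear approximation, the others by compactness and
  injectivity. The bound 1/2 is the largest distance on a circle of length 1.\<close>

lemma bilipschitz:
  assumes inj: "\<And>s t. \<gamma> s = \<gamma> t \<Longrightarrow> s - t \<in> \<int>"
  obtains c where "c > 0" "\<And>s t. \<bar>s - t\<bar> \<le> 1/2 \<Longrightarrow> c * \<bar>s - t\<bar> \<le> norm (\<gamma> s - \<gamma> t)"
proof -
  obtain \<delta> where \<delta>: "\<delta> > 0" "tangent_modulus \<delta> (1/2)" using tangent_modulus_exists[of "1/2"] by auto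
  define \<eta> where "\<eta> = min \<delta> (1/2)"
  have \<eta>: "0 < \<eta>" "\<eta> \<le> \<delta>" "\<eta> \<le> 1/2" using \<delta> by (auto simp: \<eta>_def)
  define f where "f x = norm (\<gamma> (fst x + snd x) - \<gamma> (fst x))" for x :: "real \<times> real"
  have contf: "continuous_on K f" for K
    unfolding f_def by (intro continuous_intros continuous_on_compose2[OF cont]) auto
  have "compact ({0..1::real} \<times> {\<eta>..1/2})" by (intro compact_Times compact_Icc)
  moreover have "{0..1::real} \<times> {\<eta>..1/2} \<noteq> {}" using \<eta> by auto
  ultimately obtain m where m: "m \<in> {0..1::real} \<times> {\<eta>..1/2}" "\<And>y. y \<in> {0..1} \<times> {\<eta>..1/2} \<Longrightarrow> f m \<le> f y"
    using continuous_attains_inf[OF _ _ contf] by metis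
  have "f m > 0"
  proof (rule ccontr)
    assume "\<not> f m > 0"
    then have "\<gamma> (fst m + snd m) = \<gamma> (fst m)" by (simp add: f_def)
    then have "snd m \<in> \<int>" using inj by fastforce
    then obtain k where "snd m = of_int k" by (auto simp: Ints_def)
    moreover have "0 < snd m" "snd m < 1" using m(1) \<eta> by (auto simp: mem_Times_iff)
    ultimately show False by simp
  qed
  have ge: "min (1/2) (f m) * (t - s) \<le> norm (\<gamma> t - \<gamma> s)" if st: "s \<le> t" "t - s \<le> 1/2" for s t
  proof (cases "t - s \<le> \<eta>")
    case True
    have "norm (\<gamma> t - \<gamma> s - (t - s) *\<^sub>R T s) \<le> 1/2 * (t - s)"
      by (rule linear_approx[OF st(1)]) (intro tangent_modulusD[OF \<delta>(2)], use True \<eta> in auto)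
    then have "(t - s) - norm (\<gamma> t - \<gamma> s) \<le> 1/2 * (t - s)"
      using norm_triangle_ineq2[of "(t - s) *\<^sub>R T s" "\<gamma> t - \<gamma> s"] st(1) by (simp add: unit norm_minus_commute)
    then have "1/2 * (t - s) \<le> norm (\<gamma> t - \<gamma> s)" by simp
    moreover have "min (1/2) (f m) * (t - s) \<le> 1/2 * (t - s)" using st(1) by (intro mult_right_mono) auto
    ultimately show ?thesis by linarith
  next
    case False
    have "f m \<le> f (frac s, t - s)" using False st frac_ge_0[of s] frac_lt_1[of s] by (intro m) auto
    also have "\<dots> = norm (\<gamma> t - \<gamma> s)"
      using periodic1_add_int[OF periodic, of "frac s + (t - s)" "\<lfloor>s\<rfloor>"]
      by (simp add: f_def periodic1_frac[OF periodic]) (simp add: frac_def)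
    finally have "f m \<le> norm (\<gamma> t - \<gamma> s)" .
    moreover have "min (1/2) (f m) * (t - s) \<le> f m * 1" using st \<open>f m > 0\<close> by (intro mult_mono) auto
    ultimately show ?thesis by linarith
  qed
  show ?thesis
  proof (rule that[of "min (1/2) (f m)"])
    show "min (1/2) (f m) * \<bar>s - t\<bar> \<le> norm (\<gamma> s - \<gamma> t)" if "\<bar>s - t\<bar> \<le> 1/2" for s t
      using ge[of s t] ge[of t s] that by (cases "s \<le> t") (auto simp: norm_minus_commute)
  qed (use \<open>f m > 0\<close> in simp)
qed

text \<open>Up to \<open>\<delta>\<close> all tangents stay within 1/4 of \<open>T s\<close>, so the
  chord a and its extension w both point roughly along \<open>T s\<close> and the distance from the
  base point increases at a definite rate. This is what makes marching by chord length
  possible.\<close>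

lemma chord_growth:
  assumes \<delta>: "tangent_modulus \<delta> (1/4)"
    and h: "0 \<le> h" "h \<le> k" "k \<le> \<delta>"
  shows "(k - h) / 4 \<le> norm (\<gamma> (s + k) - \<gamma> s) - norm (\<gamma> (s + h) - \<gamma> s)"
proof -
  define a where "a = \<gamma> (s + h) - \<gamma> s"
  define w where "w = \<gamma> (s + k) - \<gamma> (s + h)"
  define S where "S = T s"
  have SS: "S \<bullet> S = 1" using unit[of s] by (simp add: S_def norm_eq_1)
  have a: "norm (a - h *\<^sub>R S) \<le> 1/4 * h"
    using linear_approx[of s "s + h" "T s" "1/4"] tangent_modulusD[OF \<delta>] h by (simp add: a_def S_def)
  have w: "norm (w - (k - h) *\<^sub>R S) \<le> 1/4 * (k - h)"
    using linear_approx[of "s + h" "s + k" "T s" "1/4"] tangent_modulusD[OF \<delta>] h by (simp add: w_def S_def)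
  have aw: "\<gamma> (s + k) - \<gamma> s = a + w" by (simp add: a_def w_def)
  have na: "norm a \<le> h" using lip1[of "s + h" s] h by (simp add: a_def)
  have bd: "\<bar>x \<bullet> y\<bar> \<le> c * d" if "norm x \<le> c" "norm y \<le> d" for x y :: R3 and c d
    using Cauchy_Schwarz_ineq2[of x y] mult_mono[OF that] norm_ge_zero[of x] that(1) norm_ge_zero[of y]
    by (meson order_trans)
  have S1: "norm S \<le> 1" by (simp add: S_def unit)
  have "a \<bullet> w = ((a - h *\<^sub>R S) + h *\<^sub>R S) \<bullet> ((w - (k - h) *\<^sub>R S) + (k - h) *\<^sub>R S)" by simp
  also have "\<dots> = (a - h *\<^sub>R S) \<bullet> (w - (k - h) *\<^sub>R S) + (k - h) * ((a - h *\<^sub>R S) \<bullet> S)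
      + h * ((w - (k - h) *\<^sub>R S) \<bullet> S) + h * (k - h)"
    unfolding inner_add_left inner_add_right by (simp add: SS inner_commute)
  \<comment> \<open>The four terms leave 1 - 1/16 - 1/4 - 1/4 = 7/16 of h (k - h), more than the 1/4
    required.\<close>
  also have "\<dots> \<ge> - (1/4 * h * (1/4 * (k - h))) - (k - h) * (1/4 * h) - h * (1/4 * (k - h)) + h * (k - h)"
  proof -
    have "(k - h) * ((a - h *\<^sub>R S) \<bullet> S) \<ge> (k - h) * (- (1/4 * h))"
      using bd[OF a S1] h by (intro mult_left_mono) auto
    moreover have "h * ((w - (k - h) *\<^sub>R S) \<bullet> S) \<ge> h * (- (1/4 * (k - h)))"
      using bd[OF w S1] h by (intro mult_left_mono) argo+
    ultimately show ?thesis using bd[OF a w] by (simp only: mult_minus_right)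
  qed
  also have "- (1/4 * h * (1/4 * (k - h))) - (k - h) * (1/4 * h) - h * (1/4 * (k - h)) + h * (k - h)
      = h * (k - h) * (7 / 16)" by (simp add: field_simps)
  finally have "a \<bullet> w \<ge> h * (k - h) * (7 / 16)" .
  moreover have "h * (k - h) * (7 / 16) \<ge> h * (k - h) * (1/4)" using h by (intro mult_left_mono) auto
  ultimately have awge: "a \<bullet> w \<ge> h * ((k - h) / 4)" by simp
  have "(k - h) / 4 + norm a \<le> norm (a + w)"
  proof (cases "a = 0")
    case True
    have "(k - h) - norm w \<le> 1/4 * (k - h)"
      using norm_triangle_ineq2[of "(k - h) *\<^sub>R S" w] w h by (simp add: S_def unit norm_minus_commute)
    then show ?thesis using True h by simp
  next
    case False
    then have pos: "norm a > 0" by simp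
    have "norm a * ((k - h) / 4) \<le> h * ((k - h) / 4)" using na h by (intro mult_right_mono) auto
    with awge have "norm a * ((k - h) / 4) + norm a * norm a \<le> a \<bullet> (a + w)"
      by (simp add: inner_add_right power2_norm_eq_inner[symmetric] power2_eq_square)
    also have "\<dots> \<le> norm a * norm (a + w)" by (rule norm_cauchy_schwarz)
    finally have "norm a * ((k - h) / 4 + norm a) \<le> norm a * norm (a + w)" by (simp add: distrib_left)
    then show ?thesis using pos by simp
  qed
  then show ?thesis unfolding aw a_def[symmetric] by linarith
qed

text \<open>H inverts the chord length as a function of the arc. The growth rate 1/4 gives the
  factor 4; a change of s moves both ends of the chord, hence the 2. The Lipschitz dependence makes
  the n-fold march continuous in l.\<close>

lemma chord_step:
  assumes \<delta>: "tangent_modulus \<delta> (1/4)" and "\<delta> > 0"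
  obtains H where "\<And>s l. 0 \<le> l \<Longrightarrow> l \<le> \<delta> / 4 \<Longrightarrow> 0 \<le> H s l \<and> H s l \<le> \<delta> \<and> norm (\<gamma> (s + H s l) - \<gamma> s) = l"
    "\<And>s s' l l'. l \<in> {0..\<delta>/4} \<Longrightarrow> l' \<in> {0..\<delta>/4} \<Longrightarrow> \<bar>H s l - H s' l'\<bar> \<le> 4 * (\<bar>l - l'\<bar> + 2 * \<bar>s - s'\<bar>)"
proof -
  have ex: "\<exists>h. 0 \<le> h \<and> h \<le> \<delta> \<and> norm (\<gamma> (s + h) - \<gamma> s) = l" if "0 \<le> l" "l \<le> \<delta> / 4" for s l
  proof (rule IVT')
    show "norm (\<gamma> (s + 0) - \<gamma> s) \<le> l" using that by simp
    show "l \<le> norm (\<gamma> (s + \<delta>) - \<gamma> s)" using chord_growth[OF \<delta>, of 0 \<delta> s] \<open>\<delta> > 0\<close> that by auto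
    show "continuous_on {0..\<delta>} (\<lambda>h. norm (\<gamma> (s + h) - \<gamma> s))"
      by (intro continuous_intros continuous_on_compose2[OF cont]) auto
  qed (use \<open>\<delta> > 0\<close> in simp)
  define H where "H s l = (SOME h. 0 \<le> h \<and> h \<le> \<delta> \<and> norm (\<gamma> (s + h) - \<gamma> s) = l)" for s l
  have H: "0 \<le> H s l \<and> H s l \<le> \<delta> \<and> norm (\<gamma> (s + H s l) - \<gamma> s) = l" if "0 \<le> l" "l \<le> \<delta> / 4" for s l
    using someI_ex[OF ex[OF that, of s]] unfolding H_def .
  have "\<bar>H s l - H s' l'\<bar> \<le> 4 * (\<bar>l - l'\<bar> + 2 * \<bar>s - s'\<bar>)"
    if "l \<in> {0..\<delta>/4}" "l' \<in> {0..\<delta>/4}" for s s' l l'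
  proof -
    define h h' where "h = H s l" and "h' = H s' l'"
    have h: "0 \<le> h" "h \<le> \<delta>" "norm (\<gamma> (s + h) - \<gamma> s) = l" using H[of l s] that by (auto simp: h_def)
    have h': "0 \<le> h'" "h' \<le> \<delta>" "norm (\<gamma> (s' + h') - \<gamma> s') = l'" using H[of l' s'] that by (auto simp: h'_def)
    have "\<bar>h - h'\<bar> / 4 \<le> \<bar>norm (\<gamma> (s + h) - \<gamma> s) - norm (\<gamma> (s + h') - \<gamma> s)\<bar>"
      using chord_growth[OF \<delta>, of h h' s] chord_growth[OF \<delta>, of h' h s] h h' by (cases "h \<le> h'") auto
    moreover have "\<bar>norm (\<gamma> (s + h') - \<gamma> s) - norm (\<gamma> (s' + h') - \<gamma> s')\<bar> \<le> 2 * \<bar>s - s'\<bar>"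
    proof -
      have "norm ((\<gamma> (s + h') - \<gamma> s) - (\<gamma> (s' + h') - \<gamma> s')) = norm ((\<gamma> (s + h') - \<gamma> (s' + h')) - (\<gamma> s - \<gamma> s'))"
        by (rule arg_cong[where f=norm]) simp
      also have "\<dots> \<le> norm (\<gamma> (s + h') - \<gamma> (s' + h')) + norm (\<gamma> s - \<gamma> s')" by (rule norm_triangle_ineq4)
      also have "\<dots> \<le> 2 * \<bar>s - s'\<bar>" using lip1[of "s + h'" "s' + h'"] lip1[of s s'] by simp
      finally show ?thesis
        using norm_triangle_ineq3[of "\<gamma> (s + h') - \<gamma> s" "\<gamma> (s' + h') - \<gamma> s'"] by linarith
    qed
    moreover have "\<bar>l - norm (\<gamma> (s + h') - \<gamma> s)\<bar> \<le> \<bar>l - l'\<bar> + \<bar>norm (\<gamma> (s + h') - \<gamma> s) - l'\<bar>" by linarith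
    moreover have "A \<le> 4 * (C + 2 * E)" if "A / 4 \<le> B" "D \<le> 2 * E" "B \<le> C + D" for A B C D E :: real
      using that by argo
    ultimately show ?thesis unfolding h(3) h'(3) unfolding h_def[symmetric] h'_def[symmetric] by blast
  qed
  with H show ?thesis using that by blast
qed

text \<open>March along the curve with chords of length l; by the intermediate value theorem some l
  makes the n-th step land exactly on the starting point.\<close>
lemma equilateral_inscribed:
  assumes \<delta>: "tangent_modulus \<delta> (1/4)" and "\<delta> > 0"
    and n: "n > 0" "1 / real n \<le> \<delta> / 4"
  obtains l t where "0 < l" "l \<le> 1 / real n" "t 0 = 0" "t n = 1"
    "\<And>k. norm (\<gamma> (t (Suc k)) - \<gamma> (t k)) = l" "\<And>k. t k \<le> t (Suc k)" "\<And>k. t (Suc k) - t k \<le> 4 * l"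
proof -
  obtain H where H: "\<And>s l. 0 \<le> l \<Longrightarrow> l \<le> \<delta> / 4 \<Longrightarrow> 0 \<le> H s l \<and> H s l \<le> \<delta> \<and> norm (\<gamma> (s + H s l) - \<gamma> s) = l"
    and lip: "\<And>s s' l l'. l \<in> {0..\<delta>/4} \<Longrightarrow> l' \<in> {0..\<delta>/4} \<Longrightarrow> \<bar>H s l - H s' l'\<bar> \<le> 4 * (\<bar>l - l'\<bar> + 2 * \<bar>s - s'\<bar>)"
    using chord_step[OF \<delta> \<open>\<delta> > 0\<close>] by blast
  define S where "S k l = ((\<lambda>s. s + H s l) ^^ k) 0" for k l
  have S: "S 0 l = 0" "S (Suc k) l = S k l + H (S k l) l" for k l by (simp_all add: S_def)
  have "\<exists>C. C-lipschitz_on {0..\<delta>/4} (S k)" for k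
  proof (induction k)
    case 0 then show ?case by (intro exI[of _ 0]) (auto simp: S lipschitz_on_def)
  next
    case (Suc k)
    then obtain C where C: "C-lipschitz_on {0..\<delta>/4} (S k)" by blast
    have "(C + 4 * (1 + 2 * C))-lipschitz_on {0..\<delta>/4} (S (Suc k))"
    proof (rule lipschitz_onI)
      fix x y assume xy: "x \<in> {0..\<delta>/4}" "y \<in> {0..\<delta>/4}"
      have "\<bar>S k x - S k y\<bar> \<le> C * \<bar>x - y\<bar>" using lipschitz_onD[OF C xy] by (simp add: dist_real_def)
      moreover have "\<bar>H (S k x) x - H (S k y) y\<bar> \<le> 4 * (\<bar>x - y\<bar> + 2 * \<bar>S k x - S k y\<bar>)" by (rule lip[OF xy])
      ultimately show "dist (S (Suc k) x) (S (Suc k) y) \<le> (C + 4 * (1 + 2 * C)) * dist x y"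
      proof -
        have tri: "\<bar>S (Suc k) x - S (Suc k) y\<bar> \<le> \<bar>S k x - S k y\<bar> + \<bar>H (S k x) x - H (S k y) y\<bar>"
          unfolding S by linarith
        have "A \<le> C * W + 4 * (W + 2 * (C * W))" if "U \<le> C * W" "V \<le> 4 * (W + 2 * U)" "A \<le> U + V" for A U V W
          using that by argo
        from this[OF \<open>\<bar>S k x - S k y\<bar> \<le> _\<close> \<open>\<bar>H (S k x) x - H (S k y) y\<bar> \<le> _\<close> tri]
        show ?thesis unfolding dist_real_def by (simp add: algebra_simps)
      qed
    qed (use lipschitz_on_nonneg[OF C] in simp)
    then show ?case by blast
  qed
  then have cont: "continuous_on {0..\<delta>/4} (S k)" for k using lipschitz_on_continuous_on by blast
  have Hle: "l \<le> H s l" "H s l \<le> 4 * l" if "0 \<le> l" "l \<le> \<delta> / 4" for s l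
  proof -
    show "l \<le> H s l" using H[OF that, of s] lip1[of "s + H s l" s] by simp
    show "H s l \<le> 4 * l" using H[OF that, of s] chord_growth[OF \<delta>, of 0 "H s l" s] by simp
  qed
  have "S k l \<ge> real k * l" if "0 \<le> l" "l \<le> \<delta> / 4" for k l
  proof (induction k)
    case (Suc k)
    then show ?case using Hle(1)[OF that, of "S k l"] by (simp add: S distrib_right)
  qed (simp add: S)
  \<comment> \<open>A step is at least as long as its chord, so n chords of length 1 / n reach the
    parameter 1 or pass it, while chords of length 0 never leave 0.\<close>
  from this[of "1 / real n" n] have "S n (1 / real n) \<ge> 1" using n by simp
  moreover have S0: "S k 0 = 0" for k
  proof (induction k)
    case (Suc k)
    have "H 0 0 = 0" using Hle[of 0 0] \<open>\<delta> > 0\<close> by simp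
    then show ?case using Suc by (simp add: S)
  qed (simp add: S)
  ultimately have "\<exists>l\<ge>0. l \<le> 1 / real n \<and> S n l = 1"
    using n continuous_on_subset[OF cont, of "{0..1 / real n}"] by (intro IVT') auto
  then obtain l where l: "0 \<le> l" "l \<le> 1 / real n" "S n l = 1" by blast
  then have "l > 0" using S0[of n] by (cases "l = 0") auto
  have l4: "l \<le> \<delta> / 4" using l n by simp
  show ?thesis
  proof (rule that[of l "\<lambda>k. S k l"])
    show "norm (\<gamma> (S (Suc k) l) - \<gamma> (S k l)) = l" for k using H[OF l(1) l4] by (simp add: S)
    show "S k l \<le> S (Suc k) l" for k using H[OF l(1) l4] by (simp add: S)
    show "S (Suc k) l - S k l \<le> 4 * l" for k using Hle[OF l(1) l4] by (simp add: S)
  qed (use l \<open>l > 0\<close> S in auto)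
qed

end

section \<open>Equilateral polygons as arc length curves\<close>

lemma polygon_lipschitz1:
  assumes per: "periodic1 p" and pd: "polygon_data n p v s0"
  shows "1-lipschitz_on UNIV p"
proof (rule lipschitz_on_leI)
  fix x y :: real assume "x \<le> y"
  obtain s1 where s1: "s1 \<le> x" and pd1: "polygon_data n p v s1" using polygon_data_start_le[OF per pd] .
  have n: "n > 0" and len: "norm (v (Suc k) - v k) = 1 / real n" for k
    using pd by (auto simp: polygon_data_def)
  have edge: "1-lipschitz_on {s1 + real k / real n..s1 + real (Suc k) / real n} p" for k
  proof (rule lipschitz_onI)
    fix u w assume u: "u \<in> {s1 + real k / real n..s1 + real (Suc k) / real n}"
      and w: "w \<in> {s1 + real k / real n..s1 + real (Suc k) / real n}"
    have pu: "p u = v k + (real n * (u - s1) - real k) *\<^sub>R (v (Suc k) - v k)"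
      by (rule polygon_on_edge[OF pd1]) (use u in auto)
    have pw: "p w = v k + (real n * (w - s1) - real k) *\<^sub>R (v (Suc k) - v k)"
      by (rule polygon_on_edge[OF pd1]) (use w in auto)
    have "p u - p w = (real n * (u - w)) *\<^sub>R (v (Suc k) - v k)"
      unfolding pu pw by (simp add: algebra_simps)
    then show "dist (p u) (p w) \<le> 1 * dist u w"
      using n by (simp add: dist_norm len abs_mult)
  qed simp
  have "1-lipschitz_on {s1..s1 + real m / real n} p" for m
  proof (induction m)
    case (Suc m)
    from lipschitz_on_concat[OF Suc edge[of m]] show ?case by simp
  qed simp
  moreover obtain m where "real n * (y - s1) \<le> real m" using real_arch_simple by blast
  then have "y \<le> s1 + real m / real n" using n by (simp add: field_simps)
  ultimately show "dist (p x) (p y) \<le> 1 * dist x y"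
    using \<open>x \<le> y\<close> s1 by (meson atLeastAtMost_iff lipschitz_onD order_trans)
qed simp

lemma polygon_edge_derivative:
  assumes pd: "polygon_data n p v s0" and u: "s0 + real k / real n < u" "u < s0 + real (Suc k) / real n"
  shows "(p has_vector_derivative real n *\<^sub>R (v (Suc k) - v k)) (at u)"
proof -
  have "((\<lambda>x. v k + (real n * (x - s0) - real k) *\<^sub>R (v (Suc k) - v k))
      has_vector_derivative real n *\<^sub>R (v (Suc k) - v k)) (at u)"
    by (auto intro!: derivative_eq_intros)
  then show ?thesis
    by (rule has_vector_derivative_transform_within_open[where S="{s0 + real k / real n<..<s0 + real (Suc k) / real n}"])
      (use u polygon_on_edge[OF pd, of k] in auto)
qed

lemma polygon_interior:
  assumes "n > 0" "s0 \<le> t" "t \<notin> range (\<lambda>k. s0 + real k / real n)"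
  obtains k where "s0 + real k / real n < t" "t < s0 + real (Suc k) / real n"
proof -
  obtain a where a: "t = s0 + (real (nat \<lfloor>real n * (t - s0)\<rfloor>) + a) / real n" "0 \<le> a" "a < 1"
    using polygon_param[OF assms(1,2)] by metis
  define k where "k = nat \<lfloor>real n * (t - s0)\<rfloor>"
  have t: "t = s0 + (real k + a) / real n" using a(1) by (simp add: k_def)
  have "a \<noteq> 0" using assms(3) t by auto
  then show ?thesis using that[of k] a \<open>n > 0\<close> unfolding t by (simp add: divide_strict_right_mono)
qed

lemma polygon_arclength:
  assumes per: "periodic1 p" and pd: "polygon_data n p v s0"
  shows "p \<in> arclength_curves"
proof -
  have n: "n > 0" and len: "norm (v (Suc k) - v k) = 1 / real n" for k
    using pd by (auto simp: polygon_data_def)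
  obtain s1 where s1: "s1 \<le> 0" and pd1: "polygon_data n p v s1" using polygon_data_start_le[OF per pd] .
  define P where "P t \<longleftrightarrow> (\<exists>D. norm D = 1 \<and> (p has_vector_derivative D) (at t))" for t
  have "negligible {t. \<not> P t}"
  proof (rule AE_periodic)
    show "P (t + 1) \<longleftrightarrow> P t" for t by (simp add: P_def has_vector_derivative_periodic[OF per])
    have neg: "negligible (range (\<lambda>k. s1 + real k / real n))" by (rule countable_imp_negligible) auto
    show "negligible {t \<in> {0..1}. \<not> P t}"
    proof (rule negligible_subset[OF neg], intro subsetI, rule ccontr)
      fix t assume t: "t \<in> {t \<in> {0..1}. \<not> P t}" "t \<notin> range (\<lambda>k. s1 + real k / real n)"
      then obtain k where "s1 + real k / real n < t" "t < s1 + real (Suc k) / real n"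
        using polygon_interior[OF n, of s1 t] s1 by auto
      from polygon_edge_derivative[OF pd1 this] have "P t"
        unfolding P_def using n len by (intro exI[of _ "real n *\<^sub>R (v (Suc k) - v k)"]) simp
      with t show False by simp
    qed
  qed
  moreover have "{t. \<not> (p differentiable (at t) \<and> norm (vector_derivative p (at t)) = 1)} \<subseteq> {t. \<not> P t}"
    by (auto simp: P_def vector_derivative_at intro: differentiableI_vector)
  ultimately have "AE t in lebesgue. p differentiable (at t) \<and> norm (vector_derivative p (at t)) = 1"
    unfolding eventually_ae_filter_negligible by blast
  then show ?thesis using polygon_lipschitz1[OF per pd] per by (auto simp: arclength_curves_def)
qed

definition polygon_curve :: "nat \<Rightarrow> (nat \<Rightarrow> R3) \<Rightarrow> curve" where
  "polygon_curve n v u = (let x = real n * frac u; k = nat \<lfloor>x\<rfloor> in v k + frac x *\<^sub>R (v (Suc k) - v k))"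

lemma periodic1_polygon_curve: "periodic1 (polygon_curve n v)"
  by (simp add: periodic1_def polygon_curve_def frac_1_eq)

lemma polygon_data_polygon_curve:
  assumes n: "n > 0" and per: "\<And>k. v k = v (k mod n)" and len: "\<And>k. norm (v (Suc k) - v k) = 1 / real n"
  shows "polygon_data n (polygon_curve n v) v 0"
proof -
  \<comment> \<open>At a = 1 the floor already belongs to the next edge; that value is recovered
    below as a = 0 on edge \<open>Suc k\<close>.\<close>
  have *: "polygon_curve n v ((real k + a) / real n) = (1 - a) *\<^sub>R v k + a *\<^sub>R v (Suc k)"
    if a: "0 \<le> a" "a < 1" for k a
  proof -
    define i where "i = k mod n"
    have "i < n" using n by (simp add: i_def)
    then have "real i + 1 \<le> real n" by linarith
    then have i: "0 \<le> (real i + a) / real n" "(real i + a) / real n < 1" using a n by auto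
    have "real k = real (k div n) * real n + real i"
      unfolding i_def by (metis div_mult_mod_eq of_nat_add of_nat_mult)
    then have "(real k + a) / real n = (real i + a) / real n + of_int (int (k div n))"
      using n by (simp add: field_simps)
    then have "polygon_curve n v ((real k + a) / real n) = polygon_curve n v ((real i + a) / real n)"
      using periodic1_add_int[OF periodic1_polygon_curve] by metis
    also have "\<dots> = (1 - a) *\<^sub>R v i + a *\<^sub>R v (Suc i)"
    proof -
      have "frac ((real i + a) / real n) = (real i + a) / real n" using i by (simp add: frac_eq)
      then have x: "real n * frac ((real i + a) / real n) = real i + a" using n by simp
      have "\<lfloor>real i + a\<rfloor> = int i" using a by linarith
      then have "frac (real i + a) = a" by (simp add: frac_def)
      with \<open>\<lfloor>real i + a\<rfloor> = int i\<close> show ?thesis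
        unfolding polygon_curve_def Let_def x by (simp add: algebra_simps)
    qed
    also have "v i = v k" using per[of k] by (simp add: i_def)
    also have "v (Suc i) = v (Suc k)" using per[of "Suc i"] per[of "Suc k"] by (simp add: i_def mod_Suc_eq)
    finally show ?thesis .
  qed
  have "polygon_curve n v ((real k + a) / real n) = (1 - a) *\<^sub>R v k + a *\<^sub>R v (Suc k)"
    if a: "0 \<le> a" "a \<le> 1" for k a
  proof (cases "a = 1")
    case True
    then show ?thesis using *[of 0 "Suc k"] by (simp add: add.commute)
  qed (use a * in auto)
  then show ?thesis using n per len unfolding polygon_data_def by auto
qed

section \<open>Convergence of the rescaled inscribed polygons\<close>

context C1_closed_curve
begin

text \<open>Closeness of edge directions to tangents becomes a Lipschitz bound on p - gamma, the
  form of W(1,infinity) closeness used for the distance, the isotopy and the critical pairs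
  alike.\<close>

lemma polygon_perturbation_lipschitz:
  assumes per_p: "periodic1 p" and pd: "polygon_data n p v 0"
    and close: "\<And>k u. k < n \<Longrightarrow> real k / real n \<le> u \<Longrightarrow> u \<le> real (Suc k) / real n \<Longrightarrow>
       norm (real n *\<^sub>R (v (Suc k) - v k) - T u) \<le> e"
  shows "norm ((p t - \<gamma> t) - (p s - \<gamma> s)) \<le> e * \<bar>t - s\<bar>"
proof -
  have n: "n > 0" using pd by (auto simp: polygon_data_def)
  define f where "f t = p t - \<gamma> t" for t
  have perf: "periodic1 f" using per_p periodic by (simp add: f_def periodic1_def)
  define P where "P t \<longleftrightarrow> (\<exists>D. norm D \<le> e \<and> (f has_vector_derivative D) (at t))" for t
  have neg: "negligible {t. \<not> P t}"
  proof (rule AE_periodic)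
    show "P (t + 1) \<longleftrightarrow> P t" for t by (simp add: P_def has_vector_derivative_periodic[OF perf])
    have neg: "negligible (insert 1 (range (\<lambda>k. 0 + real k / real n)))" by (rule countable_imp_negligible) auto
    show "negligible {t \<in> {0..1}. \<not> P t}"
    proof (rule negligible_subset[OF neg], intro subsetI, rule ccontr)
      fix t assume t: "t \<in> {t \<in> {0..1}. \<not> P t}" "t \<notin> insert 1 (range (\<lambda>k. 0 + real k / real n))"
      then obtain k where k: "0 + real k / real n < t" "t < 0 + real (Suc k) / real n"
        using polygon_interior[OF n, of 0 t] by auto
      have "real k / real n < 1" using k t by auto
      then have "k < n" using n by simp
      then have "norm (real n *\<^sub>R (v (Suc k) - v k) - T t) \<le> e" using k by (intro close) auto
      moreover have "(f has_vector_derivative real n *\<^sub>R (v (Suc k) - v k) - T t) (at t)"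
        unfolding f_def by (intro has_vector_derivative_diff polygon_edge_derivative[OF pd k] der)
      ultimately have "P t" unfolding P_def by blast
      with t show False by simp
    qed
  qed
  have "1-lipschitz_on UNIV \<gamma>"
    by (rule lipschitz_onI) (use lip1 in \<open>auto simp: dist_norm\<close>)
  then have "(1 + 1)-lipschitz_on UNIV f"
    unfolding f_def by (intro lipschitz_on_diff polygon_lipschitz1[OF per_p pd])
  then have *: "norm (f b - f a) \<le> e * (b - a)" if "a \<le> b" for a b
    by (rule lipschitz_AE_deriv_bound[OF that lipschitz_on_subset[OF _ subset_UNIV] neg]) (auto simp: P_def)
  show ?thesis
    using *[of s t] *[of t s] unfolding f_def by (cases "s \<le> t") (simp_all add: norm_minus_commute)
qed

definition inscribed :: "nat \<Rightarrow> real \<Rightarrow> (nat \<Rightarrow> real) \<Rightarrow> bool" where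
  "inscribed n l t \<longleftrightarrow> n > 0 \<and> 0 < l \<and> l \<le> 1 / real n \<and> t 0 = 0 \<and> t n = 1 \<and>
     (\<forall>k. norm (\<gamma> (t (Suc k)) - \<gamma> (t k)) = l \<and> t k \<le> t (Suc k) \<and> t (Suc k) - t k \<le> 4 * l)"

text \<open>Scaling about the starting point turns the side length l into 1/n.\<close>
definition inscribed_vertex :: "nat \<Rightarrow> real \<Rightarrow> (nat \<Rightarrow> real) \<Rightarrow> nat \<Rightarrow> R3" where
  "inscribed_vertex n l t k = \<gamma> 0 + (1 / (real n * l)) *\<^sub>R (\<gamma> (t (k mod n)) - \<gamma> 0)"

lemma inscribed_exists: "\<forall>\<^sub>F n in sequentially. \<exists>l t. inscribed n l t"
proof -
  obtain \<delta> where \<delta>: "\<delta> > 0" "tangent_modulus \<delta> (1/4)" using tangent_modulus_exists[of "1/4"] by auto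
  have "\<forall>\<^sub>F n in sequentially. inverse (real n) < \<delta> / 4"
    using \<delta>(1) by (intro order_tendstoD(2)[OF lim_inverse_n]) auto
  then have "\<forall>\<^sub>F n in sequentially. n > 0 \<and> inverse (real n) < \<delta> / 4"
    using eventually_gt_at_top[of 0] by eventually_elim simp
  then show ?thesis
  proof eventually_elim
    case (elim n)
    have "n > 0" "1 / real n \<le> \<delta> / 4" using elim by (simp_all add: inverse_eq_divide)
    show ?case
    proof (rule equilateral_inscribed[OF \<delta>(2,1) \<open>n > 0\<close> \<open>1 / real n \<le> \<delta> / 4\<close>])
      fix l t assume "0 < l" "l \<le> 1 / real n" "t 0 = 0" "t n = 1"
        "\<And>k. norm (\<gamma> (t (Suc k)) - \<gamma> (t k)) = l" "\<And>k. t k \<le> t (Suc k)" "\<And>k. t (Suc k) - t k \<le> 4 * l"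
      then have "inscribed n l t" using \<open>n > 0\<close> by (simp add: inscribed_def)
      then show "\<exists>l t. inscribed n l t" by blast
    qed
  qed
qed

lemma inscribed_vertex_diff:
  assumes "inscribed n l t"
  shows "inscribed_vertex n l t (Suc k) - inscribed_vertex n l t k
     = (1 / (real n * l)) *\<^sub>R (\<gamma> (t (Suc (k mod n))) - \<gamma> (t (k mod n)))"
proof -
  \<comment> \<open>On the last edge the index wraps to 0 whereas t n = 1; both parameters give the
    same point of the closed curve.\<close>
  have "\<gamma> (t (Suc k mod n)) = \<gamma> (t (Suc (k mod n)))"
  proof (cases "Suc (k mod n) = n")
    case True
    then have "Suc k mod n = 0" by (simp add: mod_Suc)
    then show ?thesis using True assms per[of 0] by (simp add: inscribed_def)
  qed (simp add: mod_Suc)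
  then show ?thesis by (simp add: inscribed_vertex_def algebra_simps)
qed

lemma inscribed_polygon_data:
  assumes ins: "inscribed n l t"
  shows "polygon_data n (polygon_curve n (inscribed_vertex n l t)) (inscribed_vertex n l t) 0"
proof (rule polygon_data_polygon_curve)
  show "norm (inscribed_vertex n l t (Suc k) - inscribed_vertex n l t k) = 1 / real n" for k
    using ins by (simp add: inscribed_vertex_diff[OF ins]) (simp add: inscribed_def)
qed (use ins in \<open>auto simp: inscribed_def inscribed_vertex_def\<close>)

text \<open>Replacing the chord by (arc) T and the arc by l costs 4 e l each, and division by l
  leaves 8 e. Likewise t k drifts from k l, and k l from k / n, by at most 4 e each; with the length
  1 / n of the edge this gives the argument of the second modulus.\<close>

lemma inscribed_tangent_close:
  assumes ins: "inscribed n l t" and \<delta>: "tangent_modulus \<delta> e" "4 / real n \<le> \<delta>"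
    and \<delta>': "tangent_modulus \<delta>' e'" "8 * e + 1 / real n \<le> \<delta>'" and "0 < e"
    and k: "k < n" and u: "real k / real n \<le> u" "u \<le> real (Suc k) / real n"
  shows "norm (real n *\<^sub>R (inscribed_vertex n l t (Suc k) - inscribed_vertex n l t k) - T u) \<le> 8 * e + e'"
proof -
  have n: "n > 0" and l: "0 < l" "l \<le> 1 / real n" and t0: "t 0 = 0" "t n = 1"
    and len: "\<And>k. norm (\<gamma> (t (Suc k)) - \<gamma> (t k)) = l" and gap: "\<And>k. t k \<le> t (Suc k)" "\<And>k. t (Suc k) - t k \<le> 4 * l"
    using ins by (auto simp: inscribed_def)
  have nl: "real n * l \<le> 1" using l n by (simp add: field_simps)
  have approx: "norm (\<gamma> (t (Suc k)) - \<gamma> (t k) - (t (Suc k) - t k) *\<^sub>R T (t k)) \<le> 4 * e * l" for k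
  proof -
    have "4 * l \<le> \<delta>" using l \<delta>(2) by simp
    then have "norm (\<gamma> (t (Suc k)) - \<gamma> (t k) - (t (Suc k) - t k) *\<^sub>R T (t k)) \<le> e * (t (Suc k) - t k)"
      using gap[of k] by (intro linear_approx tangent_modulusD[OF \<delta>(1)]) auto
    also have "\<dots> \<le> e * (4 * l)" using gap[of k] \<open>0 < e\<close> by (intro mult_left_mono) auto
    finally show ?thesis by simp
  qed
  have hl: "\<bar>(t (Suc k) - t k) - l\<bar> \<le> 4 * e * l" for k
  proof -
    have "norm ((t (Suc k) - t k) *\<^sub>R T (t k)) = t (Suc k) - t k" using gap(1)[of k] by (simp add: unit)
    then show ?thesis
      using norm_triangle_ineq3[of "\<gamma> (t (Suc k)) - \<gamma> (t k)" "(t (Suc k) - t k) *\<^sub>R T (t k)"] approx[of k] len[of k]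
      by linarith
  qed
  have tk: "\<bar>t k - real k * l\<bar> \<le> 4 * e * l * real k" for k
  proof (induction k)
    case (Suc k)
    have "real (Suc k) * l = real k * l + l" "4 * e * l * real (Suc k) = 4 * e * l * real k + 4 * e * l"
      by (simp_all add: algebra_simps)
    then show ?case using Suc hl[of k] by linarith
  qed (simp add: t0)
  have el: "4 * e * l * real j \<le> 4 * e" if "j \<le> n" for j
  proof -
    have "l * real j \<le> l * real n" using that l by (intro mult_left_mono) auto
    then have "l * real j \<le> 1" using nl by (simp add: mult.commute)
    then have "4 * e * (l * real j) \<le> 4 * e * 1" using \<open>0 < e\<close> by (intro mult_left_mono) auto
    then show ?thesis by (simp add: mult.assoc)
  qed
  have "\<bar>1 - real n * l\<bar> \<le> 4 * e" using tk[of n] el[of n] t0 by simp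
  moreover have eq: "real k / real n - real k * l = (real k / real n) * (1 - real n * l)" using n by (simp add: field_simps)
  have "\<bar>real k / real n - real k * l\<bar> \<le> 1 * \<bar>1 - real n * l\<bar>"
    unfolding eq abs_mult by (intro mult_right_mono) (use k in auto)
  ultimately have kl: "\<bar>real k / real n - real k * l\<bar> \<le> 4 * e" by argo
  have "\<bar>t k - real k * l\<bar> \<le> 4 * e" using tk[of k] el[of k] k by linarith
  moreover have "real (Suc k) / real n = real k / real n + 1 / real n" by (simp add: add_divide_distrib)
  ultimately have "\<bar>t k - u\<bar> \<le> \<delta>'" using kl u \<delta>'(2) by linarith
  then have T2: "norm (T (t k) - T u) \<le> e'" by (rule tangent_modulusD[OF \<delta>'(1)])
  define c where "c = \<gamma> (t (Suc k)) - \<gamma> (t k)"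
  define h where "h = t (Suc k) - t k"
  have "real n *\<^sub>R (inscribed_vertex n l t (Suc k) - inscribed_vertex n l t k) = (1 / l) *\<^sub>R c"
    using n k by (simp add: inscribed_vertex_diff[OF ins] c_def)
  moreover have "(1 / l) *\<^sub>R c - T (t k) = (1 / l) *\<^sub>R ((c - h *\<^sub>R T (t k)) + (h - l) *\<^sub>R T (t k))"
    using l(1) by (simp add: algebra_simps)
  moreover have "norm ((c - h *\<^sub>R T (t k)) + (h - l) *\<^sub>R T (t k)) \<le> 8 * e * l"
    using norm_triangle_ineq[of "c - h *\<^sub>R T (t k)" "(h - l) *\<^sub>R T (t k)"] approx[of k] hl[of k]
    by (simp add: c_def h_def unit)
  then have "(1 / l) * norm ((c - h *\<^sub>R T (t k)) + (h - l) *\<^sub>R T (t k)) \<le> (1 / l) * (8 * e * l)"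
    using l(1) by (intro mult_left_mono) auto
  then have "norm ((1 / l) *\<^sub>R ((c - h *\<^sub>R T (t k)) + (h - l) *\<^sub>R T (t k))) \<le> 8 * e"
    unfolding norm_scaleR using l(1) by simp
  ultimately have "norm (real n *\<^sub>R (inscribed_vertex n l t (Suc k) - inscribed_vertex n l t k) - T (t k)) \<le> 8 * e" by simp
  then show ?thesis
    using norm_triangle_ineq[of "real n *\<^sub>R (inscribed_vertex n l t (Suc k) - inscribed_vertex n l t k) - T (t k)" "T (t k) - T u"] T2
    by simp
qed

lemma inscribed_polygon_converges:
  assumes "e > 0"
  shows "\<forall>\<^sub>F n in sequentially. \<forall>l t. inscribed n l t \<longrightarrow>
    (let p = polygon_curve n (inscribed_vertex n l t) in
      \<forall>x y. norm ((p x - \<gamma> x) - (p y - \<gamma> y)) \<le> e * \<bar>x - y\<bar>)"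
proof -
  obtain \<delta>' where \<delta>': "\<delta>' > 0" "tangent_modulus \<delta>' (e/2)" using tangent_modulus_exists[of "e/2"] assms by auto
  \<comment> \<open>e / 16 makes 8 e1 at most e / 2, and \<open>\<delta>'\<close> / 16 leaves half
    of \<open>\<delta>'\<close> for 1 / n.\<close>
  define e1 where "e1 = min (e / 16) (\<delta>' / 16)"
  have "e1 > 0" using assms \<delta>' by (simp add: e1_def)
  have "e1 \<le> e / 16" by (simp add: e1_def)
  obtain \<delta> where \<delta>: "\<delta> > 0" "tangent_modulus \<delta> e1" using tangent_modulus_exists[OF \<open>e1 > 0\<close>] by auto
  have "\<forall>\<^sub>F n in sequentially. inverse (real n) < min (\<delta> / 4) (\<delta>' / 2)"
    using \<delta>(1) \<delta>'(1) by (intro order_tendstoD(2)[OF lim_inverse_n]) auto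
  then show ?thesis
  proof eventually_elim
    case (elim n)
    have n: "4 / real n \<le> \<delta>" "8 * e1 + 1 / real n \<le> \<delta>'" 
    proof -
      have "1 / real n < \<delta> / 4" "1 / real n < \<delta>' / 2" using elim by (simp_all add: inverse_eq_divide)
      moreover have "e1 \<le> \<delta>' / 16" by (simp add: e1_def)
      ultimately show "4 / real n \<le> \<delta>" "8 * e1 + 1 / real n \<le> \<delta>'" by argo+
    qed
    show ?case unfolding Let_def
    proof (intro allI impI)
      fix l t x y assume ins: "inscribed n l t"
      show "norm ((polygon_curve n (inscribed_vertex n l t) x - \<gamma> x) - (polygon_curve n (inscribed_vertex n l t) y - \<gamma> y)) \<le> e * \<bar>x - y\<bar>"
      proof (rule polygon_perturbation_lipschitz[OF periodic1_polygon_curve inscribed_polygon_data[OF ins]])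
        fix k u assume "k < n" "real k / real n \<le> u" "u \<le> real (Suc k) / real n"
        from inscribed_tangent_close[OF ins \<delta>(2) n(1) \<delta>'(2) n(2) \<open>e1 > 0\<close> this]
        have "norm (real n *\<^sub>R (inscribed_vertex n l t (Suc k) - inscribed_vertex n l t k) - T u) \<le> 8 * e1 + e / 2" .
        also have "8 * e1 + e / 2 \<le> e" using \<open>e1 \<le> e / 16\<close> by argo
        finally show "norm (real n *\<^sub>R (inscribed_vertex n l t (Suc k) - inscribed_vertex n l t k) - T u) \<le> e" .
      qed
    qed
  qed
qed

end

section \<open>Discrete thickness of inscribed polygons\<close>

lemma polygon_vertex:
  assumes "polygon_data n p v s0"
  shows "p (s0 + real k / real n) = v k"
proof -
  have "p (s0 + (real k + 0) / real n) = (1 - 0) *\<^sub>R v k + 0 *\<^sub>R v (Suc k)"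
    using assms unfolding polygon_data_def by (metis order_refl zero_le_one)
  then show ?thesis by simp
qed

text \<open>\<open>disc_thickness\<close> picks some vertex list, so any two lists must agree up to
  a shift. If the start parameters were not aligned, each vertex of one list would lie inside an
  edge of the other; all edges would then be the same vector, and n copies of it cannot close
  up.\<close>

lemma polygon_vertices_unique:
  assumes per: "periodic1 p" and pd: "polygon_data n p v s0" and pd': "polygon_data n p v' s0'"
  obtains j where "\<And>k. v' k = v (j + k)"
proof -
  obtain s1 where s1: "s1 \<le> s0'" and pd1: "polygon_data n p v s1" using polygon_data_start_le[OF per pd] .
  have n: "n > 0" and len: "norm (v (Suc k) - v k) = 1 / real n" and vper: "v k = v (k mod n)" for k
    using pd by (auto simp: polygon_data_def)
  define m where "m = nat \<lfloor>real n * (s0' - s1)\<rfloor>"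
  obtain b where b: "s0' = s1 + (real m + b) / real n" "0 \<le> b" "b < 1"
    using polygon_param[OF n s1] unfolding m_def by metis
  have "b = 0"
  proof (rule ccontr)
    assume "b \<noteq> 0"
    then have "b > 0" using b by simp
    have step: "v (Suc (Suc (m + k))) - v (Suc (m + k)) = v (Suc (m + k)) - v (m + k)" for k
    proof -
      \<comment> \<open>u1 and u2 lie on the same edge k of v', but on the consecutive edges m + k
        and m + k + 1 of v.\<close>
      define u1 where "u1 = s1 + (real (m + k) + (b + 1) / 2) / real n"
      define u2 where "u2 = s1 + (real (m + k) + 1 + b / 2) / real n"
      have u1: "u1 = s0' + (real k + (1 - b) / 2) / real n" and u2: "u2 = s0' + (real k + (1 - b / 2)) / real n"
      proof -
        have "real (m + k) + (b + 1) / 2 = (real m + b) + (real k + (1 - b) / 2)" by (simp add: field_simps)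
        then show "u1 = s0' + (real k + (1 - b) / 2) / real n"
          unfolding u1_def b(1) by (simp only:) (simp only: add_divide_distrib add.assoc)
        have "real (m + k) + 1 + b / 2 = (real m + b) + (real k + (1 - b / 2))" by (simp add: field_simps)
        then show "u2 = s0' + (real k + (1 - b / 2)) / real n"
          unfolding u2_def b(1) by (simp only:) (simp only: add_divide_distrib add.assoc)
      qed
      have "(p has_vector_derivative real n *\<^sub>R (v' (Suc k) - v' k)) (at u1)"
        using b \<open>b > 0\<close> n by (intro polygon_edge_derivative[OF pd']) (simp_all add: u1 divide_strict_right_mono)
      moreover have "(p has_vector_derivative real n *\<^sub>R (v (Suc (m + k)) - v (m + k))) (at u1)"
        using b \<open>b > 0\<close> n by (intro polygon_edge_derivative[OF pd1]) (simp_all add: u1_def divide_strict_right_mono)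
      moreover have "(p has_vector_derivative real n *\<^sub>R (v' (Suc k) - v' k)) (at u2)"
        using b \<open>b > 0\<close> n by (intro polygon_edge_derivative[OF pd']) (simp_all add: u2 divide_strict_right_mono)
      moreover have "(p has_vector_derivative real n *\<^sub>R (v (Suc (Suc (m + k))) - v (Suc (m + k)))) (at u2)"
        using b \<open>b > 0\<close> n by (intro polygon_edge_derivative[OF pd1]) (simp_all add: u2_def divide_strict_right_mono)
      ultimately have "real n *\<^sub>R (v (Suc (Suc (m + k))) - v (Suc (m + k))) = real n *\<^sub>R (v (Suc (m + k)) - v (m + k))"
        using vector_derivative_unique_at by metis
      then show ?thesis using n by simp
    qed
    define d where "d = v (Suc m) - v m"
    have d: "v (Suc (m + k)) - v (m + k) = d" for k
    proof (induction k)
      case (Suc k) then show ?case using step[of k] by simp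
    qed (simp add: d_def)
    have "v (m + k) = v m + real k *\<^sub>R d" for k
    proof (induction k)
      case (Suc k)
      have "v (m + Suc k) = v (m + k) + d" using d[of k] by (simp add: algebra_simps)
      then show ?case using Suc by (simp add: algebra_simps)
    qed simp
    from this[of n] have "real n *\<^sub>R d = 0" using vper[of "m + n"] vper[of m] by simp
    then have "d = 0" using n by simp
    then show False using len[of m] n by (simp add: d_def)
  qed
  have "v' k = v (m + k)" for k
  proof -
    have "s0' + real k / real n = s1 + real (m + k) / real n" by (simp add: b(1) \<open>b = 0\<close> add_divide_distrib)
    then show ?thesis using polygon_vertex[OF pd', of k] polygon_vertex[OF pd1, of "m + k"] by simp
  qed
  then show ?thesis using that by blast
qed

text \<open>For two edges of length r on a circle of radius R, sin(phi/2) = r / (2 R), so the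
  discrete curvature is 1 / sqrt(R^2 - r^2/4): the inverse radius of the circle touching the edges
  at their midpoints. The assumption x \<noteq> z excludes folding back, where the curvature is
  infinite although \<open>circumradius_ge\<close> holds.\<close>

lemma disc_curv_bound:
  assumes r: "norm (y - x) = r" "norm (z - y) = r" "r > 0" and "x \<noteq> z"
    and ge: "circumradius_ge \<rho> x y z" and "\<sigma> > 0" "\<sigma>\<^sup>2 \<le> \<rho>\<^sup>2 - r\<^sup>2 / 4"
  shows "disc_curv x y z \<le> ereal (1 / \<sigma>)"
proof -
  define a b where "a = y - x" and "b = z - y"
  define q where "q = (a \<bullet> b) / r\<^sup>2"
  have aa: "a \<bullet> a = r\<^sup>2" "b \<bullet> b = r\<^sup>2" using r by (simp_all add: a_def b_def power2_norm_eq_inner[symmetric])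
  have r2: "r\<^sup>2 > 0" using r by simp
  have ab: "a \<bullet> b = r\<^sup>2 * q" using r2 by (simp add: q_def)
  have \<phi>: "ext_angle x y z = arccos q"
    using r by (simp add: ext_angle_def q_def a_def b_def power2_eq_square)
  have "\<bar>a \<bullet> b\<bar> \<le> r * r" using Cauchy_Schwarz_ineq2[of a b] r by (simp add: a_def b_def)
  then have "r\<^sup>2 * \<bar>q\<bar> \<le> r\<^sup>2 * 1" unfolding ab abs_mult by (simp add: power2_eq_square)
  then have "\<bar>q\<bar> \<le> 1" using r2 by (simp only: mult_le_cancel_left_pos)
  have zx: "(norm (z - x))\<^sup>2 = r\<^sup>2 * (2 * (1 + q))"
  proof -
    have "z - x = a + b" by (simp add: a_def b_def)
    then show ?thesis
      by (simp add: power2_norm_eq_inner inner_add_left inner_add_right inner_commute aa ab algebra_simps)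
  qed
  have "(norm (z - x))\<^sup>2 > 0" using \<open>x \<noteq> z\<close> by simp
  then have q1: "1 + q > 0" unfolding zx using r2 by (simp add: zero_less_mult_iff)
  with \<open>\<bar>q\<bar> \<le> 1\<close> have q: "-1 < q" "q \<le> 1" by auto
  have g: "gram (y - x) (z - x) = r\<^sup>2 * r\<^sup>2 * (1 - q) * (1 + q)"
    unfolding gram_middle[symmetric, of y x z] unfolding gram_def a_def[symmetric] b_def[symmetric] aa ab
    by (simp add: power2_eq_square algebra_simps)
  have "(r\<^sup>2 * r\<^sup>2 * (1 + q)) * (4 * \<rho>\<^sup>2 * (1 - q)) \<le> (r\<^sup>2 * r\<^sup>2 * (1 + q)) * (2 * r\<^sup>2)"
  proof -
    have "(r\<^sup>2 * r\<^sup>2 * (1 + q)) * (4 * \<rho>\<^sup>2 * (1 - q)) = 4 * \<rho>\<^sup>2 * (r\<^sup>2 * r\<^sup>2 * (1 - q) * (1 + q))"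
      "(r\<^sup>2 * r\<^sup>2 * (1 + q)) * (2 * r\<^sup>2) = r\<^sup>2 * (r\<^sup>2 * (2 * (1 + q))) * r\<^sup>2" by algebra+
    then show ?thesis using ge unfolding circumradius_ge_def g zx r by (simp only:)
  qed
  moreover have "r\<^sup>2 * r\<^sup>2 * (1 + q) > 0" using r2 q1 by simp
  ultimately have le: "4 * \<rho>\<^sup>2 * (1 - q) \<le> 2 * r\<^sup>2" by (simp only: mult_le_cancel_left_pos)
  have "4 * \<sigma>\<^sup>2 * (1 - q) \<le> (4 * \<rho>\<^sup>2 - r\<^sup>2) * (1 - q)"
    using \<open>\<sigma>\<^sup>2 \<le> _\<close> q by (intro mult_right_mono) auto
  also have "\<dots> \<le> r\<^sup>2 * (1 + q)" using le by (simp add: algebra_simps)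
  finally have key: "4 * \<sigma>\<^sup>2 * (1 - q) \<le> r\<^sup>2 * (1 + q)" .
  have ne: "arccos q \<noteq> pi"
  proof
    assume "arccos q = pi"
    then have "cos (arccos q) = -1" by simp
    then show False using q by simp
  qed
  define t where "t = tan (arccos q / 2)"
  have "t = sin (arccos q) / (cos (arccos q) + 1)" unfolding t_def using tan_half[of "arccos q / 2"] by simp
  also have "\<dots> = sqrt (1 - q\<^sup>2) / (1 + q)" using q by (simp add: sin_arccos add.commute)
  finally have "t\<^sup>2 = (1 - q\<^sup>2) / (1 + q)\<^sup>2" using q by (simp add: power_divide abs_square_le_1)
  also have "1 - q\<^sup>2 = (1 - q) * (1 + q)" by (simp add: power2_eq_square algebra_simps)
  finally have t2: "t\<^sup>2 = (1 - q) / (1 + q)" using q1 by (simp add: power2_eq_square)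
  have "(2 * \<sigma> * t)\<^sup>2 = 4 * \<sigma>\<^sup>2 * (1 - q) / (1 + q)" by (simp add: power_mult_distrib t2)
  also have "\<dots> \<le> r\<^sup>2" using key q1 by (simp add: pos_divide_le_eq)
  finally have "2 * \<sigma> * t \<le> r" using r(3) by (rule power2_le_imp_le[OF _ less_imp_le])
  then have "2 * t / r \<le> 1 / \<sigma>" using r \<open>\<sigma> > 0\<close> by (simp add: field_simps)
  moreover have "(dist x y + dist z y) / 2 = r" using r by (simp add: dist_norm norm_minus_commute)
  ultimately show ?thesis using ne by (simp add: disc_curv_def \<phi> t_def)
qed

section \<open>Doubly critical pairs of polygons close to the curve\<close>

context C1_closed_curve
begin

text \<open>At a vertex p has no derivative; instead p (s + h) - p s is h T s up to 2 e |h|, one e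
  from \<open>lip\<close> and one from differentiating gamma. If the inner product exceeded 3 e
  times the distance, the distance would strictly decrease on one side of s and increase on the
  other, so neither kind of extremum could occur.\<close>

lemma near_extremum_orthogonal:
  assumes lip: "\<And>x y. norm ((p x - \<gamma> x) - (p y - \<gamma> y)) \<le> e * \<bar>x - y\<bar>" and "e > 0"
    and ext: "local_extremum (\<lambda>u. (norm (z - p u))\<^sup>2) s" and ne: "z \<noteq> p s"
  shows "\<bar>(z - p s) \<bullet> T s\<bar> \<le> 3 * e * norm (z - p s)"
proof (rule ccontr)
  assume neg: "\<not> ?thesis"
  define D where "D = z - p s"
  have Dpos: "norm D > 0" using ne by (simp add: D_def)
  define a :: real where "a = (if D \<bullet> T s \<ge> 0 then 1 else -1)"
  have a: "a * a = 1" "\<bar>a\<bar> = 1" and DT: "a * (D \<bullet> T s) > 3 * e * norm D"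
    using neg by (auto simp: a_def D_def)
  obtain e1 where e1: "e1 > 0" "(\<forall>u. \<bar>u - s\<bar> < e1 \<longrightarrow> (norm (z - p u))\<^sup>2 \<le> (norm (z - p s))\<^sup>2) \<or>
      (\<forall>u. \<bar>u - s\<bar> < e1 \<longrightarrow> (norm (z - p s))\<^sup>2 \<le> (norm (z - p u))\<^sup>2)"
    using ext unfolding local_extremum_def by blast
  obtain d1 where d1: "d1 > 0" "\<And>y. norm (y - s) < d1 \<Longrightarrow> norm (\<gamma> y - \<gamma> s - (y - s) *\<^sub>R T s) \<le> e * norm (y - s)"
    using der[of s] \<open>e > 0\<close> unfolding has_vector_derivative_def has_derivative_at_alt by blast
  \<comment> \<open>The last bound makes the quadratic term |w|^2 smaller than the margin e |D| k
    that remains from 3 e - 2 e.\<close>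
  define k where "k = min (min (e1 / 2) (d1 / 2)) (e * norm D / (1 + 2 * e)\<^sup>2)"
  have k: "k > 0" "k < e1" "k < d1" using e1 d1 Dpos \<open>e > 0\<close> by (auto simp: k_def)
  have "(1 + 2 * e)\<^sup>2 > 0" using \<open>e > 0\<close> by simp
  then have k2: "(1 + 2 * e)\<^sup>2 * k \<le> e * norm D"
  proof -
    have "k \<le> e * norm D / (1 + 2 * e)\<^sup>2" by (simp add: k_def)
    then show ?thesis using \<open>(1 + 2 * e)\<^sup>2 > 0\<close> by (simp only: pos_le_divide_eq mult.commute)
  qed
  have exp: "\<exists>E. p (s + h) - p s = h *\<^sub>R T s + E \<and> norm E \<le> 2 * e * \<bar>h\<bar>" if "\<bar>h\<bar> < d1" for h
  proof -
    define E where "E = p (s + h) - p s - h *\<^sub>R T s"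
    have "norm E \<le> norm ((p (s + h) - \<gamma> (s + h)) - (p s - \<gamma> s)) + norm (\<gamma> (s + h) - \<gamma> s - h *\<^sub>R T s)"
      using norm_triangle_ineq[of "(p (s + h) - \<gamma> (s + h)) - (p s - \<gamma> s)" "\<gamma> (s + h) - \<gamma> s - h *\<^sub>R T s"]
      by (simp add: E_def algebra_simps)
    also have "\<dots> \<le> e * \<bar>h\<bar> + e * \<bar>h\<bar>" using lip[of "s + h" s] d1(2)[of "s + h"] that by (intro add_mono) auto
    finally show ?thesis by (intro exI[of _ E]) (simp add: E_def)
  qed
  have sq: "(norm (D - w))\<^sup>2 = (norm D)\<^sup>2 - 2 * (D \<bullet> w) + (norm w)\<^sup>2" for w
    by (simp add: power2_norm_eq_inner inner_diff_left inner_diff_right inner_commute)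
  have zD: "z - p (s + h) = D - (p (s + h) - p s)" for h by (simp add: D_def)
  have less: "(norm (z - p (s + a * k)))\<^sup>2 < (norm D)\<^sup>2"
  proof -
    have ak: "\<bar>a * k\<bar> = k" using k by (simp add: abs_mult a)
    obtain E where E: "p (s + a * k) - p s = (a * k) *\<^sub>R T s + E" "norm E \<le> 2 * e * k"
      using exp[of "a * k"] k ak by auto
    define w where "w = (a * k) *\<^sub>R T s + E"
    have "norm w \<le> norm ((a * k) *\<^sub>R T s) + norm E" unfolding w_def by (rule norm_triangle_ineq)
    also have "\<dots> \<le> (1 + 2 * e) * k" using E(2) ak by (simp add: unit algebra_simps)
    finally have "(norm w)\<^sup>2 \<le> ((1 + 2 * e) * k)\<^sup>2" by (intro power_mono) auto
    also have "\<dots> = ((1 + 2 * e)\<^sup>2 * k) * k" by (simp add: power2_eq_square)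
    also have "\<dots> \<le> (e * norm D) * k" using k2 k by (intro mult_right_mono) auto
    finally have w2: "(norm w)\<^sup>2 \<le> e * norm D * k" .
    have "D \<bullet> w = k * (a * (D \<bullet> T s)) + D \<bullet> E" by (simp add: w_def inner_add_right)
    moreover have "k * (3 * e * norm D) < k * (a * (D \<bullet> T s))" using DT k by (intro mult_strict_left_mono) auto
    moreover have "\<bar>D \<bullet> E\<bar> \<le> norm D * (2 * e * k)"
      using Cauchy_Schwarz_ineq2[of D E] mult_left_mono[OF E(2), of "norm D"] by simp
    moreover have "0 < e * norm D * k" using \<open>e > 0\<close> Dpos k by simp
    ultimately have "(norm w)\<^sup>2 < 2 * (D \<bullet> w)"
      using w2 by (simp add: algebra_simps abs_le_iff)
    then show ?thesis unfolding zD E(1) w_def[symmetric] sq by simp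
  qed
  have greater: "(norm D)\<^sup>2 < (norm (z - p (s + - (a * k))))\<^sup>2"
  proof -
    have ak: "\<bar>- (a * k)\<bar> = k" using k by (simp add: abs_mult a)
    obtain E where E: "p (s + - (a * k)) - p s = (- (a * k)) *\<^sub>R T s + E" "norm E \<le> 2 * e * k"
      using exp[of "- (a * k)"] k ak by auto
    define w where "w = (- (a * k)) *\<^sub>R T s + E"
    have "D \<bullet> w = - (k * (a * (D \<bullet> T s))) + D \<bullet> E" by (simp add: w_def inner_diff_right inner_add_right)
    moreover have "k * (3 * e * norm D) < k * (a * (D \<bullet> T s))" using DT k by (intro mult_strict_left_mono) auto
    moreover have "\<bar>D \<bullet> E\<bar> \<le> norm D * (2 * e * k)"
      using Cauchy_Schwarz_ineq2[of D E] mult_left_mono[OF E(2), of "norm D"] by simp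
    moreover have "0 < e * norm D * k" using \<open>e > 0\<close> Dpos k by simp
    ultimately have "D \<bullet> w < 0" by (simp add: algebra_simps abs_le_iff)
    then show ?thesis unfolding zD E(1) w_def[symmetric] sq
      using zero_le_power2[of "norm w"] by linarith
  qed
  have "\<bar>(s + a * k) - s\<bar> < e1" "\<bar>(s + - (a * k)) - s\<bar> < e1" using k by (simp_all add: abs_mult a)
  with e1(2) less greater show False unfolding D_def by (meson not_less)
qed

text \<open>Chords of p and gamma differ by the relative error \<open>\<kappa>\<close> = e / c. The
  chord of gamma is thus almost orthogonal to its tangent, with cosine at most 6 e +
  \<open>\<kappa>\<close>, and a tangent circle of radius at least rho then makes it almost a
  diameter.\<close>

lemma critical_pair_far:
  assumes lip: "\<And>x y. norm ((p x - \<gamma> x) - (p y - \<gamma> y)) \<le> e * \<bar>x - y\<bar>" and "e > 0"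
    and per_p: "periodic1 p"
    and tangent: "\<And>s t. 4 * \<rho>\<^sup>2 * gram (T s) (\<gamma> t - \<gamma> s) \<le> (norm (\<gamma> t - \<gamma> s))\<^sup>2 * (norm (\<gamma> t - \<gamma> s))\<^sup>2"
    and c: "c > 0" "\<And>s t. \<bar>s - t\<bar> \<le> 1/2 \<Longrightarrow> c * \<bar>s - t\<bar> \<le> norm (\<gamma> s - \<gamma> t)"
    and crit: "(x, y) \<in> dcrit p"
    and \<kappa>: "e / c \<le> 1"
  shows "4 * \<rho>\<^sup>2 * ((1 - e / c)\<^sup>2 * (1 - (6 * e + e / c)\<^sup>2)) \<le> (dist x y)\<^sup>2"
proof -
  obtain t0 s where ts: "x = p t0" "y = p s" "p t0 \<noteq> p s" "local_extremum (\<lambda>u. (norm (p t0 - p u))\<^sup>2) s"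
    using crit unfolding dcrit_def by auto
  \<comment> \<open>Another parameter of the same point, at distance at most 1/2 from s, where the
    bilipschitz bound applies.\<close>
  define t where "t = t0 + of_int (round (s - t0))"
  have pt: "p t = p t0" unfolding t_def by (rule periodic1_add_int[OF per_p])
  have "\<bar>t - s\<bar> \<le> 1/2" using of_int_round_abs_le[of "s - t0"] by (simp add: t_def abs_le_iff algebra_simps)
  define D d where "D = p t - p s" and "d = \<gamma> t - \<gamma> s"
  define \<kappa> where "\<kappa> = e / c"
  have \<kappa>: "0 < \<kappa>" "\<kappa> \<le> 1" using assms by (auto simp: \<kappa>_def)
  have DT: "\<bar>D \<bullet> T s\<bar> \<le> 3 * e * norm D"
    unfolding D_def pt by (rule near_extremum_orthogonal[OF lip \<open>e > 0\<close> ts(4) ts(3)])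
  have "e * \<bar>t - s\<bar> = \<kappa> * (c * \<bar>t - s\<bar>)" using c by (simp add: \<kappa>_def)
  also have "\<dots> \<le> \<kappa> * norm d" using c(2)[OF \<open>\<bar>t - s\<bar> \<le> 1/2\<close>] \<kappa> by (intro mult_left_mono) (auto simp: d_def)
  finally have Dd: "norm (D - d) \<le> \<kappa> * norm d"
    using lip[of t s] by (simp add: D_def d_def algebra_simps)
  have nD: "norm D \<le> 2 * norm d"
  proof -
    have "norm D \<le> norm (D - d) + norm d" using norm_triangle_sub[of D d] by simp
    also have "\<dots> \<le> 1 * norm d + norm d" using Dd mult_right_mono[OF \<kappa>(2), of "norm d"] by simp
    finally show ?thesis by simp
  qed
  have "D \<noteq> 0" using ts pt by (simp add: D_def)
  then have dpos: "norm d > 0" using nD by (cases "d = 0") auto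
  have dT: "\<bar>d \<bullet> T s\<bar> \<le> (6 * e + \<kappa>) * norm d"
  proof -
    have "\<bar>(d - D) \<bullet> T s\<bar> \<le> \<kappa> * norm d"
      using Cauchy_Schwarz_ineq2[of "d - D" "T s"] Dd by (simp add: unit norm_minus_commute)
    moreover have "d \<bullet> T s = D \<bullet> T s + (d - D) \<bullet> T s" by (simp add: inner_diff_left)
    moreover have "3 * e * norm D \<le> 3 * e * (2 * norm d)" using nD \<open>e > 0\<close> by (intro mult_left_mono) auto
    ultimately show ?thesis using DT by (simp add: distrib_right abs_le_iff)
  qed
  have "(d \<bullet> T s)\<^sup>2 \<le> ((6 * e + \<kappa>) * norm d)\<^sup>2"
    using power_mono[OF dT, of 2] by simp
  then have "(d \<bullet> T s)\<^sup>2 \<le> (norm d)\<^sup>2 * (6 * e + \<kappa>)\<^sup>2" by (simp only: power_mult_distrib mult.commute)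
  moreover have "gram (T s) d = (norm d)\<^sup>2 - (d \<bullet> T s)\<^sup>2"
    using unit[of s] by (simp add: gram_def norm_eq_1 power2_norm_eq_inner inner_commute)
  ultimately have "gram (T s) d \<ge> (norm d)\<^sup>2 * (1 - (6 * e + \<kappa>)\<^sup>2)"
    by (simp only: right_diff_distrib)
  then have "4 * \<rho>\<^sup>2 * ((norm d)\<^sup>2 * (1 - (6 * e + \<kappa>)\<^sup>2)) \<le> 4 * \<rho>\<^sup>2 * gram (T s) d" by (intro mult_left_mono) auto
  also have "\<dots> \<le> (norm d)\<^sup>2 * (norm d)\<^sup>2" unfolding d_def by (rule tangent)
  finally have "(norm d)\<^sup>2 * (4 * \<rho>\<^sup>2 * (1 - (6 * e + \<kappa>)\<^sup>2)) \<le> (norm d)\<^sup>2 * (norm d)\<^sup>2" by (simp add: mult_ac)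
  moreover have "(norm d)\<^sup>2 > 0" using dpos by simp
  ultimately have d2: "4 * \<rho>\<^sup>2 * (1 - (6 * e + \<kappa>)\<^sup>2) \<le> (norm d)\<^sup>2" by (simp only: mult_le_cancel_left_pos)
  have "norm d - norm D \<le> \<kappa> * norm d" using norm_triangle_ineq2[of d D] Dd by (simp add: norm_minus_commute)
  then have "(1 - \<kappa>) * norm d \<le> norm D" by (simp add: algebra_simps)
  then have "((1 - \<kappa>) * norm d)\<^sup>2 \<le> (norm D)\<^sup>2" using \<kappa> by (intro power_mono) auto
  then have "(1 - \<kappa>)\<^sup>2 * (norm d)\<^sup>2 \<le> (norm D)\<^sup>2" by (simp add: power_mult_distrib)
  moreover have "(1 - \<kappa>)\<^sup>2 * (4 * \<rho>\<^sup>2 * (1 - (6 * e + \<kappa>)\<^sup>2)) \<le> (1 - \<kappa>)\<^sup>2 * (norm d)\<^sup>2"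
    using d2 by (intro mult_left_mono) auto
  ultimately have "4 * \<rho>\<^sup>2 * ((1 - \<kappa>)\<^sup>2 * (1 - (6 * e + \<kappa>)\<^sup>2)) \<le> (norm D)\<^sup>2" by (simp add: mult_ac)
  then show ?thesis by (simp add: \<kappa>_def D_def pt ts dist_norm)
qed

end

section \<open>Ambient isotopy of Lipschitz perturbations\<close>

text \<open>McShane's extension: the largest function with constant K below all cones of slope K
  that stand on the graph of g.\<close>

lemma lipschitz_extension_real:
  fixes g :: "'a::metric_space \<Rightarrow> real"
  assumes lip: "K-lipschitz_on X g" and "X \<noteq> {}"
  obtains G where "K-lipschitz_on UNIV G" "\<And>x. x \<in> X \<Longrightarrow> G x = g x"
proof -
  have "K \<ge> 0" using lip lipschitz_on_nonneg by blast
  define G where "G x = (INF y\<in>X. g y + K * dist x y)" for x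
  obtain y0 where "y0 \<in> X" using \<open>X \<noteq> {}\<close> by blast
  have bdd: "bdd_below ((\<lambda>y. g y + K * dist x y) ` X)" for x
  proof (rule bdd_belowI2)
    fix y assume "y \<in> X"
    have "g y0 - g y \<le> K * dist y0 y"
      using lipschitz_onD[OF lip \<open>y0 \<in> X\<close> \<open>y \<in> X\<close>] by (simp add: dist_real_def abs_le_iff)
    also have "\<dots> \<le> K * (dist x y0 + dist x y)"
      using \<open>K \<ge> 0\<close> dist_triangle3[of y0 y x] by (intro mult_left_mono) auto
    finally show "g y0 - K * dist x y0 \<le> g y + K * dist x y" by (simp add: algebra_simps)
  qed
  have le: "G x \<le> g y + K * dist x y" if "y \<in> X" for x y
    unfolding G_def by (rule cINF_lower[OF bdd that])
  have "G x \<le> G z + K * dist x z" for x z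
  proof -
    have "G x - K * dist x z \<le> G z"
      unfolding G_def[of z]
    proof (rule cINF_greatest[OF \<open>X \<noteq> {}\<close>])
      fix y assume "y \<in> X"
      have "K * dist x y \<le> K * (dist x z + dist z y)"
        using \<open>K \<ge> 0\<close> dist_triangle by (intro mult_left_mono)
      then show "G x - K * dist x z \<le> g y + K * dist z y"
        using le[OF \<open>y \<in> X\<close>, of x] by (simp add: distrib_left)
    qed
    then show ?thesis by simp
  qed
  note GG = this
  have "K-lipschitz_on UNIV G"
  proof (rule lipschitz_onI)
    fix x y
    show "dist (G x) (G y) \<le> K * dist x y"
      using GG[of x y] GG[of y x] by (simp add: dist_real_def dist_commute abs_le_iff)
  qed fact
  moreover have "G x = g x" if "x \<in> X" for x
  proof (rule antisym)
    show "G x \<le> g x" using le[OF that, of x] by simp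
    show "g x \<le> G x" unfolding G_def
    proof (rule cINF_greatest[OF \<open>X \<noteq> {}\<close>])
      fix y assume "y \<in> X"
      show "g x \<le> g y + K * dist x y"
        using lipschitz_onD[OF lip that \<open>y \<in> X\<close>] by (simp add: dist_real_def abs_le_iff)
    qed
  qed
  ultimately show ?thesis using that by blast
qed

text \<open>Coordinates are extended separately, and the sum norm collects them at the price of the
  factor \<open>CARD('n)\<close>. A contraction remains one if the original constant is small
  enough.\<close>

lemma lipschitz_extension_vec:
  fixes g :: "'a::metric_space \<Rightarrow> real ^ 'n"
  assumes lip: "K-lipschitz_on X g" and "X \<noteq> {}"
  obtains G where "(real CARD('n) * K)-lipschitz_on UNIV G" "\<And>x. x \<in> X \<Longrightarrow> G x = g x"
proof -
  have K: "K \<ge> 0" using lip lipschitz_on_nonneg by blast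
  have "\<exists>G. K-lipschitz_on UNIV G \<and> (\<forall>x\<in>X. G x = g x $ i)" for i
  proof -
    have "K-lipschitz_on X (\<lambda>x. g x $ i)"
    proof (rule lipschitz_onI)
      fix x y assume "x \<in> X" "y \<in> X"
      then show "dist (g x $ i) (g y $ i) \<le> K * dist x y"
        using lipschitz_onD[OF lip] dist_vec_nth_le[of "g x" i "g y"] by (meson order_trans)
    qed fact
    then show ?thesis by (rule lipschitz_extension_real[OF _ \<open>X \<noteq> {}\<close>]) auto
  qed
  then obtain F where F: "\<And>i. K-lipschitz_on UNIV (F i)" "\<And>i x. x \<in> X \<Longrightarrow> F i x = g x $ i" by metis
  show ?thesis
  proof (rule that[of "\<lambda>x. \<chi> i. F i x"])
    show "(real CARD('n) * K)-lipschitz_on UNIV (\<lambda>x. \<chi> i. F i x)"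
    proof (rule lipschitz_onI)
      fix x y
      have "dist (\<chi> i. F i x) (\<chi> i. F i y) \<le> (\<Sum>i\<in>UNIV. \<bar>F i x - F i y\<bar>)"
        using norm_le_l1_cart[of "(\<chi> i. F i x) - (\<chi> i. F i y)"] by (simp add: dist_norm)
      also have "\<dots> \<le> (\<Sum>i\<in>(UNIV :: 'n set). K * dist x y)"
        using lipschitz_onD[OF F(1)] by (intro sum_mono) (simp add: dist_real_def)
      finally show "dist (\<chi> i. F i x) (\<chi> i. F i y) \<le> real CARD('n) * K * dist x y" by simp
    qed (use K in simp)
  qed (simp add: F vec_eq_iff)
qed

text \<open>Solving x + G x = y is a fixed point problem for the contraction y - G x; the expansion
  by at least 1 - k makes the inverse Lipschitz.\<close>

lemma lipschitz_perturbation_homeomorphism: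
  fixes G :: "'a::banach \<Rightarrow> 'a"
  assumes lip: "k-lipschitz_on UNIV G" and "k < 1"
  obtains h where "homeomorphism UNIV UNIV (\<lambda>x. x + G x) h"
proof -
  have "k \<ge> 0" using lip lipschitz_on_nonneg by blast
  define F where "F x = x + G x" for x
  have lipG: "norm (G x - G y) \<le> k * norm (x - y)" for x y
    using lipschitz_onD[OF lip, of x y] by (simp add: dist_norm)
  have expand: "(1 - k) * norm (x - y) \<le> norm (F x - F y)" for x y
  proof -
    have "x - y = (F x - F y) - (G x - G y)" by (simp add: F_def)
    then have "norm (x - y) \<le> norm (F x - F y) + norm (G x - G y)" by (metis norm_triangle_ineq4)
    then show ?thesis using lipG[of x y] by (simp add: algebra_simps)
  qed
  have "inj F"
  proof (rule injI)
    fix x y assume "F x = F y"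
    then have "(1 - k) * norm (x - y) \<le> 0" using expand[of x y] by simp
    then show "x = y" using \<open>k < 1\<close> by (simp add: mult_le_0_iff)
  qed
  moreover have "surj F"
    unfolding surj_def
  proof (rule allI)
    fix y
    have "\<forall>x z. dist (y - G x) (y - G z) \<le> k * dist x z"
      using lipG by (simp add: dist_norm norm_minus_commute)
    then obtain x where "y - G x = x"
      using banach_fix_type[OF \<open>k \<ge> 0\<close> \<open>k < 1\<close>, of "\<lambda>x. y - G x"] by blast
    then have "F x = y" by (simp add: F_def algebra_simps)
    then show "\<exists>x. y = F x" by blast
  qed
  ultimately have inv: "\<And>x. inv F (F x) = x" "\<And>y. F (inv F y) = y"
    by (simp_all add: surj_f_inv_f)
  have "(1 / (1 - k))-lipschitz_on UNIV (inv F)"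
  proof (rule lipschitz_onI)
    fix x y
    have "(1 - k) * dist (inv F x) (inv F y) \<le> dist x y" using expand[of "inv F x" "inv F y"] inv by (simp add: dist_norm)
    then show "dist (inv F x) (inv F y) \<le> 1 / (1 - k) * dist x y" using \<open>k < 1\<close> by (simp add: field_simps)
  qed (use \<open>k < 1\<close> in simp)
  then have "continuous_on UNIV (inv F)" by (rule lipschitz_on_continuous_on)
  moreover have "continuous_on UNIV F"
    unfolding F_def by (intro continuous_intros lipschitz_on_continuous_on[OF lip])
  ultimately have "homeomorphism UNIV UNIV F (inv F)"
    by (intro homeomorphismI) (auto simp: inv)
  then show ?thesis using that unfolding F_def by blast
qed

section \<open>Invariance of knot classes under small Lipschitz perturbations\<close>

lemma ambient_isotopic_perturbation:
  assumes iso: "ambient_isotopic K0 K1" and lip: "k-lipschitz_on UNIV G" and "k < 1"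
  shows "ambient_isotopic K0 ((\<lambda>x. x + G x) ` K1)"
proof -
  obtain H :: "real \<times> R3 \<Rightarrow> R3" where H: "continuous_on ({0..1} \<times> UNIV) H"
    "\<And>t. t \<in> {0..1} \<Longrightarrow> \<exists>g. homeomorphism UNIV UNIV (\<lambda>x. H (t, x)) g" "\<And>x. H (0, x) = x" "(\<lambda>x. H (1, x)) ` K0 = K1"
    using iso unfolding ambient_isotopic_def by blast
  \<comment> \<open>During the first half of the time a runs through the given isotopy while b is 0;
    during the second half a rests at 1 and b switches the perturbation on.\<close>
  define a b where "a t = min (2 * t) 1" and "b t = max (2 * t - 1) 0" for t :: real
  define J where "J z = (let y = H (a (fst z), snd z) in y + b (fst z) *\<^sub>R G y)" for z
  have "continuous_on ({0..1} \<times> UNIV) (\<lambda>z. H (a (fst z), snd z))"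
    by (rule continuous_on_compose2[OF H(1)]) (auto simp: a_def intro!: continuous_intros)
  moreover have "continuous_on UNIV G" by (rule lipschitz_on_continuous_on[OF lip])
  ultimately have "continuous_on ({0..1} \<times> UNIV) J"
    unfolding J_def Let_def b_def
    by (intro continuous_intros) (auto intro: continuous_on_compose2)
  moreover have "\<exists>g. homeomorphism UNIV UNIV (\<lambda>x. J (t, x)) g" if t: "t \<in> {0..1}" for t
  proof -
    have "a t \<in> {0..1}" and b: "0 \<le> b t" "b t \<le> 1" using t by (auto simp: a_def b_def)
    then obtain g where g: "homeomorphism UNIV UNIV (\<lambda>x. H (a t, x)) g" using H(2) by blast
    have "(b t * k)-lipschitz_on UNIV (\<lambda>x. b t *\<^sub>R G x)"
      using b by (intro lipschitz_on_cmult_nonneg lip)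
    moreover have "b t * k < 1"
      using b \<open>k < 1\<close> lipschitz_on_nonneg[OF lip] mult_right_mono[of "b t" 1 k] by simp
    ultimately obtain h where "homeomorphism UNIV UNIV (\<lambda>x. x + b t *\<^sub>R G x) h"
      using lipschitz_perturbation_homeomorphism by blast
    from homeomorphism_compose[OF g this] show ?thesis
      by (auto simp: J_def Let_def o_def)
  qed
  moreover have "J (0, x) = x" for x using H(3) by (simp add: J_def a_def b_def)
  moreover have "(\<lambda>x. J (1, x)) ` K0 = (\<lambda>x. x + G x) ` K1"
    unfolding H(4)[symmetric] by (simp add: J_def a_def b_def image_image Let_def)
  ultimately show ?thesis unfolding ambient_isotopic_def by blast
qed

lemma knot_class_perturbation:
  assumes \<K>: "tame_knot_class \<K>" "K \<in> \<K>" and lip: "k-lipschitz_on UNIV G" and "k < 1"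
  shows "(\<lambda>x. x + G x) ` K \<in> \<K>"
proof -
  obtain K0 where K0: "\<K> = {K. is_knot K \<and> ambient_isotopic K0 K}"
    using \<K>(1) unfolding tame_knot_class_def by blast
  obtain h where h: "homeomorphism UNIV UNIV (\<lambda>x. x + G x) h"
    using lipschitz_perturbation_homeomorphism[OF lip \<open>k < 1\<close>] by blast
  have "K homeomorphic (\<lambda>x. x + G x) ` K"
    unfolding homeomorphic_def using homeomorphism_of_subsets[OF h subset_UNIV subset_UNIV refl] by blast
  then have "is_knot ((\<lambda>x. x + G x) ` K)"
    using \<K>(2) K0 unfolding is_knot_def by (metis (mono_tags, lifting) homeomorphic_sym homeomorphic_trans is_knot_def mem_Collect_eq)
  moreover have "ambient_isotopic K0 ((\<lambda>x. x + G x) ` K)"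
    using \<K>(2) K0 ambient_isotopic_perturbation[OF _ lip \<open>k < 1\<close>] by blast
  ultimately show ?thesis by (simp add: K0)
qed

text \<open>Measured against chords of gamma, p - gamma has Lipschitz constant e / c and so becomes
  a map on the image of gamma. Its extension to space has constant 3 (e / c) < 1, and adding it
  carries the image of gamma to that of p. Since e / c < 1, the sum also stays injective along the
  curve.\<close>

lemma (in C1_closed_curve) perturbation_in_class:
  assumes \<K>: "tame_knot_class \<K>" and \<gamma>: "\<gamma> \<in> curves_in \<K>" and p: "p \<in> arclength_curves"
    and lip: "\<And>x y. norm ((p x - \<gamma> x) - (p y - \<gamma> y)) \<le> e * \<bar>x - y\<bar>" and "0 \<le> e"
    and c: "c > 0" "\<And>s t. \<bar>s - t\<bar> \<le> 1/2 \<Longrightarrow> c * \<bar>s - t\<bar> \<le> norm (\<gamma> s - \<gamma> t)"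
    and small: "3 * (e / c) < 1"
  shows "p \<in> curves_in \<K>"
proof -
  define f where "f t = p t - \<gamma> t" for t
  have per_p: "periodic1 p" using p by (simp add: arclength_curves_def)
  have perf: "periodic1 f" using per_p periodic by (simp add: f_def periodic1_def)
  have inj: "inj_on \<gamma> {0..<1}" and K: "\<gamma> ` {0..1} \<in> \<K>" using \<gamma> by (auto simp: curves_in_def)
  have key: "norm (f s - f t) \<le> e / c * norm (\<gamma> s - \<gamma> t)" for s t
  proof -
    define u where "u = t + of_int (round (s - t))"
    have u: "\<gamma> u = \<gamma> t" "f u = f t" unfolding u_def by (simp_all add: periodic1_add_int periodic perf)
    have su: "\<bar>s - u\<bar> \<le> 1/2" using of_int_round_abs_le[of "s - t"] by (simp add: u_def abs_minus_commute algebra_simps)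
    have "norm (f s - f u) \<le> e * \<bar>s - u\<bar>" using lip[of s u] by (simp add: f_def)
    also have "\<dots> = e / c * (c * \<bar>s - u\<bar>)" using c(1) by simp
    also have "\<dots> \<le> e / c * norm (\<gamma> s - \<gamma> u)" using c(2)[OF su] \<open>0 \<le> e\<close> c(1) by (intro mult_left_mono) auto
    finally show ?thesis by (simp add: u)
  qed
  \<comment> \<open>The choice of a preimage is harmless: by \<open>key\<close>, f takes equal
    values at parameters of the same point.\<close>
  define g where "g y = f (SOME t. \<gamma> t = y)" for y
  have g: "g (\<gamma> t) = f t" for t
  proof -
    have "\<gamma> (SOME s. \<gamma> s = \<gamma> t) = \<gamma> t" by (rule someI) simp
    then have "norm (g (\<gamma> t) - f t) \<le> 0" using key[of "SOME s. \<gamma> s = \<gamma> t" t] by (simp add: g_def)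
    then show ?thesis by simp
  qed
  have "(e / c)-lipschitz_on (range \<gamma>) g"
    by (rule lipschitz_onI) (use key \<open>0 \<le> e\<close> c(1) in \<open>auto simp: g dist_norm\<close>)
  then obtain G where G: "(real CARD(3) * (e / c))-lipschitz_on UNIV G" "\<And>x. x \<in> range \<gamma> \<Longrightarrow> G x = g x"
    using lipschitz_extension_vec by blast
  have k1: "real CARD(3) * (e / c) < 1" using small by simp
  have pG: "p t = \<gamma> t + G (\<gamma> t)" for t by (simp add: G(2) g f_def)
  have "p ` {0..1} = (\<lambda>x. x + G x) ` (\<gamma> ` {0..1})" by (simp add: image_image pG)
  also have "\<dots> \<in> \<K>" by (rule knot_class_perturbation[OF \<K> K G(1) k1])
  finally have "p ` {0..1} \<in> \<K>" .
  moreover have "inj_on p {0..<1}"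
  proof (rule inj_onI)
    fix s t assume st: "s \<in> {0..<1}" "t \<in> {0..<1}" "p s = p t"
    have "\<gamma> s - \<gamma> t = - (f s - f t)" using st(3) by (simp add: f_def)
    then have "norm (\<gamma> s - \<gamma> t) \<le> e / c * norm (\<gamma> s - \<gamma> t)" using key[of s t] by (metis norm_minus_cancel)
    moreover have "0 \<le> e / c" using \<open>0 \<le> e\<close> c(1) by simp
    then have "e / c < 1" using small by linarith
    ultimately have "norm (\<gamma> s - \<gamma> t) = 0"
      using mult_strict_right_mono[of "e / c" 1 "norm (\<gamma> s - \<gamma> t)"] by force
    then show "s = t" using inj_onD[OF inj _ st(1,2)] by simp
  qed
  ultimately show ?thesis using p by (simp add: curves_in_def)
qed

section \<open>Gamma-convergence\<close>

lemma circumradius_nonneg: "0 \<le> circumradius x y z"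
proof (cases "collinear {x, y, z}")
  case False
  then show ?thesis by (simp add: circumradius_eq gram_nonneg)
qed (simp add: circumradius_def)

lemma thickness_nonneg: "0 \<le> thickness \<gamma>"
  unfolding thickness_def by (rule Inf_greatest) (auto simp: circumradius_nonneg)

lemma circumradius_ge_of_thickness:
  assumes per: "periodic1 \<gamma>" and "\<rho> > 0" "ereal \<rho> \<le> thickness \<gamma>"
  shows "circumradius_ge \<rho> (\<gamma> a) (\<gamma> b) (\<gamma> c)"
proof (cases "\<gamma> a = \<gamma> b \<or> \<gamma> b = \<gamma> c \<or> \<gamma> a = \<gamma> c")
  case False
  have mem: "\<gamma> t \<in> \<gamma> ` {0..1}" for t
  proof -
    have "frac t \<in> {0..1}" using frac_lt_1[of t] by simp
    then have "\<gamma> (frac t) \<in> \<gamma> ` {0..1}" by (rule imageI)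
    then show ?thesis by (simp only: periodic1_frac[OF per])
  qed
  have "thickness \<gamma> \<le> circumradius (\<gamma> a) (\<gamma> b) (\<gamma> c)"
    unfolding thickness_def
    by (rule Inf_lower, rule CollectI, rule exI[of _ "\<gamma> a"], rule exI[of _ "\<gamma> b"], rule exI[of _ "\<gamma> c"])
      (simp add: mem False[simplified])
  with assms(3) have "ereal \<rho> \<le> circumradius (\<gamma> a) (\<gamma> b) (\<gamma> c)" by (rule order_trans)
  then show ?thesis using circumradius_ge_iff[OF \<open>\<rho> > 0\<close>] by blast
qed (rule circumradius_ge_trivial)

lemma le_thickness:
  assumes per: "periodic1 \<gamma>" and "\<rho> > 0"
    and ge: "\<And>a b c. a < b \<Longrightarrow> b < c \<Longrightarrow> c < a + 1 \<Longrightarrow> circumradius_ge \<rho> (\<gamma> a) (\<gamma> b) (\<gamma> c)"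
  shows "ereal \<rho> \<le> thickness \<gamma>"
  unfolding thickness_def
proof (rule Inf_greatest, clarify)
  fix a b c :: real
  have sorted: "circumradius_ge \<rho> (\<gamma> a) (\<gamma> b) (\<gamma> c)"
    if "0 \<le> a" "a < b" "b < c" "c < 1" for a b c using that by (intro ge) auto
  have any: "circumradius_ge \<rho> (\<gamma> a) (\<gamma> b) (\<gamma> c)"
    if "0 \<le> a" "a < 1" "0 \<le> b" "b < 1" "0 \<le> c" "c < 1" for a b c
  proof -
    consider "a = b \<or> b = c \<or> a = c" | "a < b" "b < c" | "a < c" "c < b" | "b < a" "a < c"
      | "b < c" "c < a" | "c < a" "a < b" | "c < b" "b < a" by argo
    then show ?thesis
    proof cases
      case 1 then show ?thesis by (intro circumradius_ge_trivial) auto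
    next
      case 2 then show ?thesis using sorted that by blast
    next
      case 3 then show ?thesis using sorted[of a c b] that circumradius_ge_swap by blast
    next
      case 4 then show ?thesis using sorted[of b a c] that
        by (metis circumradius_ge_rotate circumradius_ge_swap)
    next
      case 5 then show ?thesis using sorted[of b c a] that by (metis circumradius_ge_rotate)
    next
      case 6 then show ?thesis using sorted[of c a b] that by (metis circumradius_ge_rotate)
    next
      case 7 then show ?thesis using sorted[of c b a] that
        by (metis circumradius_ge_rotate circumradius_ge_swap)
    qed
  qed
  have "circumradius_ge \<rho> (\<gamma> (frac a)) (\<gamma> (frac b)) (\<gamma> (frac c))"
    by (intro any frac_ge_0 frac_lt_1)
  then have "circumradius_ge \<rho> (\<gamma> a) (\<gamma> b) (\<gamma> c)" by (simp add: periodic1_frac[OF per])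
  then show "ereal \<rho> \<le> circumradius (\<gamma> a) (\<gamma> b) (\<gamma> c)" using circumradius_ge_iff[OF \<open>\<rho> > 0\<close>] by blast
qed

section \<open>Discrete thickness and inverses in the extended reals\<close>

lemma disc_curv_nonneg: "0 \<le> disc_curv x y z"
proof (cases "ext_angle x y z = pi")
  case False
  define q where "q = ((y - x) \<bullet> (z - y)) / (norm (y - x) * norm (z - y))"
  \<comment> \<open>Also for coincident points, where division by zero yields q = 0.\<close>
  have "\<bar>q\<bar> \<le> 1"
    using Cauchy_Schwarz_ineq2[of "y - x" "z - y"] by (simp add: q_def abs_mult divide_le_eq)
  then have q: "0 \<le> arccos q" "arccos q \<le> pi" by (auto intro: arccos_lbound arccos_ubound)
  have eq: "ext_angle x y z = arccos q" by (simp add: ext_angle_def q_def)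
  have "tan (arccos q / 2) \<ge> 0" using q False by (intro tan_pos_pi2_le) (auto simp: eq)
  then show ?thesis using False by (simp add: disc_curv_def eq)
qed (simp add: disc_curv_def)

lemma disc_curv_le_maxCurv: "i \<in> {1..n} \<Longrightarrow> disc_curv (v (i - 1)) (v i) (v (Suc i)) \<le> maxCurv n v"
  unfolding maxCurv_def by (rule Max_ge) auto

lemma maxCurv_le:
  assumes "n > 0" "\<And>i. i \<in> {1..n} \<Longrightarrow> disc_curv (v (i - 1)) (v i) (v (Suc i)) \<le> C"
  shows "maxCurv n v \<le> C"
proof -
  have "{disc_curv (v (i - 1)) (v i) (v (Suc i)) | i. i \<in> {1..n}} \<noteq> {}" using assms(1) by (auto intro!: exI[of _ 1])
  then show ?thesis unfolding maxCurv_def using assms(2) by (subst Max_le_iff) auto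
qed

lemma maxCurv_nonneg: "n > 0 \<Longrightarrow> 0 \<le> maxCurv n v"
  by (rule order_trans[OF disc_curv_nonneg disc_curv_le_maxCurv[of 1]]) simp

lemma ereal_inverse_nonneg: "0 \<le> inverse x" if "0 \<le> x" for x :: ereal
  using that by (cases x) auto

lemma ereal_inverse_less_imp:
  fixes x :: ereal
  assumes "0 \<le> x" "inverse x < ereal M"
  shows "M > 0" "ereal (1 / M) < x"
proof -
  have "0 < ereal M" using ereal_inverse_nonneg[OF assms(1)] assms(2) by (rule le_less_trans)
  then show "M > 0" by simp
  then show "ereal (1 / M) < x"
    using assms by (cases x) (auto simp: field_simps split: if_splits)
qed

lemma ereal_le_inverse:
  fixes x :: ereal
  assumes "0 \<le> x" "x \<le> ereal (1 / \<rho>)" "\<rho> > 0"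
  shows "ereal \<rho> \<le> inverse x"
  using assms by (cases x) (auto simp: field_simps)

lemma ereal_less_inverse_imp:
  fixes x :: ereal
  assumes "0 \<le> x" "ereal \<rho> < inverse x" "\<rho> > 0"
  shows "x \<le> ereal (1 / \<rho>)"
  using assms by (cases x) (auto simp: field_simps split: if_splits)

lemma dcsd_nonneg: "0 \<le> dcsd p"
  unfolding dcsd_def by (rule Inf_greatest) auto

lemma disc_thickness_nonneg:
  assumes "n > 0"
  shows "0 \<le> disc_thickness n p"
proof -
  have "0 \<le> minRad n v" for v
    unfolding minRad_def by (intro ereal_inverse_nonneg maxCurv_nonneg assms)
  moreover have "0 \<le> dcsd p / 2" using dcsd_nonneg[of p] by (cases "dcsd p") auto
  ultimately show ?thesis by (simp add: disc_thickness_def Let_def)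
qed

lemma disc_thickness_gt:
  assumes p: "p \<in> polygons n" and "\<rho> > 0" and gt: "ereal \<rho> < disc_thickness n p"
  obtains v s0 where "polygon_data n p v s0"
    "\<And>i. i \<in> {1..n} \<Longrightarrow> disc_curv (v (i - 1)) (v i) (v (Suc i)) \<le> ereal (1 / \<rho>)"
    "ereal (2 * \<rho>) \<le> dcsd p"
proof -
  define v where "v = (SOME v. \<exists>s0. polygon_data n p v s0)"
  have "\<exists>v s0. polygon_data n p v s0" using p by (simp add: polygons_def)
  then have "\<exists>s0. polygon_data n p v s0" unfolding v_def by (rule someI_ex)
  then obtain s0 where pd: "polygon_data n p v s0" by blast
  then have n: "n > 0" by (simp add: polygon_data_def)
  have dt: "disc_thickness n p = (if inj_on v {1..n} then min (minRad n v) (dcsd p / 2) else 0)"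
    by (simp add: disc_thickness_def v_def)
  with gt \<open>\<rho> > 0\<close> have "ereal \<rho> < min (minRad n v) (dcsd p / 2)"
    by (auto split: if_splits)
  then have *: "ereal \<rho> < inverse (maxCurv n v)" "ereal \<rho> < dcsd p / 2" by (auto simp: minRad_def)
  have "maxCurv n v \<le> ereal (1 / \<rho>)"
    by (rule ereal_less_inverse_imp[OF maxCurv_nonneg[OF n] *(1) \<open>\<rho> > 0\<close>])
  then have "\<And>i. i \<in> {1..n} \<Longrightarrow> disc_curv (v (i - 1)) (v i) (v (Suc i)) \<le> ereal (1 / \<rho>)"
    using disc_curv_le_maxCurv order_trans by blast
  moreover have "ereal (2 * \<rho>) \<le> dcsd p"
    using *(2) dcsd_nonneg[of p] by (cases "dcsd p") auto
  ultimately show ?thesis using that pd by blast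
qed

text \<open>If the inequality failed, some real M would separate the two sides. Along a subsequence
  the functionals stay below M, hence are finite; there the curves are polygons of discrete
  thickness above 1 / M, and this bound passes to gamma.\<close>

lemma F_lim_le_liminf:
  assumes \<gamma>s: "\<And>n. n \<ge> 3 \<Longrightarrow> \<gamma>s n \<in> curves_in \<K>" and \<gamma>: "\<gamma> \<in> curves_in \<K>"
    and conv: "(\<lambda>n. w1inf_dist (\<gamma>s n) \<gamma>) \<longlonglongrightarrow> 0"
  shows "F_lim \<gamma> \<le> liminf (\<lambda>n. F_n \<K> n (\<gamma>s n))"
proof (rule ccontr)
  assume "\<not> ?thesis"
  then have "liminf (\<lambda>n. F_n \<K> n (\<gamma>s n)) < F_lim \<gamma>" by simp
  then obtain M where M: "liminf (\<lambda>n. F_n \<K> n (\<gamma>s n)) < ereal M" "ereal M < F_lim \<gamma>"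
    using ereal_dense2 by blast
  \<comment> \<open>The restriction to n \<ge> 3 is kept because membership of
    \<open>\<gamma>s n\<close> in the class is known only there.\<close>
  define S where "S = {n. 3 \<le> n \<and> F_n \<K> n (\<gamma>s n) < ereal M}"
  have "\<not> (\<forall>\<^sub>F n in sequentially. ereal M \<le> F_n \<K> n (\<gamma>s n))"
    using M(1) Liminf_bounded[of "ereal M" "\<lambda>n. F_n \<K> n (\<gamma>s n)" sequentially] by (auto simp: not_le)
  then have "\<forall>m. \<exists>n\<ge>m. F_n \<K> n (\<gamma>s n) < ereal M"
    unfolding eventually_sequentially by (meson not_le)
  then have "\<forall>m. \<exists>n\<ge>m. n \<in> S"
    unfolding S_def by (metis (no_types, lifting) max.bounded_iff mem_Collect_eq)
  then have "infinite S" by (simp add: infinite_nat_iff_unbounded_le)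
  then obtain r :: "nat \<Rightarrow> nat" where r: "strict_mono r" "\<And>k. r k \<in> S"
    using infinite_enumerate by blast
  define p where "p k = \<gamma>s (r k)" for k
  have rk: "3 \<le> r k" "F_n \<K> (r k) (p k) < ereal M" for k using r(2)[of k] by (auto simp: S_def p_def)
  have pol: "p k \<in> polygons_in (r k) \<K>" for k
    by (rule ccontr) (use rk(2)[of k] in \<open>simp add: F_n_def\<close>)
  have inv: "inverse (disc_thickness (r k) (p k)) < ereal M" for k
    using rk(2)[of k] pol[of k] by (simp add: F_n_def)
  have dtn: "0 \<le> disc_thickness (r k) (p k)" for k using rk(1)[of k] by (intro disc_thickness_nonneg) simp
  define \<rho> where "\<rho> = 1 / M"
  have "M > 0" using ereal_inverse_less_imp(1)[OF dtn inv] .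
  then have "\<rho> > 0" by (simp add: \<rho>_def)
  have dt: "ereal \<rho> < disc_thickness (r k) (p k)" for k
    unfolding \<rho>_def using ereal_inverse_less_imp(2)[OF dtn inv] .
  have "\<exists>v s0. polygon_data (r k) (p k) v s0 \<and>
    (\<forall>i\<in>{1..r k}. disc_curv (v (i - 1)) (v i) (v (Suc i)) \<le> ereal (1 / \<rho>)) \<and> ereal (2 * \<rho>) \<le> dcsd (p k)" for k
  proof -
    have "p k \<in> polygons (r k)" using pol[of k] by (simp add: polygons_in_def)
    then show ?thesis by (rule disc_thickness_gt[OF _ \<open>\<rho> > 0\<close> dt]) blast
  qed
  then obtain v s0 where pd: "\<And>k. polygon_data (r k) (p k) (v k) (s0 k)"
    and dc: "\<And>k i. i \<in> {1..r k} \<Longrightarrow> disc_curv (v k (i - 1)) (v k i) (v k (Suc i)) \<le> ereal (1 / \<rho>)"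
    and dcsd: "\<And>k. ereal (2 * \<rho>) \<le> dcsd (p k)"
    by metis
  have arc: "\<gamma> \<in> arclength_curves" "\<And>k. p k \<in> arclength_curves" "\<And>k. inj_on (p k) {0..<1}"
    using \<gamma> pol by (auto simp: curves_in_def polygons_in_def)
  have conv': "(\<lambda>k. w1inf_dist (p k) \<gamma>) \<longlonglongrightarrow> 0"
    using LIMSEQ_subseq_LIMSEQ[OF conv r(1)] by (simp add: p_def o_def)
  have "ereal \<rho> \<le> thickness \<gamma>"
  proof (rule le_thickness[OF _ \<open>\<rho> > 0\<close>])
    show "periodic1 \<gamma>" using arc by (simp add: arclength_curves_def)
    show "circumradius_ge \<rho> (\<gamma> a) (\<gamma> b) (\<gamma> c)" if "a < b" "b < c" "c < a + 1" for a b c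
      by (rule limit_of_thick_polygons[OF arc \<open>\<rho> > 0\<close> conv' filterlim_subseq[OF r(1)] pd dc dcsd that])
  qed
  then have "F_lim \<gamma> \<le> inverse (ereal \<rho>)"
    unfolding F_lim_def using \<open>\<rho> > 0\<close> by (intro ereal_inverse_antimono) auto
  also have "\<dots> = ereal M" using \<open>M > 0\<close> by (simp add: \<rho>_def)
  finally show False using M(2) by simp
qed

section \<open>The limsup inequality\<close>

lemma w1inf_dist_le:
  assumes \<gamma>: "\<gamma> \<in> arclength_curves" and p: "p \<in> arclength_curves"
    and lip: "\<And>x y. norm ((p x - \<gamma> x) - (p y - \<gamma> y)) \<le> e * \<bar>x - y\<bar>" and "0 \<le> e" and p0: "p 0 = \<gamma> 0"
  shows "w1inf_dist p \<gamma> \<le> 2 * e"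
proof -
  define f where "f t = p t - \<gamma> t" for t
  have lipf: "norm (f x - f y) \<le> e * \<bar>x - y\<bar>" for x y using lip by (simp add: f_def)
  \<comment> \<open>Each part of the norm is at most e: the supremum because f vanishes at 0 and one
    period has length 1, the essential bound because e is a Lipschitz constant of f.\<close>
  have "(SUP t\<in>{0..1}. norm (f t)) \<le> e"
  proof (rule cSUP_least)
    fix t :: real assume "t \<in> {0..1}"
    then have "norm (f t) \<le> e * t" using lipf[of t 0] p0 by (simp add: f_def)
    also have "\<dots> \<le> e * 1" using \<open>t \<in> {0..1}\<close> \<open>0 \<le> e\<close> by (intro mult_left_mono) auto
    finally show "norm (f t) \<le> e" by simp
  qed simp
  moreover have "Inf {C. 0 \<le> C \<and> (AE t in lebesgue_on {0..1}. norm (vector_derivative f (at t)) \<le> C)} \<le> e"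
  proof (rule cInf_lower)
    have "AE t in lebesgue. norm (vector_derivative f (at t)) \<le> e"
    proof -
      have "AE t in lebesgue. p differentiable (at t) \<and> norm (vector_derivative p (at t)) = 1"
        "AE t in lebesgue. \<gamma> differentiable (at t) \<and> norm (vector_derivative \<gamma> (at t)) = 1"
        using p \<gamma> by (simp_all add: arclength_curves_def)
      then show ?thesis
      proof eventually_elim
        case (elim t)
        then have "f differentiable (at t)" unfolding f_def by (intro differentiable_diff) auto
        then have "(f has_vector_derivative vector_derivative f (at t)) (at t)" by (simp flip: vector_derivative_works)
        then show "norm (vector_derivative f (at t)) \<le> e" by (rule lipschitz_deriv_bound[OF lipf])
      qed
    qed
    then have "AE t in lebesgue_on {0..1}. norm (vector_derivative f (at t)) \<le> e"
      by (subst AE_restrict_space_iff) auto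
    then show "e \<in> {C. 0 \<le> C \<and> (AE t in lebesgue_on {0..1}. norm (vector_derivative f (at t)) \<le> C)}"
      using \<open>0 \<le> e\<close> by simp
  qed (auto intro: bdd_belowI[of _ 0])
  ultimately show ?thesis by (simp add: w1inf_dist_def w1inf_norm_def f_def[abs_def])
qed

text \<open>Scaling multiplies the left side of the polynomial condition by m^4 and the right side
  by m^6. Inscribed polygons are scaled by 1 / (n l), which is at least 1 since l \<le> 1 /
  n.\<close>

lemma circumradius_ge_scale:
  assumes "circumradius_ge \<rho> x y z" "m \<ge> 1"
  shows "circumradius_ge \<rho> (w + m *\<^sub>R (x - w)) (w + m *\<^sub>R (y - w)) (w + m *\<^sub>R (z - w))"
proof -
  have d: "(w + m *\<^sub>R (a - w)) - (w + m *\<^sub>R (b - w)) = m *\<^sub>R (a - b)" for a b by (simp add: algebra_simps)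
  define N where "N = (norm (y - x))\<^sup>2 * (norm (z - x))\<^sup>2 * (norm (z - y))\<^sup>2"
  have g: "gram (m *\<^sub>R (y - x)) (m *\<^sub>R (z - x)) = m^4 * gram (y - x) (z - x)"
    unfolding gram_def by (simp add: algebra_simps power2_eq_square power4_eq_xxxx)
  have "4 * \<rho>\<^sup>2 * (m^4 * gram (y - x) (z - x)) = m^4 * (4 * \<rho>\<^sup>2 * gram (y - x) (z - x))" by simp
  also have "\<dots> \<le> m^4 * N" using assms unfolding circumradius_ge_def N_def by (intro mult_left_mono) auto
  also have "\<dots> \<le> m^6 * N" using assms(2) by (intro mult_right_mono power_increasing) (auto simp: N_def)
  also have "\<dots> = (norm (m *\<^sub>R (y - x)))\<^sup>2 * (norm (m *\<^sub>R (z - x)))\<^sup>2 * (norm (m *\<^sub>R (z - y)))\<^sup>2"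
    unfolding N_def by (simp add: power_mult_distrib mult_ac flip: power_add)
  finally show ?thesis unfolding circumradius_ge_def d g .
qed

context C1_closed_curve
begin

lemma disc_thickness_inscribed_ge:
  assumes inj: "inj_on p {0..<1}" and ins: "inscribed n l t" and p: "p = polygon_curve n (inscribed_vertex n l t)"
    and n: "n \<ge> 3" and "\<rho> > 0" "\<sigma> > 0"
    and ge: "\<And>a b c. circumradius_ge \<rho> (\<gamma> a) (\<gamma> b) (\<gamma> c)"
    and \<sigma>n: "\<sigma>\<^sup>2 \<le> \<rho>\<^sup>2 - (1 / real n)\<^sup>2 / 4"
    and lip: "\<And>x y. norm ((p x - \<gamma> x) - (p y - \<gamma> y)) \<le> e * \<bar>x - y\<bar>" and "e > 0"
    and c: "c > 0" "\<And>s t. \<bar>s - t\<bar> \<le> 1/2 \<Longrightarrow> c * \<bar>s - t\<bar> \<le> norm (\<gamma> s - \<gamma> t)"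
    and e: "e / c \<le> 1" "\<sigma>\<^sup>2 \<le> \<rho>\<^sup>2 * ((1 - e / c)\<^sup>2 * (1 - (6 * e + e / c)\<^sup>2))"
  shows "ereal \<sigma> \<le> disc_thickness n p"
proof -
  define v where "v = inscribed_vertex n l t"
  have pd: "polygon_data n p v 0" unfolding p v_def by (rule inscribed_polygon_data[OF ins])
  have per_p: "periodic1 p" unfolding p by (rule periodic1_polygon_curve)
  define v' where "v' = (SOME v. \<exists>s0. polygon_data n p v s0)"
  have "\<exists>v s0. polygon_data n p v s0" using pd by blast
  then have "\<exists>s0. polygon_data n p v' s0" unfolding v'_def by (rule someI_ex)
  then obtain s0 where pd': "polygon_data n p v' s0" by blast
  obtain j where j: "\<And>k. v' k = v (j + k)" using polygon_vertices_unique[OF per_p pd pd'] by blast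
  have len: "norm (v' (Suc k) - v' k) = 1 / real n" for k using pd' by (simp add: polygon_data_def)
  \<comment> \<open>Serves twice: for injectivity on {1..n} and, as n \<ge> 3, for the distinctness
    of the two neighbours of a vertex, which \<open>disc_curv_bound\<close> requires.\<close>
  have dist: "v' a \<noteq> v' b" if "a < b" "b < a + n" for a b
  proof
    assume "v' a = v' b"
    then have "p (s0 + real a / real n) = p (s0 + real b / real n)" by (simp add: polygon_vertex[OF pd'])
    then have "(s0 + real b / real n) - (s0 + real a / real n) \<in> \<int>" using periodic1_inj_iff[OF per_p inj] by metis
    moreover have "(s0 + real b / real n) - (s0 + real a / real n) = real (b - a) / real n"
      using that by (simp add: diff_divide_distrib of_nat_diff)
    ultimately obtain m where m: "real (b - a) / real n = of_int m" by (auto simp: Ints_def)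
    have "0 < real (b - a) / real n" "real (b - a) / real n < 1" using that n by auto
    then show False unfolding m by simp
  qed
  have "inj_on v' {1..n}"
  proof (rule linorder_inj_onI)
    fix a b assume "a < b" "a \<in> {1..n}" "b \<in> {1..n}"
    then show "v' a \<noteq> v' b" by (intro dist) auto
  qed auto
  have ge': "circumradius_ge \<rho> (v' a) (v' b) (v' d)" for a b d
  proof -
    have "real n * l \<le> 1" "0 < real n * l" using ins n by (auto simp: inscribed_def field_simps)
    then have "1 / (real n * l) \<ge> 1" by simp
    then show ?thesis unfolding j v_def inscribed_vertex_def by (intro circumradius_ge_scale ge)
  qed
  have "maxCurv n v' \<le> ereal (1 / \<sigma>)"
  proof (rule maxCurv_le)
    fix i assume i: "i \<in> {1..n}"
    then have Suc: "Suc (i - 1) = i" by simp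
    show "disc_curv (v' (i - 1)) (v' i) (v' (Suc i)) \<le> ereal (1 / \<sigma>)"
    proof (rule disc_curv_bound[OF _ len _ _ ge' \<open>\<sigma> > 0\<close> \<sigma>n])
      show "norm (v' i - v' (i - 1)) = 1 / real n" using len[of "i - 1"] unfolding Suc .
      show "v' (i - 1) \<noteq> v' (Suc i)" using i n by (intro dist) auto
    qed (use n in simp)
  qed (use n in simp)
  then have "ereal \<sigma> \<le> minRad n v'"
    unfolding minRad_def using maxCurv_nonneg[of n v'] n \<open>\<sigma> > 0\<close> by (intro ereal_le_inverse) auto
  moreover have "ereal (2 * \<sigma>) \<le> dcsd p"
    unfolding dcsd_def
  proof (rule Inf_greatest, clarify)
    fix x y assume crit: "(x, y) \<in> dcrit p"
    have "4 * \<rho>\<^sup>2 * ((1 - e / c)\<^sup>2 * (1 - (6 * e + e / c)\<^sup>2)) \<le> (dist x y)\<^sup>2"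
    proof (rule critical_pair_far[OF lip \<open>e > 0\<close> per_p _ c crit e(1)])
      show "4 * \<rho>\<^sup>2 * gram (T s) (\<gamma> t - \<gamma> s) \<le> (norm (\<gamma> t - \<gamma> s))\<^sup>2 * (norm (\<gamma> t - \<gamma> s))\<^sup>2" for s t
        using circumradius_ge_tangent[of \<gamma> "T s" s \<rho> "\<gamma> t", OF der ge] by (simp add: unit)
    qed
    moreover have "(2 * \<sigma>)\<^sup>2 = 4 * \<sigma>\<^sup>2" by (simp add: power_mult_distrib)
    ultimately have "(2 * \<sigma>)\<^sup>2 \<le> (dist x y)\<^sup>2" using e(2) by linarith
    then have "2 * \<sigma> \<le> dist x y" by (rule power2_le_imp_le) simp
    then show "ereal (2 * \<sigma>) \<le> ereal (dist x y)" by simp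
  qed
  then have "ereal \<sigma> \<le> dcsd p / 2" by (cases "dcsd p") auto
  ultimately show ?thesis using \<open>inj_on v' {1..n}\<close> by (simp add: disc_thickness_def v'_def[symmetric] Let_def)
qed

text \<open>One sequence has to serve every \<open>\<sigma>\<close> below the thickness, so the
  polygons are fixed first. For a given \<open>\<sigma>\<close> a suitable e is chosen afterwards,
  and then all large n satisfy the bound.\<close>

lemma recovery_sequence:
  assumes \<K>: "tame_knot_class \<K>" and \<gamma>: "\<gamma> \<in> curves_in \<K>"
  shows "\<exists>\<gamma>s. (\<forall>n. \<gamma>s n \<in> curves_in \<K>) \<and> (\<lambda>n. w1inf_dist (\<gamma>s n) \<gamma>) \<longlonglongrightarrow> 0 \<and>
     limsup (\<lambda>n. F_n \<K> n (\<gamma>s n)) \<le> F_lim \<gamma>"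
proof -
  have arc: "\<gamma> \<in> arclength_curves" and inj: "inj_on \<gamma> {0..<1}" using \<gamma> by (auto simp: curves_in_def)
  have "\<gamma> s = \<gamma> t \<Longrightarrow> s - t \<in> \<int>" for s t using periodic1_inj_iff[OF periodic inj] by blast
  then obtain c where c: "c > 0" "\<And>s t. \<bar>s - t\<bar> \<le> 1/2 \<Longrightarrow> c * \<bar>s - t\<bar> \<le> norm (\<gamma> s - \<gamma> t)"
    using bilipschitz by blast
  define P where "P n l t = polygon_curve n (inscribed_vertex n l t)" for n l t
  have close: "\<forall>\<^sub>F n in sequentially. \<forall>l t. inscribed n l t \<longrightarrow>
      (\<forall>x y. norm ((P n l t x - \<gamma> x) - (P n l t y - \<gamma> y)) \<le> e * \<bar>x - y\<bar>)" if "e > 0" for e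
    using inscribed_polygon_converges[OF that] by (simp add: P_def Let_def)
  have Parc: "P n l t \<in> arclength_curves" if "inscribed n l t" for n l t
    unfolding P_def by (rule polygon_arclength[OF periodic1_polygon_curve inscribed_polygon_data[OF that]])
  \<comment> \<open>A Lipschitz constant c / 4 gives 3/4 < 1 in
    \<open>perturbation_in_class\<close>.\<close>
  have c4: "c / 4 > 0" using c(1) by simp
  have "\<forall>\<^sub>F n in sequentially. \<exists>l t. inscribed n l t \<and> P n l t \<in> curves_in \<K>"
    using inscribed_exists close[OF c4]
  proof eventually_elim
    case (elim n)
    then obtain l t where ins: "inscribed n l t" by blast
    have "P n l t \<in> curves_in \<K>"
    proof (rule perturbation_in_class[OF \<K> \<gamma> Parc[OF ins] _ _ c])
      show "norm ((P n l t x - \<gamma> x) - (P n l t y - \<gamma> y)) \<le> c / 4 * \<bar>x - y\<bar>" for x y using elim ins c(1) by blast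
    qed (use c(1) in auto)
    with ins show ?case by blast
  qed
  then obtain N where N: "\<And>n. n \<ge> N \<Longrightarrow> \<exists>l t. inscribed n l t \<and> P n l t \<in> curves_in \<K>"
    unfolding eventually_sequentially by blast
  then have "\<forall>n. \<exists>l t. n \<ge> N \<longrightarrow> inscribed n l t \<and> P n l t \<in> curves_in \<K>" by blast
  then obtain l t where lt: "\<And>n. n \<ge> N \<Longrightarrow> inscribed n (l n) (t n) \<and> P n (l n) (t n) \<in> curves_in \<K>" by metis
  \<comment> \<open>For the finitely many n below N the curve itself is inserted, so that every term
    lies in the class.\<close>
  define \<gamma>s where "\<gamma>s n = (if n \<ge> N then P n (l n) (t n) else \<gamma>)" for n
  have mem: "\<gamma>s n \<in> curves_in \<K>" for n using lt \<gamma> by (simp add: \<gamma>s_def)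
  have close': "\<forall>\<^sub>F n in sequentially. \<forall>x y. norm ((\<gamma>s n x - \<gamma> x) - (\<gamma>s n y - \<gamma> y)) \<le> e * \<bar>x - y\<bar>" if "e > 0" for e
    using close[OF that] eventually_ge_at_top[of N]
  proof eventually_elim
    case (elim n)
    then show ?case using lt[of n] by (simp add: \<gamma>s_def)
  qed
  have start: "\<gamma>s n 0 = \<gamma> 0" for n
  proof (cases "n \<ge> N")
    case True
    then have ins: "inscribed n (l n) (t n)" using lt by blast
    have "P n (l n) (t n) (0 + real 0 / real n) = inscribed_vertex n (l n) (t n) 0"
      unfolding P_def by (rule polygon_vertex[OF inscribed_polygon_data[OF ins]])
    then show ?thesis using ins True by (simp add: \<gamma>s_def inscribed_vertex_def inscribed_def)
  qed (simp add: \<gamma>s_def)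
  have sarc: "\<gamma>s n \<in> arclength_curves" for n using mem[of n] by (simp add: curves_in_def)
  have conv: "(\<lambda>n. w1inf_dist (\<gamma>s n) \<gamma>) \<longlonglongrightarrow> 0"
  proof (rule tendstoI)
    fix e :: real assume "e > 0"
    then have "e / 3 > 0" by simp
    from close'[OF this] show "\<forall>\<^sub>F n in sequentially. dist (w1inf_dist (\<gamma>s n) \<gamma>) 0 < e"
    proof eventually_elim
      case (elim n)
      have "w1inf_dist (\<gamma>s n) \<gamma> \<le> 2 * (e / 3)"
        by (rule w1inf_dist_le[OF arc sarc _ _ start]) (use elim \<open>e > 0\<close> in auto)
      moreover have "0 \<le> w1inf_dist (\<gamma>s n) \<gamma>"
        using norm_le_w1inf_dist[OF sarc arc, of n 0] norm_ge_zero order_trans by blast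
      ultimately show ?case using \<open>e > 0\<close> by simp
    qed
  qed
  have bound: "\<forall>\<^sub>F n in sequentially. F_n \<K> n (\<gamma>s n) \<le> ereal (1 / \<sigma>)"
    if \<sigma>: "\<sigma> > 0" "ereal \<sigma> < thickness \<gamma>" for \<sigma>
  proof -
    \<comment> \<open>The gap between \<open>\<sigma>\<close> and \<open>\<rho>\<close> pays for two
      losses: (1/n)^2 / 4 in the discrete curvature, and the factor depending on e for critical
      pairs.\<close>
    obtain \<rho> where \<rho>: "ereal \<sigma> < ereal \<rho>" "ereal \<rho> < thickness \<gamma>" using ereal_dense2[OF \<sigma>(2)] by blast
    then have "\<sigma> < \<rho>" "\<rho> > 0" using \<sigma> by auto
    have ge: "circumradius_ge \<rho> (\<gamma> a) (\<gamma> b) (\<gamma> d)" for a b d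
      by (rule circumradius_ge_of_thickness[OF periodic \<open>\<rho> > 0\<close> less_imp_le[OF \<rho>(2)]])
    have sq: "\<sigma>\<^sup>2 < \<rho>\<^sup>2" using \<open>\<sigma> < \<rho>\<close> \<sigma>(1) by (intro power_strict_mono) auto
    have "((\<lambda>e. \<rho>\<^sup>2 * ((1 - e / c)\<^sup>2 * (1 - (6 * e + e / c)\<^sup>2))) \<longlongrightarrow> \<rho>\<^sup>2 * ((1 - 0 / c)\<^sup>2 * (1 - (6 * 0 + 0 / c)\<^sup>2))) (at_right 0)"
      using c(1) by (intro tendsto_intros) auto
    then have "\<forall>\<^sub>F e in at_right 0. \<sigma>\<^sup>2 < \<rho>\<^sup>2 * ((1 - e / c)\<^sup>2 * (1 - (6 * e + e / c)\<^sup>2))"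
      using sq by (intro order_tendstoD(1)) auto
    moreover have "\<forall>\<^sub>F e in at_right 0. e < c" "\<forall>\<^sub>F e in at_right (0::real). e > 0"
      using c(1) by (auto simp: eventually_at_right_less intro: eventually_at_right_real[THEN eventually_mono])
    ultimately have "\<forall>\<^sub>F e in at_right 0. \<sigma>\<^sup>2 < \<rho>\<^sup>2 * ((1 - e / c)\<^sup>2 * (1 - (6 * e + e / c)\<^sup>2)) \<and> e < c \<and> e > 0"
      by eventually_elim simp
    then obtain e where e: "\<sigma>\<^sup>2 < \<rho>\<^sup>2 * ((1 - e / c)\<^sup>2 * (1 - (6 * e + e / c)\<^sup>2))" "e < c" "e > 0"
      using eventually_happens trivial_limit_at_right_real by blast
    have "(\<lambda>n. \<rho>\<^sup>2 - (inverse (real n))\<^sup>2 / 4) \<longlonglongrightarrow> \<rho>\<^sup>2 - 0\<^sup>2 / 4"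
      by (intro tendsto_intros lim_inverse_n) simp
    then have "\<forall>\<^sub>F n in sequentially. \<sigma>\<^sup>2 < \<rho>\<^sup>2 - (inverse (real n))\<^sup>2 / 4"
      using sq by (intro order_tendstoD(1)) auto
    with close'[OF e(3)] eventually_ge_at_top[of "max N 3"] show ?thesis
    proof eventually_elim
      case (elim n)
      then have n: "n \<ge> N" "n \<ge> 3" by auto
      have ins: "inscribed n (l n) (t n)" using lt n by blast
      have eq: "\<gamma>s n = polygon_curve n (inscribed_vertex n (l n) (t n))" using n by (simp add: \<gamma>s_def P_def)
      have "ereal \<sigma> \<le> disc_thickness n (\<gamma>s n)"
      proof (rule disc_thickness_inscribed_ge[OF _ ins eq n(2) \<open>\<rho> > 0\<close> \<sigma>(1) ge _ _ e(3) c])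
        show "inj_on (\<gamma>s n) {0..<1}" using mem[of n] by (simp add: curves_in_def)
        show "\<sigma>\<^sup>2 \<le> \<rho>\<^sup>2 - (1 / real n)\<^sup>2 / 4" using elim by (simp add: inverse_eq_divide)
        show "e / c \<le> 1" using e c(1) by simp
      qed (use elim e in auto)
      then have "inverse (disc_thickness n (\<gamma>s n)) \<le> inverse (ereal \<sigma>)"
        using \<sigma>(1) by (intro ereal_inverse_antimono) auto
      moreover have "\<gamma>s n \<in> polygons_in n \<K>"
        using mem[of n] sarc[of n] inscribed_polygon_data[OF ins] eq
        unfolding polygons_in_def polygons_def by auto
      ultimately show ?case using \<sigma>(1) by (simp add: F_n_def inverse_eq_divide)
    qed
  qed
  have "limsup (\<lambda>n. F_n \<K> n (\<gamma>s n)) \<le> F_lim \<gamma>"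
  proof (rule ccontr)
    assume "\<not> ?thesis"
    then have "F_lim \<gamma> < limsup (\<lambda>n. F_n \<K> n (\<gamma>s n))" by simp
    then obtain M where M: "F_lim \<gamma> < ereal M" "ereal M < limsup (\<lambda>n. F_n \<K> n (\<gamma>s n))"
      using ereal_dense2 by blast
    have Mpos: "M > 0" and thick: "ereal (1 / M) < thickness \<gamma>"
      using ereal_inverse_less_imp[OF thickness_nonneg M(1)[unfolded F_lim_def]] by auto
    have "\<forall>\<^sub>F n in sequentially. F_n \<K> n (\<gamma>s n) \<le> ereal M"
      using bound[OF _ thick] Mpos by simp
    then have "limsup (\<lambda>n. F_n \<K> n (\<gamma>s n)) \<le> ereal M" by (rule Limsup_bounded)
    then show False using M(2) by simp
  qed
  with mem conv show ?thesis by blast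
qed

end

lemma limsup_le_F_lim:
  assumes \<K>: "tame_knot_class \<K>" and \<gamma>: "\<gamma> \<in> curves_in \<K>"
  shows "\<exists>\<gamma>s. (\<forall>n. \<gamma>s n \<in> curves_in \<K>) \<and> (\<lambda>n. w1inf_dist (\<gamma>s n) \<gamma>) \<longlonglongrightarrow> 0 \<and>
     limsup (\<lambda>n. F_n \<K> n (\<gamma>s n)) \<le> F_lim \<gamma>"
proof (cases "thickness \<gamma> = 0")
  \<comment> \<open>Here \<open>F_lim \<gamma>\<close> is infinite, since
    \<open>inverse 0 = \<infinity>\<close> in the extended reals, and the constant sequence is a
    recovery sequence.\<close>
  case True
  have "w1inf_dist \<gamma> \<gamma> = 0"
  proof (rule antisym)
    have arc: "\<gamma> \<in> arclength_curves" using \<gamma> by (simp add: curves_in_def)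
    show "w1inf_dist \<gamma> \<gamma> \<le> 0" using w1inf_dist_le[OF arc arc, of 0] by simp
    show "0 \<le> w1inf_dist \<gamma> \<gamma>" using norm_le_w1inf_dist[OF arc arc, of 0] by simp
  qed
  then show ?thesis using \<gamma> True by (intro exI[of _ "\<lambda>n. \<gamma>"]) (simp add: F_lim_def)
next
  case False
  then have "0 < thickness \<gamma>" using thickness_nonneg[of \<gamma>] by (simp add: order_less_le)
  then obtain \<rho> where \<rho>: "0 < ereal \<rho>" "ereal \<rho> < thickness \<gamma>" using ereal_dense2 by blast
  have arc: "\<gamma> \<in> arclength_curves" and inj: "inj_on \<gamma> {0..<1}" using \<gamma> by (auto simp: curves_in_def)
  have per: "periodic1 \<gamma>" using arc by (simp add: arclength_curves_def)
  obtain T where T: "uniformly_continuous_on UNIV T" "\<And>t. (\<gamma> has_vector_derivative T t) (at t)" "\<And>t. norm (T t) = 1"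
    using thick_curve_C1[OF arc inj _ circumradius_ge_of_thickness[OF per _ less_imp_le[OF \<rho>(2)]]] \<rho>(1) by auto
  interpret C1_closed_curve \<gamma> T
    using per T by unfold_locales (auto simp: periodic1_def)
  show ?thesis by (rule recovery_sequence[OF \<K> \<gamma>])
qed

theorem theorem1:
  fixes \<K> :: "R3 set set"
  assumes "tame_knot_class \<K>"
  shows "(\<forall>(\<gamma>s :: nat \<Rightarrow> curve) \<gamma>.
            (\<forall>n\<ge>3. \<gamma>s n \<in> curves_in \<K>) \<and> \<gamma> \<in> curves_in \<K> \<and>
            (\<lambda>n. w1inf_dist (\<gamma>s n) \<gamma>) \<longlonglongrightarrow> 0
            \<longrightarrow> F_lim \<gamma> \<le> liminf (\<lambda>n. F_n \<K> n (\<gamma>s n)))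
       \<and> (\<forall>\<gamma>\<in>curves_in \<K>. \<exists>\<gamma>s :: nat \<Rightarrow> curve.
            (\<forall>n. \<gamma>s n \<in> curves_in \<K>) \<and>
            (\<lambda>n. w1inf_dist (\<gamma>s n) \<gamma>) \<longlonglongrightarrow> 0 \<and>
            limsup (\<lambda>n. F_n \<K> n (\<gamma>s n)) \<le> F_lim \<gamma>)"
  using F_lim_le_liminf limsup_le_F_lim[OF assms] by blast

end
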